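(* The two-sided shift $\tilde\tau$ on $\tilde X$ with the two-sided Erdős measure $\tilde\nu$ is a special automorphism over the two-sided goldenshift $\tilde{\mathcal S}$ on $\tilde X_0$ with the measure $\tilde\mu$, with step (roof) function equal to the length $|B_1|$ of the block beginning with the first coordinate. That is, $\tilde{\mathcal S}(\varepsilon)=\tilde\tau^{|B_1(\varepsilon)|}\varepsilon$ is (mod 0) the first-return map of $\tilde\tau$ to $\tilde X_0$, the first return time is $|B_1(\varepsilon)|$, and for every Borel set $E\subset\tilde X$, $$\tilde\nu(E)=\frac{1}{\int_{\tilde X_0}|B_1|\,d\tilde\mu}\int_{\tilde X_0}\sum_{j=0}^{|B_1(\varepsilon)|-1}\mathbf 1_E(\tilde\tau^{j}\varepsilon)\,d\tilde\mu(\varepsilon).$$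
   Context: $\lambda=\frac{1+\sqrt5}{2}$. $\tilde\Sigma=\{0,1\}^{\mathbb Z}$ with the product measure $\tilde p=\prod_{-\infty}^{\infty}(\frac12,\frac12)$; $\tilde X=\{\varepsilon\in\tilde\Sigma:\varepsilon_k\varepsilon_{k+1}=0\ \forall k\}$; $(\tilde\tau\varepsilon)_k=\varepsilon_{k+1}$. Two-sided normalization $\tilde{\mathfrak n}$: for a one-sided 0-1 sequence $(x_i)_{i\ge k+1}$ let $\mathfrak n((x_i)_{i\ge k+1})=(\varepsilon_i)_{i\ge k}$ be the 0-1 sequence with $\varepsilon_i\varepsilon_{i+1}=0$ and $\sum_{i\ge k}\varepsilon_i\lambda^{-i}=\sum_{i\ge k+1}x_i\lambda^{-i}$ (the greedy expansion). For $x\in\tilde\Sigma$ having infinitely many zeros at negative coordinates, let $0\ge k_1>k_2>\dots$ be all the indices $k\le0$ with $x_k=0$, put $x^{(0)}=x$, and let $x^{(n)}$ be obtained from $x^{(n-1)}$ by replacing its coordinates with indices $\ge k_n$ by $\mathfrak n((x^{(n-1)}_i)_{i\ge k_n+1})$. The sequence $x^{(n)}$ stabilizes coordinatewise and $\tilde{\mathfrak n}(x)=\lim_n x^{(n)}\in\tilde X$. The two-sided Erdős measure is $\tilde\nu=\tilde{\mathfrak n}(\tilde p)$. A block is a finite 0-1 word without two adjacent 1's, starting with 1 and ending with an even positive number of zeros, containing no subword $1(00)^l1$ with $l\ge1$. $\tilde X_0=\bigcup_{k\ge1}\{\varepsilon\in\tilde X:\varepsilon_{-2k}=1,\ \varepsilon_{-2k+1}=\dots=\varepsilon_0=0,\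 \varepsilon_1=1\}$, restricted (mod 0) to sequences which contain subwords $1(00)^l1$, $l\ge1$, infinitely often both to the left and to the right. Each such $\varepsilon\in\tilde X_0$ splits uniquely into a bi-infinite concatenation of blocks $\dots B_{0}B_1B_2\dots$ with $B_1$ beginning at coordinate 1. For a finite word $w$, $f(w)$ is the number of 0-1 words $w'$ of the same length with $\sum_kw'_k\lambda^{-k}=\sum_kw_k\lambda^{-k}$. $\tilde\mu$ is the probability measure on $\tilde X_0$ under which the blocks $(B_j)_{j\in\mathbb Z}$ are independent and identically distributed with $\tilde\mu\{B_j=B\}=f(B)/2^{|B|}$ for every block $B$. *)

theory Defs
  imports "HOL-Probability.Probability" "HOL-Library.Sublist"
begin

(* A two-sided 0-1 sequence is a function int => bool; True is the digit 1, False the digit 0. *)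

definition golden :: real where
  "golden = (1 + sqrt 5) / 2"

definition coin_measure :: "(int \<Rightarrow> bool) measure" where
  "coin_measure = (\<Pi>\<^sub>M k\<in>UNIV. measure_pmf (bernoulli_pmf (1/2)))"

definition golden_space :: "(int \<Rightarrow> bool) set" where
  "golden_space = {\<epsilon>. \<forall>k. \<not> (\<epsilon> k \<and> \<epsilon> (k + 1))}"

definition two_sided_shift :: "(int \<Rightarrow> bool) \<Rightarrow> (int \<Rightarrow> bool)" where
  "two_sided_shift \<epsilon> = (\<lambda>k. \<epsilon> (k + 1))"

definition tail_value :: "int \<Rightarrow> (int \<Rightarrow> bool) \<Rightarrow> real" where
  "tail_value k x = (\<Sum>\<^sub>\<infinity>i\<in>{k..}. of_bool (x i) * golden powi (- i))"

(* One-sided sequences indexed by {k..} are extended by 0 below k. *)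
definition golden_expansions :: "int \<Rightarrow> real \<Rightarrow> (int \<Rightarrow> bool) set" where
  "golden_expansions k v =
     {\<epsilon> \<in> golden_space. (\<forall>i<k. \<not> \<epsilon> i) \<and> tail_value k \<epsilon> = v}"

(* The expansion without adjacent ones is unique except that a tail 1 0 0 0 ... can also be
   written 0 1 0 1 0 1 ...; the greedy expansion is the lexicographically greatest one.
   (Selecting digits greedily one by one gives the same sequence, except for
   x = 1 1 1 ..., where it would produce two adjacent ones; the expansion of that x
   without adjacent ones is 1 0 1 0 ....) *)
definition one_sided_normalization :: "int \<Rightarrow> (int \<Rightarrow> bool) \<Rightarrow> (int \<Rightarrow> bool)" where
  "one_sided_normalization k x =
     (THE \<epsilon>. \<epsilon> \<in> golden_expansions k (tail_value (k + 1) x) \<and>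
        (\<forall>\<delta> \<in> golden_expansions k (tail_value (k + 1) x). \<delta> \<noteq> \<epsilon> \<longrightarrow>
           (\<exists>j. (\<forall>i<j. \<delta> i = \<epsilon> i) \<and> \<not> \<delta> j \<and> \<epsilon> j)))"

(* zero_index x n is the index k_(n+1) of the (n+1)-st zero of x, counted leftwards from 0. *)
definition zero_index :: "(int \<Rightarrow> bool) \<Rightarrow> nat \<Rightarrow> int" where
  "zero_index x n = - int (enumerate {m. \<not> x (- int m)} n)"

primrec normalization_step :: "(int \<Rightarrow> bool) \<Rightarrow> nat \<Rightarrow> (int \<Rightarrow> bool)" where
  "normalization_step x 0 = x"
| "normalization_step x (Suc n) =
     (\<lambda>i. if i \<ge> zero_index x n
          then one_sided_normalization (zero_index x n) (normalization_step x n) i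
          else normalization_step x n i)"

(* The sequences with finitely many zeros on the left form a null set; the value 0 given to
   them only makes the map total with values in golden_space. *)
definition two_sided_normalization :: "(int \<Rightarrow> bool) \<Rightarrow> (int \<Rightarrow> bool)" where
  "two_sided_normalization x =
     (if infinite {k. k < 0 \<and> \<not> x k}
      then (\<lambda>i. lim (\<lambda>n. normalization_step x n i))
      else (\<lambda>_. False))"

definition erdos_measure :: "(int \<Rightarrow> bool) measure" where
  "erdos_measure = distr coin_measure (restrict_space borel golden_space) two_sided_normalization"

definition golden_block :: "bool list \<Rightarrow> bool" where
  "golden_block w \<longleftrightarrow>
     (\<forall>i. Suc i < length w \<longrightarrow> \<not> (w ! i \<and> w ! Suc i)) \<and>
     w \<noteq> [] \<and> hd w \<and>
     (\<exists>u l. l \<ge> 1 \<and> w = u @ [True] @ replicate (2 * l) False) \<and>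
     \<not> (\<exists>l\<ge>1. sublist ([True] @ replicate (2 * l) False @ [True]) w)"

definition word_value :: "bool list \<Rightarrow> real" where
  "word_value w = (\<Sum>k<length w. of_bool (w ! k) * golden powi (- int k))"

definition representation_count :: "bool list \<Rightarrow> nat" where
  "representation_count w = card {w'. length w' = length w \<and> word_value w' = word_value w}"

(* The word 1 (00)^l 1 with l \<ge> 1 occurs in the sequence, starting at coordinate i. *)
definition separator_at :: "(int \<Rightarrow> bool) \<Rightarrow> int \<Rightarrow> bool" where
  "separator_at \<epsilon> i \<longleftrightarrow>
     (\<exists>l::nat. l \<ge> 1 \<and> \<epsilon> i \<and> (\<forall>j\<in>{i<..i + 2 * int l}. \<not> \<epsilon> j) \<and> \<epsilon> (i + 2 * int l + 1))"

definition golden_base :: "(int \<Rightarrow> bool) set" where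
  "golden_base =
     {\<epsilon> \<in> golden_space.
        (\<exists>k\<ge>1. \<epsilon> (- 2 * k) \<and> (\<forall>i\<in>{- 2 * k + 1..0}. \<not> \<epsilon> i) \<and> \<epsilon> 1) \<and>
        (\<forall>N. \<exists>i\<le>N. separator_at \<epsilon> i) \<and> (\<forall>N. \<exists>i\<ge>N. separator_at \<epsilon> i)}"

(* s j is the coordinate at which the block B j begins. *)
definition block_splitting :: "(int \<Rightarrow> bool) \<Rightarrow> (int \<Rightarrow> bool list) \<Rightarrow> bool" where
  "block_splitting \<epsilon> B \<longleftrightarrow>
     (\<forall>j. golden_block (B j)) \<and>
     (\<exists>s :: int \<Rightarrow> int. s 1 = 1 \<and>
        (\<forall>j. s (j + 1) = s j + int (length (B j)) \<and> B j = map \<epsilon> [s j..s (j + 1) - 1]))"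

definition blocks :: "(int \<Rightarrow> bool) \<Rightarrow> int \<Rightarrow> bool list" where
  "blocks \<epsilon> = (THE B. block_splitting \<epsilon> B)"

definition is_block_measure :: "(int \<Rightarrow> bool) measure \<Rightarrow> bool" where
  "is_block_measure M \<longleftrightarrow>
     prob_space M \<and> space M = golden_base \<and> sets M = sets (restrict_space borel golden_base) \<and>
     prob_space.indep_vars M (\<lambda>_. count_space UNIV) (\<lambda>j \<epsilon>. blocks \<epsilon> j) (UNIV :: int set) \<and>
     (\<forall>j w. golden_block w \<longrightarrow>
        measure M {\<epsilon> \<in> golden_base. blocks \<epsilon> j = w} =
          real (representation_count w) / 2 ^ length w)"

definition block_measure :: "(int \<Rightarrow> bool) measure" where
  "block_measure = (THE M. is_block_measure M)"

definition first_block_length :: "(int \<Rightarrow> bool) \<Rightarrow> nat" where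
  "first_block_length \<epsilon> = length (blocks \<epsilon> 1)"

definition goldenshift :: "(int \<Rightarrow> bool) \<Rightarrow> (int \<Rightarrow> bool)" where
  "goldenshift \<epsilon> = (two_sided_shift ^^ first_block_length \<epsilon>) \<epsilon>"

definition measure_automorphism :: "'a measure \<Rightarrow> ('a \<Rightarrow> 'a) \<Rightarrow> bool" where
  "measure_automorphism M T \<longleftrightarrow>
     prob_space M \<and> T \<in> measurable M M \<and> distr M M T = M \<and>
     (\<exists>T' \<in> measurable M M. (AE x in M. T' (T x) = x) \<and> (AE x in M. T (T' x) = x))"

definition first_return_time :: "('a \<Rightarrow> 'a) \<Rightarrow> 'a set \<Rightarrow> 'a \<Rightarrow> nat" where
  "first_return_time T A x = (LEAST n. n > 0 \<and> (T ^^ n) x \<in> A)"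

definition first_return_map :: "('a \<Rightarrow> 'a) \<Rightarrow> 'a set \<Rightarrow> 'a \<Rightarrow> 'a" where
  "first_return_map T A x = (T ^^ first_return_time T A x) x"

(* The automorphism T of M is the special automorphism over the automorphism S of N with
   roof function r, where the base space N is realised as a measurable subset of the space of M.
   The last clause, taken for the complement of the tower over N, says that the tower
   fills M mod 0. *)
definition special_automorphism ::
  "'a measure \<Rightarrow> ('a \<Rightarrow> 'a) \<Rightarrow> 'a measure \<Rightarrow> ('a \<Rightarrow> 'a) \<Rightarrow> ('a \<Rightarrow> nat) \<Rightarrow> bool" where
  "special_automorphism M T N S r \<longleftrightarrow>
     measure_automorphism M T \<and> measure_automorphism N S \<and>
     space N \<in> sets M \<and> sets N = sets (restrict_space M (space N)) \<and>
     (AE x in N. (\<exists>n>0. (T ^^ n) x \<in> space N) \<and>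
        r x = first_return_time T (space N) x \<and> S x = first_return_map T (space N) x) \<and>
     integrable N (\<lambda>x. real (r x)) \<and>
     (\<forall>E \<in> sets M. measure M E =
        1 / (\<integral>x. real (r x) \<partial>N) * (\<integral>x. (\<Sum>j<r x. indicator E ((T ^^ j) x)) \<partial>N))"

end

theory Submission
  imports Defs
begin

text \<open>Subtracting the normalized sequence from the given one leaves at every position a carry, an element
  of the ring generated by the golden ratio. Bounds on the tails of both expansions leave only three
  carries, so the normalization is a transducer with four states, in which a path is determined by
  the digits it reads as soon as these contain the word 00100100 infinitely often on both sides.
  Where a one follows an even positive number of zeros in the normalized sequence, nothing is
  carried. Therefore the past, the blocks and the future are read off independent parts of the coin
  tossing sequence, and a block has as many preimages as it has representations: the Erdos
  measure conditioned on the base makes the blocks independent with the required distribution, and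
  it is the only measure that does. The tower formula is Kac's formula, obtained by splitting the
  space according to the time of the last visit to the base.\<close>

section \<open>Golden expansions of real numbers\<close>

text \<open>A digit of the normalization depends on the whole future of the coin sequence, because
  normalizing at a zero uses the value of an infinite tail; independence of past, blocks and future
  is therefore invisible in \<open>two_sided_normalization\<close> itself. Its events are replaced
  by statements that some finite path of the transducer exists with state \<open>Even\<close> at
  both ends. Such a statement involves only the digits that the path reads and two adjacent zeros at
  its outer end, so disjoint ranges of coordinates give independence, and uniqueness of paths
  identifies it with the event of the normalization up to a null set. The word 00100100 serves
  twice: two adjacent zeros force \<open>Even\<close>, which pins the outer ends of finite paths,
  and its inner part is copied, so that block boundaries recur in both directions and the base has
  positive measure. The weights f(B)/2^|B| are never summed by hand: that they add up to 1 comes out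
  as the total probability of the values of one block under the conditioned measure.\<close>

lemma golden_bounds: "1.6 < golden" "golden < 1.7"
proof -
  have "2.2 < sqrt 5" by (rule real_less_rsqrt) (simp add: power2_eq_square)
  then show "1.6 < golden" by (simp add: golden_def)
  have "sqrt 5 < 2.4" by (rule real_less_lsqrt) (simp_all add: power2_eq_square)
  then show "golden < 1.7" by (simp add: golden_def)
qed

lemma golden_square: "golden * golden = golden + 1"
proof -
  have "(1 + sqrt 5) * (1 + sqrt 5) = 6 + 2 * sqrt 5"
    by (simp add: distrib_left distrib_right)
  then show ?thesis unfolding golden_def by simp
qed

text \<open>\<open>golden - 1\<close> is the inverse of \<open>golden\<close>; its powers serve as
  contracting error terms in the bound on tails.\<close>

lemma golden_mult_power: "golden * (golden - 1) ^ Suc m = (golden - 1) ^ m"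
proof -
  have "golden * (golden - 1) = 1" using golden_square by (simp add: right_diff_distrib)
  then show ?thesis by (simp flip: mult.assoc)
qed

text \<open>The number 0.x(j+1)x(j+2)... in base \<open>golden\<close>: the tail after
  \<open>j\<close>, rescaled so that \<open>j\<close> is the unit place. Moving by one place then
  becomes the affine map of \<open>tail_number_step\<close>, with bounds that do not depend on
  \<open>j\<close>.\<close>

definition tail_number :: "(int \<Rightarrow> bool) \<Rightarrow> int \<Rightarrow> real" where
  "tail_number x j = (\<Sum>n. of_bool (x (j + 1 + int n)) * (1 / golden) ^ Suc n)"

lemma tail_number_summable: "summable (\<lambda>n. of_bool (x (j + 1 + int n)) * (1 / golden) ^ Suc n)"
proof (rule summable_comparison_test'[where N = 0 and g = "\<lambda>n. (1 / golden) ^ Suc n"])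
  show "summable (\<lambda>n. (1 / golden) ^ Suc n)"
    unfolding power_Suc by (rule summable_mult[OF summable_geometric]) (use golden_bounds in simp)
  show "norm (of_bool (x (j + 1 + int n)) * (1 / golden) ^ Suc n) \<le> (1 / golden) ^ Suc n" for n
    using golden_bounds by (simp add: norm_mult)
qed

lemma tail_number_nonneg: "0 \<le> tail_number x j"
  unfolding tail_number_def
  by (rule suminf_nonneg[OF tail_number_summable]) (use golden_bounds in auto)

text \<open>All ones is the extreme case; its geometric series has the value
  \<open>1 / (golden - 1)\<close>, which is \<open>golden\<close>.\<close>

lemma tail_number_le_golden: "tail_number x j \<le> golden"
proof -
  have s: "(\<lambda>n. (1 / golden) ^ n) sums (1 / (1 - 1 / golden))"
    using golden_bounds by (intro geometric_sums) simp
  have "(\<lambda>n. (1 / golden) ^ Suc n) sums (1 / golden * (1 / (1 - 1 / golden)))"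
    using sums_mult[OF s, of "1 / golden"] by simp
  moreover have "1 / golden * (1 / (1 - 1 / golden)) = golden"
    using golden_bounds golden_square by (simp add: divide_simps) (simp add: algebra_simps)
  ultimately have s': "(\<lambda>n. (1 / golden) ^ Suc n) sums golden" by simp
  have "tail_number x j \<le> (\<Sum>n. (1 / golden) ^ Suc n)" unfolding tail_number_def
  proof (rule suminf_le[OF _ tail_number_summable sums_summable[OF s']])
    show "of_bool (x (j + 1 + int n)) * (1 / golden) ^ Suc n \<le> (1 / golden) ^ Suc n" for n
      using golden_bounds by (cases "x (j + 1 + int n)") auto
  qed
  then show ?thesis using sums_unique[OF s'] by simp
qed

lemma tail_number_rec: "golden * tail_number x (j - 1) = of_bool (x j) + tail_number x j"
proof -
  let ?f = "\<lambda>n. of_bool (x (j + int n)) * (1 / golden) ^ Suc n"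
  have s: "summable ?f" using tail_number_summable[of x "j - 1"] by simp
  have "tail_number x (j - 1) = suminf ?f" by (simp add: tail_number_def)
  also have "\<dots> = (\<Sum>n. ?f (Suc n)) + ?f 0" using suminf_split_head[OF s] by simp
  also have "(\<Sum>n. ?f (Suc n)) = (\<Sum>n. (1 / golden) * (of_bool (x (j + 1 + int n)) * (1 / golden) ^ Suc n))"
    by (rule suminf_cong) (simp add: add_ac)
  also have "\<dots> = (1 / golden) * tail_number x j"
    unfolding tail_number_def by (rule suminf_mult[OF tail_number_summable])
  finally show ?thesis using golden_bounds by (simp add: field_simps)
qed

lemma tail_number_step: "tail_number x j = golden * tail_number x (j - 1) - of_bool (x j)"
  using tail_number_rec[of x j] by simp

lemma tail_number_cong: "(\<And>i. i > j \<Longrightarrow> x i = y i) \<Longrightarrow> tail_number x j = tail_number y j"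
  unfolding tail_number_def by (intro suminf_cong) auto

lemma tail_number_shift: "tail_number (\<lambda>i. x (i + m)) j = tail_number x (j + m)"
  unfolding tail_number_def by (intro suminf_cong) (simp add: algebra_simps)

lemma tail_value_eq: "tail_value k x = golden powi (1 - k) * tail_number x (k - 1)"
proof -
  let ?g = "\<lambda>n. of_bool (x (k + int n)) * golden powi (- (k + int n))"
  have bij: "bij_betw (\<lambda>n. k + int n) UNIV {k..}"
    by (rule bij_betw_byWitness[where f' = "\<lambda>i. nat (i - k)"]) auto
  have g: "?g n = golden powi (1 - k) * (of_bool (x (k - 1 + 1 + int n)) * (1 / golden) ^ Suc n)" for n
  proof -
    have "golden powi (- (k + int n)) = golden powi ((1 - k) + - int (Suc n))" by (simp add: algebra_simps)
    also have "\<dots> = golden powi (1 - k) * golden powi (- int (Suc n))"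
      by (rule power_int_add) (use golden_bounds in simp)
    also have "golden powi (- int (Suc n)) = (1 / golden) ^ Suc n"
      by (simp only: power_int_minus power_int_of_nat power_one_over inverse_eq_divide)
    finally show ?thesis by simp
  qed
  have s: "summable ?g"
    unfolding g by (rule summable_mult[OF tail_number_summable])
  have "tail_value k x = (\<Sum>\<^sub>\<infinity>n. ?g n)"
    unfolding tail_value_def by (rule infsum_reindex_bij_betw[OF bij, symmetric])
  also have "\<dots> = suminf ?g"
    by (intro infsumI sums_nonneg_imp_has_sum summable_sums s) (use golden_bounds in auto)
  also have "\<dots> = golden powi (1 - k) * tail_number x (k - 1)"
    unfolding g tail_number_def by (rule suminf_mult[OF tail_number_summable])
  finally show ?thesis .
qed

lemma tail_value_Suc_eq_iff:
  "tail_value k x = tail_value (k + 1) y \<longleftrightarrow> golden * tail_number x (k - 1) = tail_number y k"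
proof -
  have "golden powi (1 - k) = golden * golden powi (- k)"
    using golden_bounds power_int_add[of golden 1 "- k"] by simp
  then show ?thesis using golden_bounds by (simp add: tail_value_eq power_int_eq_0_iff)
qed

lemma golden_mult_le_iff [simp]: "golden * a \<le> golden * b \<longleftrightarrow> a \<le> b"
  using golden_bounds by simp

text \<open>The bound 1 reproduces itself under a digit 0 and under the pair 1 0, but a recursion
  along an infinite tail has no start. So the crude bound \<open>golden\<close> is carried along as
  an error, which shrinks by the factor \<open>golden - 1\<close> per digit.\<close>

lemma golden_space_tail_le: assumes "x \<in> golden_space" shows "tail_number x j \<le> 1"
proof -
  have approx: "tail_number x j \<le> 1 + (golden - 1) ^ n" for n j
  proof (induction n arbitrary: j rule: less_induct)
    case (less n)
    consider "n = 0" | m where "n = Suc m" "\<not> x (j + 1)"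
      | "n = 1" "x (j + 1)" | m where "n = Suc (Suc m)" "x (j + 1)"
      by (metis One_nat_def not0_implies_Suc)
    then show ?case
    proof cases
      case 1 then show ?thesis using tail_number_le_golden[of x j] golden_bounds by simp
    next
      case 2
      have "tail_number x (j + 1) \<le> 1 + (golden - 1) ^ m" using less 2 by simp
      then have "golden * tail_number x j \<le> golden * 1 + (golden - 1) ^ m"
        using tail_number_rec[of x "j + 1"] 2 golden_bounds by simp
      also have "\<dots> = golden * (1 + (golden - 1) ^ n)"
        by (simp only: 2 distrib_left golden_mult_power)
      finally show ?thesis by simp
    next
      case 3
      have "tail_number x j \<le> golden" by (rule tail_number_le_golden)
      then show ?thesis using 3 by simp
    next
      case 4
      have n: "\<not> x (j + 2)" using assms 4 unfolding golden_space_def by (metis (mono_tags, lifting) add.assoc mem_Collect_eq one_add_one)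
      have "tail_number x (j + 2) \<le> 1 + (golden - 1) ^ m" using less 4 by simp
      then have "golden * tail_number x (j + 1) \<le> 1 + (golden - 1) ^ m"
        using tail_number_rec[of x "j + 2"] n by (simp add: add.commute)
      then have "golden * tail_number x (j + 1) \<le> golden * ((golden - 1) + (golden - 1) ^ Suc m)"
        using golden_square by (simp only: distrib_left golden_mult_power) (simp add: right_diff_distrib)
      then have "tail_number x (j + 1) \<le> (golden - 1) + (golden - 1) ^ Suc m" by simp
      then have "golden * tail_number x j \<le> golden + (golden - 1) ^ Suc m"
        using tail_number_rec[of x "j + 1"] 4 golden_bounds by simp
      also have "\<dots> = golden * (1 + (golden - 1) ^ n)"
        by (simp only: 4 distrib_left golden_mult_power mult_1_right)
      finally show ?thesis by simp
    qed
  qed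
  have "(\<lambda>n. (golden - 1) ^ n) \<longlonglongrightarrow> 0"
    using golden_bounds LIMSEQ_realpow_zero[of "golden - 1"] by linarith
  then have "(\<lambda>n. 1 + (golden - 1) ^ n) \<longlonglongrightarrow> 1 + 0" by (intro tendsto_add tendsto_const)
  then have "tail_number x j \<le> 1 + 0" by (rule LIMSEQ_le_const) (use approx in blast)
  then show ?thesis by simp
qed

lemma golden_spaceD: "x \<in> golden_space \<Longrightarrow> x i \<Longrightarrow> \<not> x (i + 1)"
  by (auto simp: golden_space_def)

text \<open>A leading 0 would give at most \<open>1 / golden\<close>, so 1 is attained only through
  1 0 followed by a tail that attains it again. Iteration leaves 1 0 1 0 ... as the only such
  tail.\<close>

lemma golden_space_tail_eq_1:
  assumes "x \<in> golden_space" "tail_number x j = 1"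
  shows "x (j + 1)" "\<not> x (j + 2)" "tail_number x (j + 2) = 1"
proof -
  show 1: "x (j + 1)"
    using tail_number_rec[of x "j + 1"] golden_space_tail_le[OF assms(1), of "j + 1"] assms(2) golden_bounds
    by (cases "x (j + 1)") auto
  then show 2: "\<not> x (j + 2)" using golden_spaceD[OF assms(1), of "j + 1"] by (simp add: add.commute)
  have "tail_number x (j + 1) = golden - 1"
    using tail_number_rec[of x "j + 1"] 1 assms(2) by simp
  then show "tail_number x (j + 2) = 1"
    using tail_number_rec[of x "j + 2"] 2 golden_square by (simp add: add.commute right_diff_distrib)
qed

lemma golden_space_tail_eq_1_infinite:
  assumes "x \<in> golden_space" "tail_number x j = 1"
  shows "x (j + 1 + 2 * int n)" "\<not> x (j + 2 + 2 * int n)"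
proof -
  have "tail_number x (j + 2 * int n) = 1"
  proof (induction n)
    case (Suc n)
    have "j + 2 * int (Suc n) = j + 2 * int n + 2" by simp
    then show ?case using golden_space_tail_eq_1(3)[OF assms(1) Suc] by (simp only:)
  qed (use assms in simp)
  from golden_space_tail_eq_1(1,2)[OF assms(1) this]
  show "x (j + 1 + 2 * int n)" "\<not> x (j + 2 + 2 * int n)" by (simp_all add: algebra_simps)
qed

lemma finite_support_tail_zero:
  assumes "\<And>i. i > j \<Longrightarrow> \<not> x i" shows "tail_number x j = 0"
  unfolding tail_number_def using assms by (subst suminf_cong[where g = "\<lambda>_. 0"]) auto

text \<open>The hypothesis excludes exactly the sequences with a tail 1 0 1 0 \<dots>, the only source of
  non-uniqueness of golden expansions.\<close>
lemma golden_expansion_first_difference: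
  assumes e: "e \<in> golden_space" "\<And>i. i \<ge> j \<Longrightarrow> tail_number e i < 1"
    and eq: "tail_number d j = tail_number e j"
    and agree: "\<And>i. j < i \<Longrightarrow> i < m \<Longrightarrow> d i = e i" and "j < m" "d m \<noteq> e m"
  shows "\<not> d m \<and> e m"
proof (rule ccontr)
  assume "\<not> ?thesis"
  then have dm: "d m" "\<not> e m" using \<open>d m \<noteq> e m\<close> by auto
  have "tail_number d (j + int n) = tail_number e (j + int n)" if "j + int n < m" for n
    using that
  proof (induction n)
    case (Suc n)
    then show ?case
      using tail_number_step[of d "j + 1 + int n"] tail_number_step[of e "j + 1 + int n"]
        agree[of "j + 1 + int n"] by (simp add: algebra_simps)
  qed (use eq in simp)
  from this[of "nat (m - 1 - j)"] \<open>j < m\<close> have "tail_number d (m - 1) = tail_number e (m - 1)" by simp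
  then have "1 + tail_number d m = tail_number e m"
    using tail_number_rec[of d m] tail_number_rec[of e m] dm by simp
  moreover have "tail_number e m < 1" using e(2)[of m] \<open>j < m\<close> by simp
  ultimately show False using tail_number_nonneg[of d m] by simp
qed

lemma first_difference:
  fixes d e :: "int \<Rightarrow> bool"
  assumes "d i \<noteq> e i" "j < i"
  obtains m where "j < m" "m \<le> i" "d m \<noteq> e m" "\<And>i. j < i \<Longrightarrow> i < m \<Longrightarrow> d i = e i"
proof -
  define n where "n = (LEAST n. d (j + 1 + int n) \<noteq> e (j + 1 + int n))"
  have ex: "d (j + 1 + int (nat (i - j - 1))) \<noteq> e (j + 1 + int (nat (i - j - 1)))" using assms by simp
  have 1: "d (j + 1 + int n) \<noteq> e (j + 1 + int n)" unfolding n_def by (rule LeastI[where P="\<lambda>n. d (j + 1 + int n) \<noteq> e (j + 1 + int n)", OF ex])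
  have 2: "n \<le> nat (i - j - 1)" unfolding n_def by (rule Least_le[where P="\<lambda>n. d (j + 1 + int n) \<noteq> e (j + 1 + int n)", OF ex])
  have 3: "d k = e k" if "j < k" "k < j + 1 + int n" for k
  proof -
    have "nat (k - j - 1) < n" using that by linarith
    from not_less_Least[OF this[unfolded n_def]] that show ?thesis by auto
  qed
  show ?thesis by (rule that[of "j + 1 + int n"]) (use 1 2 3 assms in auto)
qed

lemma golden_expansion_unique:
  assumes "e \<in> golden_space" "\<And>i. i \<ge> j \<Longrightarrow> tail_number e i < 1"
    and "d \<in> golden_space" "\<And>i. i \<ge> j \<Longrightarrow> tail_number d i < 1"
    and eq: "tail_number d j = tail_number e j" and "j < i"
  shows "d i = e i"
proof (rule ccontr)
  assume "d i \<noteq> e i"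
  then obtain m where
    m: "j < m" "d m \<noteq> e m" "\<And>i. j < i \<Longrightarrow> i < m \<Longrightarrow> d i = e i"
    using first_difference[of d i e j] \<open>j < i\<close> by metis
  show False
    using golden_expansion_first_difference[of e j d m, OF assms(1,2) eq m(3,1,2)]
      golden_expansion_first_difference[of d j e m, OF assms(3,4) eq[symmetric] m(3)[symmetric] m(1) m(2)[symmetric]]
    by auto
qed

text \<open>Iterates of the beta transformation, taking u to the fractional part of
  \<open>golden * u\<close>. For remainders below 1 the product stays below 2, so one subtraction
  suffices.\<close>

primrec greedy_remainder :: "real \<Rightarrow> nat \<Rightarrow> real" where
  "greedy_remainder u 0 = u"
| "greedy_remainder u (Suc n) = (let v = golden * greedy_remainder u n in if v \<ge> 1 then v - 1 else v)"

definition greedy_digit :: "real \<Rightarrow> nat \<Rightarrow> bool" where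
  "greedy_digit u n \<longleftrightarrow> golden * greedy_remainder u n \<ge> 1"

lemma greedy_remainder_bounds:
  assumes "0 \<le> u" "u < 1" shows "0 \<le> greedy_remainder u n \<and> greedy_remainder u n < 1"
proof (induction n)
  case (Suc n)
  have "golden * greedy_remainder u n \<le> golden * 1" using Suc golden_bounds by (intro mult_left_mono) auto
  then have "golden * greedy_remainder u n < 2" using golden_bounds by linarith
  then show ?case using Suc golden_bounds by (auto simp: Let_def)
qed (use assms in auto)

text \<open>The difference of two solutions of the recursion grows by the factor
  \<open>golden\<close> at each step, so a bounded solution must be the tail itself. This evaluates
  tails of explicit sequences without summing series.\<close>

lemma tail_number_unique:
  assumes bd: "\<And>i. i \<ge> J \<Longrightarrow> \<bar>c i\<bar> \<le> C"
    and rec: "\<And>i. i > J \<Longrightarrow> c i = golden * c (i - 1) - of_bool (x i)"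
    and "J \<le> j"
  shows "c j = tail_number x j"
proof (rule ccontr)
  assume "c j \<noteq> tail_number x j"
  define d where "d = (\<lambda>i. c i - tail_number x i)"
  have d: "d (j + int n) = golden ^ n * d j" for n
  proof (induction n)
    case (Suc n)
    have "d (j + int (Suc n)) = golden * d (j + int n)"
      using rec[of "j + 1 + int n"] tail_number_step[of x "j + 1 + int n"] \<open>J \<le> j\<close>
      by (simp add: d_def algebra_simps)
    then show ?case using Suc by simp
  qed simp
  have b: "\<bar>d (j + int n)\<bar> \<le> C + 2" for n
    using bd[of "j + int n"] \<open>J \<le> j\<close> tail_number_nonneg[of x "j + int n"] tail_number_le_golden[of x "j + int n"]
      golden_bounds by (simp add: d_def)
  have "\<bar>d j\<bar> > 0" using \<open>c j \<noteq> _\<close> by (simp add: d_def)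
  obtain n where "golden ^ n > (C + 2) / \<bar>d j\<bar>"
    using real_arch_pow[of golden] golden_bounds by auto
  then have "golden ^ n * \<bar>d j\<bar> > C + 2" using \<open>\<bar>d j\<bar> > 0\<close> by (simp add: field_simps)
  then show False using b[of n] golden_bounds by (simp add: d abs_mult)
qed

definition greedy_expansion :: "int \<Rightarrow> real \<Rightarrow> int \<Rightarrow> bool" where
  "greedy_expansion j u i \<longleftrightarrow> j < i \<and> greedy_digit u (nat (i - j - 1))"

lemma greedy_expansion:
  assumes u: "0 \<le> u" "u < 1"
  shows "tail_number (greedy_expansion j u) j = u"
    and "\<And>i. i \<ge> j \<Longrightarrow> tail_number (greedy_expansion j u) i < 1"
    and "greedy_expansion j u \<in> golden_space"
proof -
  define c where "c i = greedy_remainder u (nat (i - j))" for i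
  have bd: "0 \<le> c i \<and> c i < 1" for i using greedy_remainder_bounds[OF u, of "nat (i - j)"] by (simp add: c_def)
  have rec: "c i = golden * c (i - 1) - of_bool (greedy_expansion j u i)" if "i > j" for i
  proof -
    have "nat (i - j) = Suc (nat (i - 1 - j))" using that by linarith
    moreover have "nat (i - j - 1) = nat (i - 1 - j)" by (simp add: algebra_simps)
    ultimately show ?thesis using that
      by (auto simp: c_def greedy_expansion_def greedy_digit_def Let_def)
  qed
  have eq: "c i = tail_number (greedy_expansion j u) i" if "j \<le> i" for i
  proof (rule tail_number_unique[where J = j and C = 1])
    show "\<bar>c i\<bar> \<le> 1" for i using bd[of i] by simp
  qed (use rec that in auto)
  show "tail_number (greedy_expansion j u) j = u" using eq[of j] by (simp add: c_def)
  show "tail_number (greedy_expansion j u) i < 1" if "i \<ge> j" for i using eq[OF that] bd[of i] by simp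
  show "greedy_expansion j u \<in> golden_space"
    unfolding golden_space_def
  proof (clarsimp)
    fix k assume k: "greedy_expansion j u k" "greedy_expansion j u (k + 1)"
    then have "j < k" by (simp add: greedy_expansion_def)
    \<comment> \<open>A digit 1 leaves a remainder below \<open>golden - 1\<close>, and
      \<open>golden * (golden - 1) = 1\<close>, so the next digit cannot be 1.\<close>
    then have "golden * (golden * c (k - 1) - 1) - 1 \<ge> 0" using rec[of k] rec[of "k + 1"] k bd[of "k+1"] by simp
    moreover have "golden * (golden * c (k - 1) - 1) < golden * (golden - 1)"
      using bd[of "k - 1"] golden_bounds by (intro mult_strict_left_mono) auto
    ultimately show False using golden_square by (simp add: algebra_simps)
  qed
qed

section \<open>The normalization\<close>

lemma golden_cancel: "golden * a = golden * b \<Longrightarrow> a = b"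
  using golden_bounds by simp

text \<open>The candidate alternates between 1 and \<open>golden - 1\<close>; it is bounded and
  satisfies the recursion, hence is the tail.\<close>

lemma tail_number_alternating: "tail_number (\<lambda>i. k \<le> i \<and> even (i - k)) (k - 1) = 1"
proof -
  define c where "c i = (if even (i - k) then golden - 1 else 1)" for i
  have "c (k - 1) = tail_number (\<lambda>i. k \<le> i \<and> even (i - k)) (k - 1)"
  proof (rule tail_number_unique[where J = "k - 1" and C = 1])
    show "\<bar>c i\<bar> \<le> 1" for i using golden_bounds by (simp add: c_def)
    show "c i = golden * c (i - 1) - of_bool (k \<le> i \<and> even (i - k))" if "k - 1 < i" for i
      using that golden_square by (auto simp: c_def right_diff_distrib)
  qed simp
  then show ?thesis by (simp add: c_def)
qed

section \<open>One-sided normalization\<close>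

lemma one_sided_normalization_eqI:
  assumes "e \<in> golden_expansions k (tail_value (k + 1) x)"
    and "\<And>d. d \<in> golden_expansions k (tail_value (k + 1) x) \<Longrightarrow> d \<noteq> e \<Longrightarrow>
      \<exists>j. (\<forall>i<j. d i = e i) \<and> \<not> d j \<and> e j"
  shows "one_sided_normalization k x = e"
  unfolding one_sided_normalization_def
proof (rule the_equality)
  fix d assume d: "d \<in> golden_expansions k (tail_value (k + 1) x) \<and>
    (\<forall>\<delta> \<in> golden_expansions k (tail_value (k + 1) x). \<delta> \<noteq> d \<longrightarrow> (\<exists>j. (\<forall>i<j. \<delta> i = d i) \<and> \<not> \<delta> j \<and> d j))"
  show "d = e"
  proof (rule ccontr)
    assume "d \<noteq> e"
    obtain j where j: "\<forall>i<j. d i = e i" "\<not> d j" "e j" using assms(2) d \<open>d \<noteq> e\<close> by blast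
    obtain j' where j': "\<forall>i<j'. e i = d i" "\<not> e j'" "d j'" using assms(1) d \<open>d \<noteq> e\<close> by metis
    show False using j j' by (cases j j' rule: linorder_cases) auto
  qed
qed (use assms in blast)

lemma golden_expansions_iff:
  "e \<in> golden_expansions k (tail_value (k + 1) x) \<longleftrightarrow>
     e \<in> golden_space \<and> (\<forall>i<k. \<not> e i) \<and> golden * tail_number e (k - 1) = tail_number x k"
  by (simp add: golden_expansions_def tail_value_Suc_eq_iff)

text \<open>Dividing by \<open>golden\<close>, to make room for the digit at \<open>k\<close>, gives
  a number below 1. Its greedy expansion has all tails below 1, and
  \<open>golden_expansion_first_difference\<close> makes it lexicographically greatest.\<close>

lemma one_sided_normalization_regular:
  assumes "tail_number x k < golden"
  shows "one_sided_normalization k x = greedy_expansion (k - 1) (tail_number x k / golden)"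
    (is "_ = ?e")
proof (rule one_sided_normalization_eqI)
  have u: "0 \<le> tail_number x k / golden" "tail_number x k / golden < 1"
    using tail_number_nonneg[of x k] assms golden_bounds by auto
  note e = greedy_expansion[OF u, of "k - 1"]
  have e0: "\<not> ?e i" if "i < k" for i using that by (simp add: greedy_expansion_def)
  have mem: "golden * tail_number ?e (k - 1) = tail_number x k" using e(1) golden_bounds by simp
  then show "?e \<in> golden_expansions k (tail_value (k + 1) x)"
    unfolding golden_expansions_iff using e(3) e0 by blast
  fix d assume d: "d \<in> golden_expansions k (tail_value (k + 1) x)" "d \<noteq> ?e"
  then have d': "\<And>i. i < k \<Longrightarrow> \<not> d i" "golden * tail_number d (k - 1) = tail_number x k"
    unfolding golden_expansions_iff by auto
  from \<open>d \<noteq> ?e\<close> obtain i where i: "d i \<noteq> ?e i" by auto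
  then have "k - 1 < i" using d'(1)[of i] e0[of i] by (meson leI zle_diff1_eq)
  from i this obtain m where m: "k - 1 < m" "d m \<noteq> ?e m" "\<And>i. k - 1 < i \<Longrightarrow> i < m \<Longrightarrow> d i = ?e i"
    using first_difference[of d i ?e "k - 1"] by metis
  have eq: "tail_number d (k - 1) = tail_number ?e (k - 1)" by (rule golden_cancel) (simp only: d'(2) mem)
  have "\<not> d m \<and> ?e m"
    by (rule golden_expansion_first_difference[OF e(3) e(2) eq m(3) m(1,2)])
  moreover have "\<forall>i<m. d i = ?e i" using m(3) d'(1) e0 by (metis leI zle_diff1_eq)
  ultimately show "\<exists>j. (\<forall>i<j. d i = ?e i) \<and> \<not> d j \<and> ?e j" by blast
qed

text \<open>The number to be expanded is 1, where \<open>greedy_expansion\<close> does not apply. A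
  tail of value 1 in \<open>golden_space\<close> is forced to be 1 0 1 0 ..., so the maximality
  condition meets no competitor.\<close>

lemma one_sided_normalization_all_ones:
  assumes "tail_number x k = golden"
  shows "one_sided_normalization k x = (\<lambda>i. k \<le> i \<and> even (i - k))" (is "_ = ?e")
    and "(\<lambda>i. k \<le> i \<and> even (i - k)) \<in> golden_expansions k (tail_value (k + 1) x)"
proof -
  show 1: "?e \<in> golden_expansions k (tail_value (k + 1) x)"
    unfolding golden_expansions_iff tail_number_alternating assms by (auto simp: golden_space_def)
  show "one_sided_normalization k x = ?e"
  proof (rule one_sided_normalization_eqI[OF 1])
    fix d assume d: "d \<in> golden_expansions k (tail_value (k + 1) x)" "d \<noteq> ?e"
    then have g: "d \<in> golden_space" "\<And>i. i < k \<Longrightarrow> \<not> d i" "tail_number d (k - 1) = 1"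
      unfolding golden_expansions_iff assms using golden_bounds by auto
    have "d i = ?e i" for i
    proof (cases "i < k")
      case False
      consider n where "i = k + 2 * int n" | n where "i = k + 1 + 2 * int n"
      proof -
        have "i = k + 2 * int (nat ((i - k) div 2)) \<or> i = k + 1 + 2 * int (nat ((i - k) div 2))"
          using False by simp presburger
        then show thesis using that by blast
      qed
      then show ?thesis
        using golden_space_tail_eq_1_infinite[OF g(1,3)] by cases (auto simp: add_ac)
    qed (use g in auto)
    with d(2) show "\<exists>j. (\<forall>i<j. d i = ?e i) \<and> \<not> d j \<and> ?e j" by auto
  qed
qed

lemma one_sided_normalization_in_expansions:
  "one_sided_normalization k x \<in> golden_expansions k (tail_value (k + 1) x)"
proof (cases "tail_number x k < golden")
  case True
  have u: "0 \<le> tail_number x k / golden" "tail_number x k / golden < 1"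
    using tail_number_nonneg[of x k] True golden_bounds by auto
  show ?thesis
    unfolding one_sided_normalization_regular[OF True] golden_expansions_iff
    using greedy_expansion[OF u, of "k - 1"] golden_bounds by (auto simp: greedy_expansion_def)
next
  case False
  then have "tail_number x k = golden" using tail_number_le_golden[of x k] by simp
  from one_sided_normalization_all_ones[OF this] show ?thesis by simp
qed

lemma one_sided_normalization_cong:
  "tail_number x k = tail_number y k \<Longrightarrow> one_sided_normalization k x = one_sided_normalization k y"
  by (simp add: one_sided_normalization_def tail_value_eq)

lemma tail_number_extend_left:
  assumes "tail_number x j = tail_number y j" "\<And>k. i < k \<Longrightarrow> k \<le> j \<Longrightarrow> x k = y k" "i \<le> j"
  shows "tail_number x i = tail_number y i"
proof -
  have "tail_number x (j - int n) = tail_number y (j - int n)" if "i \<le> j - int n" for n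
    using that
  proof (induction n)
    case (Suc n)
    have "golden * tail_number x (j - int n - 1) = golden * tail_number y (j - int n - 1)"
      using tail_number_rec[of x "j - int n"] tail_number_rec[of y "j - int n"] Suc assms(2)[of "j - int n"]
      by simp
    then show ?case using golden_bounds by (simp add: algebra_simps)
  qed (use assms in simp)
  from this[of "nat (j - i)"] \<open>i \<le> j\<close> show ?thesis by simp
qed

text \<open>A zero at \<open>i\<close> gives a tail of at most 1 just before it, and prepending
  digits preserves the strict bound because \<open>(1 + golden) / golden = golden\<close>.\<close>

lemma tail_number_lt_golden:
  assumes "\<not> x i" "j < i" shows "tail_number x j < golden"
proof -
  have "tail_number x (i - 1 - int n) < golden" for n
  proof (induction n)
    case 0
    have "golden * tail_number x (i - 1) \<le> golden * 1"
      using tail_number_rec[of x i] assms tail_number_le_golden[of x i] by simp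
    then show ?case using golden_bounds by simp
  next
    case (Suc n)
    have "golden * tail_number x (i - 1 - int (Suc n)) < golden * golden"
      using tail_number_rec[of x "i - 1 - int n"] Suc golden_square
      by (cases "x (i - 1 - int n)") (auto simp: algebra_simps)
    then show ?case using golden_bounds by simp
  qed
  from this[of "nat (i - 1 - j)"] assms show ?thesis by simp
qed

lemma tail_number_lt_golden_mono:
  assumes "tail_number x k < golden" "j \<le> k" shows "tail_number x j < golden"
proof (cases "\<exists>i>j. \<not> x i")
  case False
  then have "x i" if "i > j" for i using that by blast
  then have "tail_number x j = tail_number x k"
    using \<open>j \<le> k\<close> unfolding tail_number_def by (intro suminf_cong) auto
  then show ?thesis using assms by simp
qed (use tail_number_lt_golden in blast)

text \<open>The orbit of 0 under \<open>D\<close> to \<open>golden * D + a - b\<close> with digits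
  \<open>a\<close> and \<open>b\<close>, as long as it stays strictly between
  \<open>- golden\<close> and 1. These are the bounds for a tail below 1 minus a tail below
  \<open>golden\<close>. The set closes up because
  \<open>golden * (1 - golden) = -1\<close>.\<close>

definition carries :: "real set" where "carries = {0, -1, 1 - golden}"

lemma carries_step:
  assumes "D \<in> carries" "D' = golden * D + of_bool a - of_bool b" "- golden < D'" "D' < 1"
  shows "D' \<in> carries"
proof -
  have "golden * (1 - golden) = -1" using golden_square by (simp add: right_diff_distrib)
  then show ?thesis
    using assms golden_bounds by (cases a; cases b) (auto simp: carries_def)
qed

lemma carries_induct:
  fixes i j :: int
  assumes D0: "D i \<in> carries"
    and step: "\<And>k. i < k \<Longrightarrow> k \<le> j \<Longrightarrow> D k = golden * D (k - 1) + of_bool (x k) - of_bool (e k)"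
    and bd: "\<And>k. i < k \<Longrightarrow> k \<le> j \<Longrightarrow> - golden < D k \<and> D k < 1" and "i \<le> j"
  shows "D j \<in> carries"
proof -
  have "D (i + int n) \<in> carries" if "i + int n \<le> j" for n
    using that
  proof (induction n)
    case (Suc n)
    show ?case
      by (rule carries_step[of "D (i + int n)" _ "x (i + int (Suc n))" "e (i + int (Suc n))"])
         (use Suc step[of "i + int (Suc n)"] bd[of "i + int (Suc n)"] in \<open>auto simp: add.commute\<close>)
  qed (use D0 in simp)
  from this[of "nat (j - i)"] \<open>i \<le> j\<close> show ?thesis by simp
qed

lemma carry_step:
  "tail_number e k - tail_number x k =
    golden * (tail_number e (k - 1) - tail_number x (k - 1)) + of_bool (x k) - of_bool (e k)"
  using tail_number_step[of x k] tail_number_step[of e k] by (simp add: algebra_simps)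

text \<open>The fractional part for arguments between 0 and \<open>golden\<close>. Its two cases
  correspond to the carries 0 and -1, the only ones possible at a zero of the input.\<close>

definition fractional :: "real \<Rightarrow> real" where
  "fractional t = (if t < 1 then t else t - 1)"

lemma fractional_bounds: "0 \<le> t \<Longrightarrow> t < golden \<Longrightarrow> 0 \<le> fractional t \<and> fractional t < 1"
  using golden_bounds by (auto simp: fractional_def)

text \<open>A zero of \<open>x\<close> at \<open>k\<close> absorbs any carry, so the digits of the normalization beyond \<open>k\<close>
  do not depend on where the normalization was started.\<close>
lemma one_sided_normalization_beyond_zero:
  assumes "\<not> x k'" "k' < k" "\<not> x k" and lt: "tail_number x k < golden" and "k < i"
  shows "one_sided_normalization k' x i = greedy_expansion k (fractional (tail_number x k)) i"
proof -
  have lt': "tail_number x j < golden" if "j \<le> k" for j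
    by (rule tail_number_lt_golden_mono[OF lt that])
  have u: "0 \<le> tail_number x k' / golden" "tail_number x k' / golden < 1"
    using tail_number_nonneg[of x k'] lt'[of k'] \<open>k' < k\<close> golden_bounds by auto
  define e where "e = greedy_expansion (k' - 1) (tail_number x k' / golden)"
  have osn: "one_sided_normalization k' x = e"
    unfolding e_def using lt'[of k'] \<open>k' < k\<close> by (intro one_sided_normalization_regular) simp
  note e = greedy_expansion[OF u, of "k' - 1", folded e_def]
  define D where "D j = tail_number e j - tail_number x j" for j
  \<comment> \<open>The normalization writes the tail after \<open>k'\<close> with one extra place,
    and in \<open>x\<close> the zero at \<open>k'\<close> fills that place; so no carry enters from
    the left.\<close>
  have "D (k' - 1) = 0"
    using golden_cancel[of "tail_number e (k' - 1)" "tail_number x (k' - 1)"]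
      e(1) tail_number_rec[of x k'] \<open>\<not> x k'\<close> golden_bounds by (simp add: D_def)
  have bd: "- golden < D j \<and> D j < 1" if "k' - 1 \<le> j" "j \<le> k" for j
    using tail_number_nonneg[of x j] tail_number_nonneg[of e j] e(2)[OF that(1)] lt'[OF that(2)]
    by (simp add: D_def)
  have D: "D j \<in> carries" if "k' - 1 \<le> j" "j \<le> k" for j
  proof (rule carries_induct[of D "k' - 1" j x e])
    show "D (k' - 1) \<in> carries" using \<open>D (k' - 1) = 0\<close> by (simp add: carries_def)
    show "D l = golden * D (l - 1) + of_bool (x l) - of_bool (e l)" for l
      unfolding D_def by (rule carry_step)
    show "- golden < D l \<and> D l < 1" if "k' - 1 < l" "l \<le> j" for l
      using bd[of l] that \<open>j \<le> k\<close> by simp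
  qed (rule that)
  have g: "golden * (1 - golden) = -1" using golden_square by (simp add: right_diff_distrib)
  have Dk: "D k = golden * D (k - 1) - of_bool (e k)"
    using carry_step[of e k x] \<open>\<not> x k\<close> by (simp add: D_def)
  have "D (k - 1) \<in> carries" "D k \<in> carries" using D[of k] D[of "k - 1"] \<open>k' < k\<close> by auto
  \<comment> \<open>Since \<open>x k\<close> is zero, \<open>D k\<close> is
    \<open>golden * D (k - 1)\<close> minus a digit, and none of the three carries at
    \<open>k - 1\<close> yields \<open>1 - golden\<close> that way.\<close>
  then have "D k = 0 \<or> D k = -1"
    using Dk g golden_bounds by (auto simp: carries_def of_bool_def split: if_splits)
  then have eq: "tail_number e k = fractional (tail_number x k)"
    using e(2)[of k] tail_number_nonneg[of e k] \<open>k' < k\<close> by (auto simp: D_def fractional_def)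
  have f: "0 \<le> fractional (tail_number x k)" "fractional (tail_number x k) < 1"
    using fractional_bounds[OF tail_number_nonneg lt] by auto
  note e' = greedy_expansion[OF f, of k]
  show ?thesis unfolding osn
    by (rule golden_expansion_unique[OF e'(3,2) e(3) e(2) _ \<open>k < i\<close>]) (use e'(1) eq \<open>k' < k\<close> in auto)
qed

section \<open>Two-sided normalization: from the limit to a local formula\<close>

lemma
  assumes "infinite {k. k < 0 \<and> \<not> x k}"
  shows zero_index_zero: "\<not> x (zero_index x n)"
    and zero_index_less: "zero_index x (Suc n) < zero_index x n"
    and zero_index_le: "zero_index x n \<le> - int n"
proof -
  have "{k. k < 0 \<and> \<not> x k} \<subseteq> (\<lambda>m. - int m) ` {m. \<not> x (- int m)}"
  proof
    fix k assume "k \<in> {k. k < 0 \<and> \<not> x k}"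
    then show "k \<in> (\<lambda>m. - int m) ` {m. \<not> x (- int m)}" by (intro image_eqI[of _ _ "nat (- k)"]) auto
  qed
  then have inf: "infinite {m. \<not> x (- int m)}" using assms finite_surj by blast
  show "\<not> x (zero_index x n)" using enumerate_in_set[OF inf, of n] by (simp add: zero_index_def)
  show "zero_index x (Suc n) < zero_index x n" using enumerate_step[OF inf, of n] by (simp add: zero_index_def)
  show "zero_index x n \<le> - int n" using le_enumerate[OF inf, of n] by (simp add: zero_index_def)
qed

text \<open>An earlier step replaces the digits from its zero on by another expansion of the same
  number, the zero leaving room for the extra leading digit. Tail values further left are unchanged,
  and the one-sided normalization depends on nothing else, so the nested construction collapses to
  normalizing \<open>x\<close> itself at the latest zero.\<close>

lemma normalization_step_Suc:
  assumes "infinite {k. k < 0 \<and> \<not> x k}"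
  shows "normalization_step x (Suc n) =
    (\<lambda>i. if zero_index x n \<le> i then one_sided_normalization (zero_index x n) x i else x i)"
proof (induction n)
  case (Suc n)
  let ?y = "normalization_step x (Suc n)" and ?z = "zero_index x n" and ?z' = "zero_index x (Suc n)"
  have zz: "?z' < ?z" by (rule zero_index_less[OF assms])
  have "golden * tail_number ?y (?z - 1) = golden * tail_number (one_sided_normalization ?z x) (?z - 1)"
    unfolding Suc by (subst tail_number_cong[of "?z - 1" _ "one_sided_normalization ?z x"]) auto
  also have "\<dots> = tail_number x ?z"
    using one_sided_normalization_in_expansions[of ?z x] unfolding golden_expansions_iff by blast
  also have "\<dots> = golden * tail_number x (?z - 1)"
    using tail_number_rec[of x ?z] zero_index_zero[OF assms, of n] by simp
  finally have "tail_number ?y (?z - 1) = tail_number x (?z - 1)" using golden_bounds by simp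
  then have "tail_number ?y ?z' = tail_number x ?z'"
    by (rule tail_number_extend_left) (use zz in \<open>auto simp: Suc simp del: normalization_step.simps\<close>)
  from one_sided_normalization_cong[OF this]
  show ?case unfolding normalization_step.simps(2)[of x "Suc n"] using zz Suc by auto
qed simp

text \<open>Once the starting zero lies left of \<open>k\<close>, the digit at \<open>i\<close> no
  longer changes. The resulting formula replaces the limit everywhere: shift equivariance,
  measurability and the carry path are derived from it.\<close>

lemma two_sided_normalization_beyond_zero:
  assumes inf: "infinite {k. k < 0 \<and> \<not> x k}" and "\<not> x k" "tail_number x k < golden" "k < i"
  shows "two_sided_normalization x i = greedy_expansion k (fractional (tail_number x k)) i" (is "_ = ?b")
proof -
  \<comment> \<open>The threshold comes from \<open>zero_index x m \<le> - int m\<close>: with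
    \<open>m = n - 1\<close> at least \<open>nat (1 - k)\<close>, the starting zero lies left of
    \<open>k\<close>.\<close>
  have "normalization_step x n i = ?b" if "n \<ge> Suc (nat (1 - k))" for n
  proof -
    define m where "m = n - 1"
    have m: "n = Suc m" "m \<ge> nat (1 - k)" using that unfolding m_def by simp_all
    then have "zero_index x m < k" using zero_index_le[OF inf, of m] by linarith
    then show ?thesis
      unfolding m normalization_step_Suc[OF inf]
      using one_sided_normalization_beyond_zero[of x "zero_index x m" k i] zero_index_zero[OF inf] assms by simp
  qed
  then have "\<forall>\<^sub>F n in sequentially. normalization_step x n i = ?b"
    unfolding eventually_sequentially by blast
  then have "(\<lambda>n. normalization_step x n i) \<longlonglongrightarrow> ?b" by (rule tendsto_eventually)
  then show ?thesis using inf by (simp add: two_sided_normalization_def limI)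
qed

text \<open>The zero \<open>zero_index x (Suc n)\<close> has \<open>zero_index x n\<close> to its
  right, which keeps its tail below \<open>golden\<close>. So suitable zeros exist arbitrarily far
  left, whatever \<open>x\<close> does on the right.\<close>

lemma obtain_regular_zero:
  fixes i :: int
  assumes inf: "infinite {k. k < 0 \<and> \<not> x k}"
  obtains k where "\<not> x k" "tail_number x k < golden" "k < i"
proof -
  define n where "n = nat (1 - i)"
  have "zero_index x (Suc n) < i" using zero_index_le[OF inf, of "Suc n"] unfolding n_def by linarith
  moreover have "tail_number x (zero_index x (Suc n)) < golden"
    using tail_number_lt_golden[of x "zero_index x n"] zero_index_zero[OF inf] zero_index_less[OF inf] by blast
  ultimately show ?thesis using that zero_index_zero[OF inf] by blast
qed

lemma two_sided_normalization_golden: "two_sided_normalization x \<in> golden_space"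
proof (cases "infinite {k. k < 0 \<and> \<not> x k}")
  case True
  show ?thesis unfolding golden_space_def
  proof (intro CollectI allI)
    fix i
    from obtain_regular_zero[OF True] obtain k where k: "\<not> x k" "tail_number x k < golden" "k < i" .
    have "greedy_expansion k (fractional (tail_number x k)) \<in> golden_space"
      using fractional_bounds[OF tail_number_nonneg k(2)] by (intro greedy_expansion) auto
    then show "\<not> (two_sided_normalization x i \<and> two_sided_normalization x (i + 1))"
      using two_sided_normalization_beyond_zero[OF True k(1,2)] k(3) by (auto simp: golden_space_def)
  qed
qed (simp add: two_sided_normalization_def golden_space_def)

text \<open>The right-hand side is visibly shift invariant and a countable combination of coordinate
  events, which the set of negative coordinates is not.\<close>

lemma infinite_left_zeros_iff:
  "infinite {k::int. k < 0 \<and> \<not> x k} \<longleftrightarrow> (\<forall>N. \<exists>k\<le>N. \<not> x k)"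
proof
  assume inf: "infinite {k. k < 0 \<and> \<not> x k}"
  show "\<forall>N. \<exists>k\<le>N. \<not> x k"
  proof
    fix N from obtain_regular_zero[OF inf, of N] show "\<exists>k\<le>N. \<not> x k" by (metis less_imp_le)
  qed
next
  assume *: "\<forall>N. \<exists>k\<le>N. \<not> x k"
  show "infinite {k. k < 0 \<and> \<not> x k}"
  proof
    assume "finite {k. k < 0 \<and> \<not> x k}"
    then obtain b where b: "\<And>k. k \<in> {k. k < 0 \<and> \<not> x k} \<Longrightarrow> b \<le> k"
      by (meson bdd_below_finite bdd_below.E)
    obtain k where "k \<le> min (-1) (b - 1)" "\<not> x k" using * by blast
    then show False using b[of k] by simp
  qed
qed

text \<open>The construction counts zeros from coordinate 0 and is not visibly equivariant; the
  local formula at a zero makes no reference to 0.\<close>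

lemma two_sided_normalization_shift:
  "two_sided_normalization (\<lambda>i. x (i + m)) = (\<lambda>i. two_sided_normalization x (i + m))"
proof (cases "infinite {k. k < 0 \<and> \<not> x k}")
  case True
  then have "\<forall>N. \<exists>k\<le>N. \<not> x (k + m)"
    unfolding infinite_left_zeros_iff by (metis add_le_cancel_right diff_add_cancel)
  then have inf: "infinite {k. k < 0 \<and> \<not> x (k + m)}"
    using infinite_left_zeros_iff[of "\<lambda>i. x (i + m)"] by simp
  show ?thesis
  proof
    fix i
    from obtain_regular_zero[OF inf] obtain k where
      k: "\<not> x (k + m)" "tail_number (\<lambda>i. x (i + m)) k < golden" "k < i" .
    have e: "tail_number (\<lambda>i. x (i + m)) k = tail_number x (k + m)" by (rule tail_number_shift)
    show "two_sided_normalization (\<lambda>i. x (i + m)) i = two_sided_normalization x (i + m)"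
      using two_sided_normalization_beyond_zero[of "\<lambda>i. x (i + m)" k i, OF inf k]
        two_sided_normalization_beyond_zero[of x "k + m" "i + m", OF True k(1)] k(2,3)
      by (simp add: e greedy_expansion_def)
  qed
next
  case False
  then obtain N where N: "\<forall>k\<le>N. x k" unfolding infinite_left_zeros_iff by auto
  then have "\<forall>k\<le>N - m. x (k + m)" by auto
  then have "\<not> infinite {k. k < 0 \<and> \<not> x (k + m)}"
    using infinite_left_zeros_iff[of "\<lambda>i. x (i + m)"] by auto
  with False show ?thesis by (simp add: two_sided_normalization_def)
qed

section \<open>The carry transducer\<close>

text \<open>The carry at a position is the value of the remaining digits of the normalization minus that
  of the remaining digits of the given sequence, in units of that position: it is 0 in the states
  \<open>Even\<close> and \<open>Kept\<close> (which record the last digit of the normalization), \<open>-1\<close> in \<open>Owed\<close>, and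
  minus the inverse of the golden ratio in \<open>Half\<close>.\<close>

datatype carry_state = Even | Kept | Owed | Half

text \<open>\<open>carry_edge s a b t\<close>: from state \<open>s\<close>, the digit \<open>a\<close> is read, \<open>b\<close> is written.\<close>

definition carry_edge :: "carry_state \<Rightarrow> bool \<Rightarrow> bool \<Rightarrow> carry_state \<Rightarrow> bool" where
  "carry_edge s a b t \<longleftrightarrow> (s, a, b, t) \<in>
     {(Even, False, False, Even), (Even, True, True, Kept), (Even, False, True, Owed),
      (Kept, False, False, Even), (Owed, True, False, Half),
      (Half, True, False, Even), (Half, False, False, Owed), (Half, True, True, Owed)}"

text \<open>State \<open>s k\<close> is the one after position \<open>k\<close>. A path from
  \<open>i\<close> to \<open>j\<close> has states at both ends but reads only digits after
  \<open>i\<close>, so adjacent paths share a state and no digit.\<close>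

definition carry_path ::
  "int \<Rightarrow> int \<Rightarrow> (int \<Rightarrow> bool) \<Rightarrow> (int \<Rightarrow> bool) \<Rightarrow> (int \<Rightarrow> carry_state) \<Rightarrow> bool" where
  "carry_path i j x e s \<longleftrightarrow> (\<forall>k. i < k \<and> k \<le> j \<longrightarrow> carry_edge (s (k - 1)) (x k) (e k) (s k))"

definition carry_state_of :: "real \<Rightarrow> bool \<Rightarrow> carry_state" where
  "carry_state_of D b =
     (if D = 0 then (if b then Kept else Even) else if D = -1 then Owed else Half)"

lemma carry_edge_state_of:
  assumes "D \<in> carries" "D' \<in> carries" "D' = golden * D + of_bool a - of_bool b" "\<not> (b0 \<and> b)"
  shows "carry_edge (carry_state_of D b0) a b (carry_state_of D' b)"
proof -
  have "golden * (1 - golden) = -1" using golden_square by (simp add: right_diff_distrib)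
  then show ?thesis
    using assms golden_bounds
    by (cases a; cases b; cases b0) (auto simp: carries_def carry_state_of_def carry_edge_def)
qed

lemma carry_path_expansion:
  assumes e: "e \<in> golden_space" "\<And>k. i \<le> k \<Longrightarrow> tail_number e k < 1"
    and x: "\<And>k. i \<le> k \<Longrightarrow> tail_number x k < golden"
    and 0: "tail_number e i - tail_number x i \<in> carries"
  shows "\<And>j. i \<le> j \<Longrightarrow> tail_number e j - tail_number x j \<in> carries"
    and "carry_path i j x e (\<lambda>k. carry_state_of (tail_number e k - tail_number x k) (e k))"
proof -
  show *: "tail_number e j - tail_number x j \<in> carries" if "i \<le> j" for j
  proof (rule carries_induct[where D = "\<lambda>k. tail_number e k - tail_number x k", OF 0 carry_step _ that])
    show "- golden < tail_number e k - tail_number x k \<and> tail_number e k - tail_number x k < 1"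
      if "i < k" for k
      using e(2)[of k] x[of k] that tail_number_nonneg[of e k] tail_number_nonneg[of x k] by simp
  qed
  show "carry_path i j x e (\<lambda>k. carry_state_of (tail_number e k - tail_number x k) (e k))"
    unfolding carry_path_def
  proof (intro allI impI carry_edge_state_of carry_step *)
    fix k show "\<not> (e (k - 1) \<and> e k)" using golden_spaceD[OF e(1), of "k - 1"] by auto
  qed auto
qed

text \<open>The states are read off from the carries of the whole sequences, without reference to
  the zero \<open>k\<close> chosen inside, so one \<open>s\<close> serves every window. The zeros on
  the right keep all tails of \<open>x\<close> below \<open>golden\<close>.\<close>

lemma carry_path_two_sided_normalization:
  assumes inf: "infinite {k. k < 0 \<and> \<not> x k}" and right: "\<And>N. \<exists>k\<ge>N. \<not> x k"
  shows "\<exists>s. \<forall>i j. carry_path i j x (two_sided_normalization x) s"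
proof (intro exI allI)
  fix i j
  let ?e = "two_sided_normalization x"
  from obtain_regular_zero[OF inf] obtain k where k: "\<not> x k" "tail_number x k < golden" "k < i" .
  let ?g = "greedy_expansion k (fractional (tail_number x k))"
  have f: "0 \<le> fractional (tail_number x k)" "fractional (tail_number x k) < 1"
    using fractional_bounds[OF tail_number_nonneg k(2)] by auto
  note g = greedy_expansion[OF f, of k]
  have eq: "tail_number ?e l = tail_number ?g l" if "k \<le> l" for l
    by (rule tail_number_cong) (use two_sided_normalization_beyond_zero[OF inf k(1,2)] that in auto)
  have "carry_path k j x ?e (\<lambda>k. carry_state_of (tail_number ?e k - tail_number x k) (?e k))"
  proof (rule carry_path_expansion(2)[OF two_sided_normalization_golden])
    show "tail_number ?e l < 1" if "k \<le> l" for l using eq[OF that] g(2)[OF that] by simp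
    show "tail_number x l < golden" for l
    proof -
      obtain m where "l + 1 \<le> m" "\<not> x m" using right by blast
      then show ?thesis using tail_number_lt_golden[of x m l] by simp
    qed
    show "tail_number ?e k - tail_number x k \<in> carries"
      using eq[of k] g(1) by (auto simp: fractional_def carries_def)
  qed
  then show "carry_path i j x ?e (\<lambda>k. carry_state_of (tail_number ?e k - tail_number x k) (?e k))"
    using \<open>k < i\<close> by (auto simp: carry_path_def)
qed

section \<open>Uniqueness and synchronization of paths\<close>

lemma carry_path_edge:
  "carry_path i j x e s \<Longrightarrow> i \<le> k \<Longrightarrow> k < j \<Longrightarrow> carry_edge (s k) (x (k + 1)) (e (k + 1)) (s (k + 1))"
  unfolding carry_path_def by (drule spec[of _ "k + 1"]) simp

lemma carry_path_sub: "carry_path i j x e s \<Longrightarrow> i \<le> i' \<Longrightarrow> j' \<le> j \<Longrightarrow> carry_path i' j' x e s"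
  by (auto simp: carry_path_def)

lemma carry_path_cong:
  assumes "\<And>k. i < k \<Longrightarrow> k \<le> j \<Longrightarrow> x k = x' k \<and> e k = e' k" "\<And>k. i \<le> k \<Longrightarrow> k \<le> j \<Longrightarrow> s k = s' k"
  shows "carry_path i j x e s \<longleftrightarrow> carry_path i j x' e' s'"
  unfolding carry_path_def by (rule all_cong1) (use assms in auto)

lemma carry_path_shift:
  "carry_path (i + m) (j + m) x e s \<longleftrightarrow>
     carry_path i j (\<lambda>k. x (k + m)) (\<lambda>k. e (k + m)) (\<lambda>k. s (k + m))"
proof -
  have "(\<forall>k. P k) \<longleftrightarrow> (\<forall>k. P (k + m))" for P :: "int \<Rightarrow> bool"
    by (metis diff_add_cancel)
  from this[of "\<lambda>k. i + m < k \<and> k \<le> j + m \<longrightarrow> carry_edge (s (k - 1)) (x k) (e k) (s k)"]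
  show ?thesis by (simp add: carry_path_def algebra_simps)
qed

lemma carry_path_append:
  assumes "carry_path i j x e s" "carry_path j k x e' s'" "s j = s' j" "i \<le> j" "j \<le> k"
  shows "carry_path i k x (\<lambda>l. if l \<le> j then e l else e' l) (\<lambda>l. if l \<le> j then s l else s' l)"
  unfolding carry_path_def
proof (intro allI impI)
  fix l assume l: "i < l \<and> l \<le> k"
  consider "l \<le> j" | "l = j + 1" | "j + 1 < l" by linarith
  then show "carry_edge (if l - 1 \<le> j then s (l - 1) else s' (l - 1)) (x l)
      (if l \<le> j then e l else e' l) (if l \<le> j then s l else s' l)"
  proof cases
    case 2
    then show ?thesis using assms(3) l carry_path_edge[OF assms(2), of j] by simp
  qed (use assms l in \<open>auto simp: carry_path_def\<close>)
qed

text \<open>Paths reading the same digits split only at \<open>Even\<close> reading 0 or at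
  \<open>Half\<close> reading 1, both times into \<open>Even\<close> and \<open>Owed\<close>. From
  there a 1 leads to \<open>Kept\<close> and \<open>Half\<close>, and a 0 leads from these back; the
  other digit leaves one of the two paths without an edge.\<close>

definition diverged :: "carry_state \<Rightarrow> carry_state \<Rightarrow> bool" where
  "diverged s t \<longleftrightarrow> (s, t) \<in> {(Even, Owed), (Owed, Even), (Kept, Half), (Half, Kept)}"

text \<open>One finite check for two situations: the moment of splitting, with \<open>s = s'\<close>
  and \<open>t \<noteq> t'\<close>, and every later step, with \<open>diverged s s'\<close>. The
  last hypothesis is the disjunction of the two.\<close>

lemma carry_edge_diverge:
  assumes "carry_edge s a b t" "carry_edge s' a b' t'" "s = s' \<or> diverged s s'" "t = t' \<Longrightarrow> s \<noteq> s'"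
  shows "diverged t t'"
  using assms by (auto simp: carry_edge_def diverged_def)

lemma carry_edge_digit_unique: "carry_edge s a b t \<Longrightarrow> carry_edge s a b' t \<Longrightarrow> b = b'"
  by (auto simp: carry_edge_def)

text \<open>Two paths reading the same digits may diverge, but then they never meet again.\<close>
lemma carry_path_unique:
  assumes p: "carry_path i j x e s" and p': "carry_path i j x e' s'"
    and i: "s i = s' i" and j: "s j = s' j" and k: "i \<le> k" "k \<le> j"
  shows "s k = s' k" and "i < k \<Longrightarrow> e k = e' k"
proof -
  have edges: "carry_edge (s k) (x (k + 1)) (e (k + 1)) (s (k + 1))"
    "carry_edge (s' k) (x (k + 1)) (e' (k + 1)) (s' (k + 1))" if "i \<le> k" "k < j" for k
    using carry_path_edge[OF p that] carry_path_edge[OF p' that] by simp_all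
  have div: "diverged (s (k + int n)) (s' (k + int n))"
    if "i \<le> k" "diverged (s k) (s' k)" "k + int n \<le> j" for k n
    using that(3)
  proof (induction n)
    case (Suc n)
    have "diverged (s (k + int n)) (s' (k + int n))" using Suc by simp
    moreover from this have "s (k + int n) \<noteq> s' (k + int n)" by (auto simp: diverged_def)
    ultimately have "diverged (s (k + int n + 1)) (s' (k + int n + 1))"
      using carry_edge_diverge[OF edges[of "k + int n"]] Suc(2) \<open>i \<le> k\<close> by simp
    then show ?case by (simp add: add_ac)
  qed (use that in simp)
  have eq: "s (i + int n) = s' (i + int n)" if "i + int n \<le> j" for n
    using that
  proof (induction n)
    case (Suc n)
    let ?k = "i + int n + 1"
    have k: "i + int (Suc n) = ?k" by simp
    show ?case unfolding k
    proof (rule ccontr)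
      assume n: "s ?k \<noteq> s' ?k"
      have "diverged (s ?k) (s' ?k)"
        by (rule carry_edge_diverge[OF edges[of "i + int n"]]) (use n Suc in auto)
      then have "diverged (s (?k + int (nat (j - ?k)))) (s' (?k + int (nat (j - ?k))))"
        by (rule div[rotated]) (use Suc(2) in auto)
      then show False using Suc(2) j by (auto simp: diverged_def)
    qed
  qed (use i in simp)
  have eq': "s k = s' k" if "i \<le> k" "k \<le> j" for k
    using eq[of "nat (k - i)"] that by simp
  show "s k = s' k" by (rule eq'[OF k])
  assume "i < k"
  then have "carry_edge (s (k - 1)) (x k) (e k) (s k)" "carry_edge (s (k - 1)) (x k) (e' k) (s k)"
    using edges[of "k - 1"] k eq'[of k] eq'[of "k - 1"] by simp_all
  then show "e k = e' k" by (rule carry_edge_digit_unique)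
qed

text \<open>Reading 0 ends in \<open>Even\<close> or \<open>Owed\<close>, and \<open>Owed\<close>
  has no edge reading 0. This synchronizes all paths, whatever they did before.\<close>

lemma carry_path_two_zeros:
  assumes "carry_path (k - 1) (k + 1) x e s" "\<not> x k" "\<not> x (k + 1)"
  shows "s k = Even"
proof -
  have "carry_edge (s (k - 1)) (x k) (e k) (s k)" "carry_edge (s k) (x (k + 1)) (e (k + 1)) (s (k + 1))"
    using carry_path_edge[OF assms(1), of "k - 1"] carry_path_edge[OF assms(1), of k] by simp_all
  then show ?thesis using assms(2,3) by (auto simp: carry_edge_def)
qed

text \<open>After a one and an even number of zeros the state is \<open>Even\<close> or \<open>Owed\<close>, and in \<open>Owed\<close> no one can
  be written: this is what makes the block boundaries regeneration times.\<close>
lemma carry_path_even_gap: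
  assumes p: "carry_path (j - 2 * int l - 1) (j + 1) x e s" and "l \<ge> 1"
    and e: "e (j - 2 * int l)" "\<And>k. j - 2 * int l < k \<Longrightarrow> k \<le> j \<Longrightarrow> \<not> e k" "e (j + 1)"
  shows "s j = Even"
proof -
  note edge = carry_path_edge[OF p]
  define i where "i = j - 2 * int l"
  have start: "s i \<in> {Kept, Owed}"
    using edge[of "i - 1"] e(1) by (auto simp: i_def carry_edge_def)
  \<comment> \<open>Evenness enters here: writing zeros from \<open>Owed\<close> passes through
    \<open>Half\<close>, which could write a 1 after an odd number of zeros.\<close>
  have two: "u \<in> {Even, Owed}"
    if "carry_edge s a False t" "carry_edge t a' False u" "s \<in> {Kept, Owed, Even}" for s t u a a'
    using that by (auto simp: carry_edge_def)
  have step: "s (k + 2) \<in> {Even, Owed}" if "s k \<in> {Kept, Owed, Even}" "i \<le> k" "k + 2 \<le> j" for k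
  proof -
    have "\<not> e (k + 1)" "\<not> e (k + 2)" using e(2) that by (auto simp: i_def)
    then have "carry_edge (s k) (x (k + 1)) False (s (k + 1))"
      "carry_edge (s (k + 1)) (x (k + 2)) False (s (k + 2))"
      using edge[of k] edge[of "k + 1"] that by (simp_all add: i_def add.commute)
    then show ?thesis using two that(1) by blast
  qed
  have "s (i + 2 * int n) \<in> {Even, Owed}" if "1 \<le> n" "n \<le> l" for n
    using that
  proof (induction n rule: nat_induct_at_least)
    case base
    have "s (i + 2) \<in> {Even, Owed}"
      by (rule step) (use start \<open>l \<ge> 1\<close> in \<open>auto simp: i_def\<close>)
    then show ?case by simp
  next
    case (Suc n)
    have "s (i + 2 * int n + 2) \<in> {Even, Owed}" by (rule step) (use Suc in \<open>auto simp: i_def\<close>)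
    then show ?case by (simp add: algebra_simps)
  qed
  from this[of l] have "s j \<in> {Even, Owed}" using \<open>l \<ge> 1\<close> by (simp add: i_def)
  moreover have "carry_edge (s j) (x (j + 1)) True (s (j + 1))" using edge[of j] e(3) by (simp add: i_def)
  ultimately show ?thesis by (auto simp: carry_edge_def)
qed

section \<open>The coin tossing measure\<close>

text \<open>A countable base for \<open>bool\<close> makes the Borel sets of the sequence space the
  product sets, which relates \<open>borel\<close> in the statement to
  \<open>coin_measure\<close>.\<close>

instance bool :: second_countable_topology
proof
  show "\<exists>B :: bool set set. countable B \<and> open = generate_topology B"
    by (intro exI[of _ "range lessThan \<union> range greaterThan"]) (auto simp: open_bool_def)
qed

abbreviation fair_bit :: "bool measure" where
  "fair_bit \<equiv> measure_pmf (bernoulli_pmf (1/2))"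

lemma product_prob_space_fair_bit: "product_prob_space (\<lambda>_. fair_bit)"
  by unfold_locales

interpretation coin: prob_space coin_measure
  unfolding coin_measure_def
  by (intro prob_space_PiM) unfold_locales

lemma space_coin_measure [simp]: "space coin_measure = UNIV"
  by (simp add: coin_measure_def space_PiM)

lemma measurable_coin_component [measurable]: "(\<lambda>x. x i) \<in> coin_measure \<rightarrow>\<^sub>M count_space UNIV"
  unfolding coin_measure_def by (subst measurable_cong_sets[OF refl sets_measure_pmf_count_space[symmetric]])
     (rule measurable_component_singleton, simp)

lemma sets_coin_measure: "sets coin_measure = sets borel"
proof -
  have "sets coin_measure = sets (Pi\<^sub>M UNIV (\<lambda>_::int. borel :: bool measure))"
    unfolding coin_measure_def by (intro sets_PiM_cong refl) (simp add: sets_borel_eq_count_space)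
  then show ?thesis by (simp add: sets_PiM_equal_borel)
qed

lemma measurable_borel_component:
  "(\<lambda>x :: int \<Rightarrow> bool. x i) \<in> borel \<rightarrow>\<^sub>M count_space UNIV"
  using measurable_coin_component measurable_cong_sets[OF sets_coin_measure refl] by blast

lemma measurable_to_sequences:
  assumes "\<And>i. (\<lambda>y. f y i) \<in> M \<rightarrow>\<^sub>M count_space UNIV"
  shows "f \<in> M \<rightarrow>\<^sub>M (borel :: (int \<Rightarrow> bool) measure)"
proof -
  have "(\<lambda>y. \<lambda>i\<in>UNIV. f y i) \<in> M \<rightarrow>\<^sub>M Pi\<^sub>M UNIV (\<lambda>_. count_space UNIV)"
    by (rule measurable_restrict) (use assms in simp)
  moreover have "sets (Pi\<^sub>M UNIV (\<lambda>_::int. count_space (UNIV :: bool set))) = sets borel"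
  proof -
    have "sets (Pi\<^sub>M UNIV (\<lambda>_::int. count_space (UNIV :: bool set))) = sets coin_measure"
      unfolding coin_measure_def by (intro sets_PiM_cong refl) simp
    then show ?thesis by (simp add: sets_coin_measure)
  qed
  ultimately show ?thesis using measurable_cong_sets[OF refl] by (simp add: restrict_def) blast
qed

lemma coin_cylinder:
  assumes "finite J"
  shows "coin.prob {x. \<forall>i\<in>J. x i = y i} = (1/2) ^ card J"
proof -
  interpret product_prob_space "\<lambda>_::int. fair_bit" UNIV by (rule product_prob_space_fair_bit)
  have "emeasure coin_measure {x. \<forall>i\<in>J. x i = y i} = (\<Prod>i\<in>J. emeasure fair_bit {y i})"
    using emeasure_PiM_Collect[of J "\<lambda>i. {y i}"] assms by (simp add: coin_measure_def space_PiM)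
  also have "\<dots> = (\<Prod>i\<in>J. ennreal (1/2))"
    by (intro prod.cong refl) (auto simp: emeasure_pmf_single pmf_bernoulli_True pmf_bernoulli_False split: if_splits)
  also have "\<dots> = ennreal ((1/2) ^ card J)"
    unfolding prod_constant by (rule ennreal_power) simp
  finally show ?thesis by (simp add: measure_def)
qed

lemma distr_coin_shift: "distr coin_measure coin_measure (\<lambda>x i. x (i + m)) = coin_measure"
  using distr_PiM_reindex[of UNIV "\<lambda>_. fair_bit" "\<lambda>i. i + m" UNIV]
  unfolding coin_measure_def by (simp add: inj_on_def measure_pmf.prob_space_axioms restrict_def)

lemma measurable_coin_shift [measurable]: "(\<lambda>x i. x (i + m)) \<in> coin_measure \<rightarrow>\<^sub>M coin_measure"
  using measurable_to_sequences[of "\<lambda>x i. x (i + m)" coin_measure]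
  by (simp cong: measurable_cong_sets add: sets_coin_measure)

lemma coin_prob_shift:
  assumes [measurable]: "A \<in> sets coin_measure"
  shows "coin.prob {x. (\<lambda>i. x (i + m)) \<in> A} = coin.prob A"
proof -
  have "measure (distr coin_measure coin_measure (\<lambda>x i. x (i + m))) A =
      coin.prob ((\<lambda>x i. x (i + m)) -` A \<inter> space coin_measure)"
    by (rule measure_distr) measurable
  then show ?thesis by (simp add: distr_coin_shift vimage_def)
qed

definition depends_on :: "int set \<Rightarrow> (int \<Rightarrow> bool) set \<Rightarrow> bool" where
  "depends_on K A \<longleftrightarrow> (\<forall>x y. (\<forall>i\<in>K. x i = y i) \<longrightarrow> x \<in> A \<longrightarrow> y \<in> A)"

lemma depends_onD: "depends_on K A \<Longrightarrow> (\<And>i. i \<in> K \<Longrightarrow> x i = y i) \<Longrightarrow> x \<in> A \<longleftrightarrow> y \<in> A"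
  unfolding depends_on_def by metis

text \<open>Such a set is a finite union of cylinders. This gives measurability of events defined by
  existence of finite paths, without any formula in the coordinates.\<close>

lemma depends_on_finite:
  assumes "depends_on K A" "finite K"
  shows "A \<in> sets coin_measure"
proof -
  let ?C = "\<lambda>S. {x. \<forall>i\<in>K. x i = (i \<in> S)}"
  have "A = (\<Union>S \<in> {S \<in> Pow K. (\<lambda>i. i \<in> S) \<in> A}. ?C S)"
  proof (intro equalityI subsetI)
    fix x assume x: "x \<in> A"
    have "(\<lambda>i. i \<in> {i \<in> K. x i}) \<in> A"
      by (subst depends_onD[OF assms(1), of _ x]) (use x in auto)
    then show "x \<in> (\<Union>S \<in> {S \<in> Pow K. (\<lambda>i. i \<in> S) \<in> A}. ?C S)"
      by (intro UN_I[of "{i \<in> K. x i}"]) auto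
  next
    fix x assume "x \<in> (\<Union>S \<in> {S \<in> Pow K. (\<lambda>i. i \<in> S) \<in> A}. ?C S)"
    then obtain S where "(\<lambda>i. i \<in> S) \<in> A" "\<And>i. i \<in> K \<Longrightarrow> x i = (i \<in> S)" by auto
    then show "x \<in> A" using depends_onD[OF assms(1), of x "\<lambda>i. i \<in> S"] by simp
  qed
  moreover have "?C S \<in> sets coin_measure" for S
  proof -
    have "{x \<in> space coin_measure. \<forall>i\<in>K. x i = (i \<in> S)} \<in> sets coin_measure"
      using \<open>finite K\<close> by (intro sets.sets_Collect_finite_All) measurable
    then show ?thesis by simp
  qed
  moreover have "finite {S \<in> Pow K. (\<lambda>i. i \<in> S) \<in> A}" using \<open>finite K\<close> by simp
  ultimately show ?thesis using sets.finite_UN by (metis (no_types, lifting))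
qed

lemma coin_indep_components: "coin.indep_vars (\<lambda>_. fair_bit) (\<lambda>i x. x i) UNIV"
proof (subst coin.indep_vars_iff_distr_eq_PiM)
  interpret product_prob_space "\<lambda>_::int. fair_bit" UNIV by (rule product_prob_space_fair_bit)
  show "(\<lambda>x. x i) \<in> coin_measure \<rightarrow>\<^sub>M fair_bit" for i
    using measurable_coin_component by (simp cong: measurable_cong_sets)
  have "distr coin_measure fair_bit (\<lambda>x. x i) = fair_bit" for i
    using PiM_component[of i] by (simp add: coin_measure_def)
  then show "distr coin_measure (\<Pi>\<^sub>M i\<in>UNIV. fair_bit) (\<lambda>x. \<lambda>i\<in>UNIV. x i) =
      (\<Pi>\<^sub>M i\<in>UNIV. distr coin_measure fair_bit (\<lambda>x. x i))"
    by (simp add: restrict_def distr_id flip: coin_measure_def)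
qed auto

text \<open>Restrictions to disjoint index sets are independent, but they live in products over
  \<open>K\<close> and \<open>L\<close>. Extending them by \<open>False\<close> returns to full
  sequences without changing membership in \<open>A\<close> and \<open>B\<close>.\<close>

lemma coin_indep:
  assumes A: "A \<in> sets coin_measure" "depends_on K A" and B: "B \<in> sets coin_measure" "depends_on L B"
    and "K \<inter> L = {}"
  shows "coin.prob (A \<inter> B) = coin.prob A * coin.prob B"
proof -
  have m: "(\<lambda>y i. i \<in> K \<and> y i) \<in> Pi\<^sub>M K (\<lambda>_. fair_bit) \<rightarrow>\<^sub>M coin_measure" for K :: "int set"
  proof -
    have "(\<lambda>y. i \<in> K \<and> y i) \<in> Pi\<^sub>M K (\<lambda>_. fair_bit) \<rightarrow>\<^sub>M count_space UNIV" for i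
    proof (cases "i \<in> K")
      case True
      then have "(\<lambda>y. y i) \<in> Pi\<^sub>M K (\<lambda>_. fair_bit) \<rightarrow>\<^sub>M fair_bit" by (rule measurable_component_singleton)
      then have "(\<lambda>y. y i) \<in> Pi\<^sub>M K (\<lambda>_. fair_bit) \<rightarrow>\<^sub>M count_space UNIV"
        unfolding measurable_pmf_measure2 .
      then show ?thesis by (simp only: True simp_thms)
    qed simp
    then have "(\<lambda>y i. i \<in> K \<and> y i) \<in> Pi\<^sub>M K (\<lambda>_. fair_bit) \<rightarrow>\<^sub>M borel"
      by (rule measurable_to_sequences)
    then show ?thesis using measurable_cong_sets[OF refl sets_coin_measure] by blast
  qed
  have "coin.indep_var (Pi\<^sub>M K (\<lambda>_. fair_bit)) (\<lambda>x. restrict x K) (Pi\<^sub>M L (\<lambda>_. fair_bit)) (\<lambda>x. restrict x L)"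
    using coin.indep_var_restrict[OF coin_indep_components \<open>K \<inter> L = {}\<close>] by simp
  from coin.indep_var_compose[OF this m m]
  have "coin.indep_var coin_measure (\<lambda>x i. i \<in> K \<and> x i) coin_measure (\<lambda>x i. i \<in> L \<and> x i)"
    by (simp add: comp_def restrict_def cong: conj_cong)
  from coin.indep_varD[OF this A(1) B(1)]
  have "coin.prob ((\<lambda>x. (\<lambda>i. i \<in> K \<and> x i, \<lambda>i. i \<in> L \<and> x i)) -` (A \<times> B)) =
      coin.prob ((\<lambda>x i. i \<in> K \<and> x i) -` A) * coin.prob ((\<lambda>x i. i \<in> L \<and> x i) -` B)"
    by simp
  moreover have "(\<lambda>i. i \<in> K \<and> x i) \<in> A \<longleftrightarrow> x \<in> A" for x by (rule depends_onD[OF A(2)]) auto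
  moreover have "(\<lambda>i. i \<in> L \<and> x i) \<in> B \<longleftrightarrow> x \<in> B" for x by (rule depends_onD[OF B(2)]) auto
  moreover have "(\<lambda>x. (\<lambda>i. i \<in> K \<and> x i, \<lambda>i. i \<in> L \<and> x i)) -` (A \<times> B) = A \<inter> B"
    "(\<lambda>x i. i \<in> K \<and> x i) -` A = A" "(\<lambda>x i. i \<in> L \<and> x i) -` B = B"
    using calculation(2,3) by auto
  ultimately show ?thesis by simp
qed

lemma measurable_tail_number [measurable]: "(\<lambda>x. tail_number x j) \<in> borel_measurable coin_measure"
  unfolding tail_number_def by measurable

lemma measurable_greedy_remainder [measurable]: "(\<lambda>u. greedy_remainder u n) \<in> borel_measurable borel"
proof (induction n)
  case (Suc n)
  note [measurable] = Suc
  show ?case unfolding greedy_remainder.simps Let_def by measurable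
qed simp

text \<open>Countable quantifiers replace the limit: the digit is 1 iff the local formula at some
  zero left of it says so, and all zeros to which the formula applies agree.\<close>

lemma measurable_two_sided_normalization_component:
  "(\<lambda>x. two_sided_normalization x i) \<in> coin_measure \<rightarrow>\<^sub>M count_space UNIV"
proof -
  have "two_sided_normalization x i \<longleftrightarrow> (\<forall>N. \<exists>k\<le>N. \<not> x k) \<and>
      (\<exists>k. k < i \<and> \<not> x k \<and> tail_number x k < golden \<and> greedy_expansion k (fractional (tail_number x k)) i)" for x
  proof (cases "\<forall>N. \<exists>k\<le>N. \<not> x k")
    case True
    then have inf: "infinite {k. k < 0 \<and> \<not> x k}" by (simp add: infinite_left_zeros_iff)
    from obtain_regular_zero[OF inf, of i] obtain k where "\<not> x k" "tail_number x k < golden" "k < i" .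
    then show ?thesis using True two_sided_normalization_beyond_zero[OF inf] by blast
  next
    case False
    then have "\<not> infinite {k. k < 0 \<and> \<not> x k}" unfolding infinite_left_zeros_iff .
    with False show ?thesis by (simp add: two_sided_normalization_def)
  qed
  then have "(\<lambda>x. two_sided_normalization x i) = (\<lambda>x. (\<forall>N. \<exists>k. k \<le> N \<and> \<not> x k) \<and>
      (\<exists>k. k < i \<and> \<not> x k \<and> tail_number x k < golden \<and> (k < i \<and>
        1 \<le> golden * greedy_remainder (if tail_number x k < 1 then tail_number x k else tail_number x k - 1) (nat (i - k - 1)))))"
    by (auto simp: fun_eq_iff greedy_expansion_def greedy_digit_def fractional_def)
  then show ?thesis by simp
qed

lemma measurable_two_sided_normalization:
  "two_sided_normalization \<in> coin_measure \<rightarrow>\<^sub>M restrict_space borel golden_space"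
proof (rule measurable_restrict_space2)
  show "two_sided_normalization \<in> borel_measurable coin_measure"
    by (intro measurable_to_sequences measurable_two_sided_normalization_component)
qed (use two_sided_normalization_golden in blast)

text \<open>The normalization copies the inner digits 1001 of the word 00100100, which form a separator.\<close>
definition sync_at :: "(int \<Rightarrow> bool) \<Rightarrow> int \<Rightarrow> bool" where
  "sync_at x i \<longleftrightarrow> (\<forall>k\<in>{i+1..i+8}. x k = (k = i + 3 \<or> k = i + 6))"

definition sync_recurrent :: "(int \<Rightarrow> bool) \<Rightarrow> bool" where
  "sync_recurrent x \<longleftrightarrow> (\<forall>N. \<exists>i\<ge>N. sync_at x i) \<and> (\<forall>N. \<exists>i\<le>N. sync_at x i)"

section \<open>Almost sure recurrence of the synchronizing word\<close>

lemma sync_at_cong: "(\<And>k. k \<in> {i+1..i+8} \<Longrightarrow> x k = y k) \<Longrightarrow> sync_at x i = sync_at y i"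
  unfolding sync_at_def by (intro ball_cong refl) metis

lemma depends_on_sync: "depends_on {i+1..i+8} {x. sync_at x i}"
  unfolding depends_on_def mem_Collect_eq using sync_at_cong[of i] by (metis (full_types))

lemma depends_on_Compl: "depends_on K A \<Longrightarrow> depends_on K (- A)"
  unfolding depends_on_def by (metis ComplD ComplI)

lemma depends_on_no_sync:
  "depends_on {a+1..a + 8 * int M} {x. \<forall>m<M. \<not> sync_at x (a + 8 * int m)}"
  unfolding depends_on_def
proof (intro allI impI)
  fix x y assume xy: "\<forall>i\<in>{a+1..a + 8 * int M}. x i = y i"
    and x: "x \<in> {x. \<forall>m<M. \<not> sync_at x (a + 8 * int m)}"
  have "sync_at x (a + 8 * int m) = sync_at y (a + 8 * int m)" if "m < M" for m
    by (rule sync_at_cong) (use xy that in auto)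
  with x show "y \<in> {x. \<forall>m<M. \<not> sync_at x (a + 8 * int m)}" by simp
qed

text \<open>Windows starting 8 apart are disjoint, so the events are independent, and each window
  spells the word with probability \<open>(1/2)^8\<close>.\<close>

lemma coin_prob_no_sync:
  "coin.prob {x. \<forall>m<M. \<not> sync_at x (a + 8 * int m)} = (1 - (1/2)^8) ^ M"
proof (induction M)
  case 0 then show ?case using coin.prob_space by simp
next
  case (Suc M)
  let ?E = "{x. \<forall>m<M. \<not> sync_at x (a + 8 * int m)}" and ?c = "a + 8 * int M"
  let ?W = "{x. sync_at x ?c}"
  note E = depends_on_no_sync[of a M]
  note W = depends_on_sync[of ?c] and W' = depends_on_Compl[OF depends_on_sync[of ?c]]
  have pW: "coin.prob ?W = (1/2)^8"
    unfolding sync_at_def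
    using coin_cylinder[of "{?c+1..?c+8}" "\<lambda>k. k = ?c + 3 \<or> k = ?c + 6"] by simp
  have "{x. \<forall>m<Suc M. \<not> sync_at x (a + 8 * int m)} = ?E \<inter> - ?W"
    by (auto simp only: less_Suc_eq Int_iff Compl_iff mem_Collect_eq)
  also have "coin.prob \<dots> = coin.prob ?E * coin.prob (- ?W)"
    by (rule coin_indep[OF depends_on_finite[OF E] E depends_on_finite[OF W'] W']) auto
  also have "coin.prob (- ?W) = 1 - (1/2)^8"
    using coin.prob_compl[OF depends_on_finite[OF W]] pW by (simp add: Compl_eq_Diff_UNIV)
  finally show ?case using Suc by simp
qed

text \<open>The start \<open>a M\<close> may depend on the number of windows: for recurrence to the
  left the \<open>M\<close> windows must begin further and further left, while to the right a fixed
  start suffices.\<close>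

lemma AE_sync:
  assumes "\<And>x M. P x \<Longrightarrow> \<forall>m<M. \<not> sync_at x (a M + 8 * int m)"
  shows "AE x in coin_measure. \<not> P x"
proof -
  let ?E = "\<lambda>M. {x. \<forall>m<M. \<not> sync_at x (a M + 8 * int m)}"
  have meas: "?E M \<in> sets coin_measure" for M
    by (rule depends_on_finite[OF depends_on_no_sync]) simp
  have "coin.prob (\<Inter>M. ?E M) \<le> (1 - (1/2)^8) ^ M" for M
  proof -
    have "coin.prob (\<Inter>M. ?E M) \<le> coin.prob (?E M)"
      by (rule coin.finite_measure_mono[OF _ meas]) blast
    then show ?thesis by (simp only: coin_prob_no_sync)
  qed
  moreover have "(\<lambda>M. (1 - (1/2)^8 :: real) ^ M) \<longlonglongrightarrow> 0"
    by (rule LIMSEQ_realpow_zero) (simp_all add: power_divide)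
  ultimately have "coin.prob (\<Inter>M. ?E M) \<le> 0"
    using LIMSEQ_le_const by blast
  then have null: "emeasure coin_measure (\<Inter>M. ?E M) = 0"
    by (simp only: coin.emeasure_eq_measure measure_le_0_iff ennreal_0)
  show ?thesis
  proof (rule AE_I[OF _ null])
    show "{x \<in> space coin_measure. \<not> \<not> P x} \<subseteq> (\<Inter>M. ?E M)" using assms by blast
    show "(\<Inter>M. ?E M) \<in> sets coin_measure"
      using meas by (intro sets.countable_INT) auto
  qed
qed

lemma AE_sync_recurrent: "AE x in coin_measure. sync_recurrent x"
proof -
  have "AE x in coin_measure. \<not> (\<forall>i\<ge>N. \<not> sync_at x i)" for N
    by (rule AE_sync[where a = "\<lambda>_. N"]) auto
  moreover have "AE x in coin_measure. \<not> (\<forall>i\<le>N. \<not> sync_at x i)" for N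
    by (rule AE_sync[where a = "\<lambda>M. N - 8 * int M"]) auto
  ultimately have "AE x in coin_measure. \<forall>N. \<not> (\<forall>i\<ge>N. \<not> sync_at x i) \<and> \<not> (\<forall>i\<le>N. \<not> sync_at x i)"
    by (simp add: AE_all_countable AE_conj_iff)
  then show ?thesis by (rule AE_mp) (auto simp: sync_recurrent_def)
qed

section \<open>Blocks and independence of past and future\<close>

definition spells :: "(int \<Rightarrow> bool) \<Rightarrow> int \<Rightarrow> bool list \<Rightarrow> bool" where
  "spells e j w \<longleftrightarrow> (\<forall>i<length w. e (j + int i) = w ! i)"

definition even_gap :: "(int \<Rightarrow> bool) \<Rightarrow> int \<Rightarrow> nat \<Rightarrow> bool" where
  "even_gap e j l \<longleftrightarrow> 1 \<le> l \<and> e (j - 2 * int l) \<and> (\<forall>k. j - 2 * int l < k \<and> k \<le> j \<longrightarrow> \<not> e k)"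

lemma spells_Nil [simp]: "spells e j []"
  by (simp add: spells_def)

lemma spells_Cons [simp]: "spells e j (b # w) \<longleftrightarrow> e j = b \<and> spells e (j + 1) w"
  by (simp add: spells_def All_less_Suc2 add_ac)

lemma spells_append: "spells e j (v @ w) \<longleftrightarrow> spells e j v \<and> spells e (j + int (length v)) w"
  by (induction v arbitrary: j) (simp_all add: add_ac)

lemma spells_shift: "spells (\<lambda>i. e (i + m)) j w \<longleftrightarrow> spells e (j + m) w"
  by (simp add: spells_def add_ac)

lemma spells_cong:
  "(\<And>i. j \<le> i \<Longrightarrow> i < j + int (length w) \<Longrightarrow> e i = e' i) \<Longrightarrow> spells e j w \<longleftrightarrow> spells e' j w"
  by (simp add: spells_def)

lemma spells_iff_map: "spells e j w \<longleftrightarrow> w = map e [j..j + int (length w) - 1]"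
proof
  assume "spells e j w"
  then show "w = map e [j..j + int (length w) - 1]"
    by (intro nth_equalityI) (simp_all add: spells_def nth_upto)
next
  assume eq: "w = map e [j..j + int (length w) - 1]"
  show "spells e j w" unfolding spells_def
  proof (intro allI impI)
    fix n assume "n < length w"
    then have "map e [j..j + int (length w) - 1] ! n = e (j + int n)" by (simp add: nth_upto)
    moreover have "w ! n = map e [j..j + int (length w) - 1] ! n" by (rule arg_cong[OF eq])
    ultimately show "e (j + int n) = w ! n" by simp
  qed
qed

lemma golden_block_nonempty: "golden_block b \<Longrightarrow> b \<noteq> []"
  by (simp add: golden_block_def)

lemma golden_block_starts: "golden_block b \<Longrightarrow> spells e j b \<Longrightarrow> e j"
  unfolding golden_block_def spells_def by (metis add_0_right hd_conv_nth length_greater_0_conv of_nat_0)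

text \<open>The bound \<open>2 * l < length b\<close> keeps the leading 1 of the gap inside the
  block, so that a path starting with the block sees the whole gap.\<close>

lemma golden_block_even_gap:
  assumes "golden_block b" "spells e j b"
  obtains l where "even_gap e (j + int (length b) - 1) l" "2 * l < length b"
proof -
  obtain u l where l: "l \<ge> 1" "b = u @ [True] @ replicate (2 * l) False"
    using assms(1) unfolding golden_block_def by blast
  have sp: "spells e (j + int (length u)) [True]" "spells e (j + int (length u) + 1) (replicate (2 * l) False)"
    using assms(2) unfolding l(2) spells_append by simp_all
  have "even_gap e (j + int (length b) - 1) l"
    unfolding even_gap_def
  proof (intro conjI allI impI)
    show "e (j + int (length b) - 1 - 2 * int l)" using sp(1) by (simp add: l(2) spells_def)
    fix k assume k: "j + int (length b) - 1 - 2 * int l < k \<and> k \<le> j + int (length b) - 1"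
    define i where "i = nat (k - (j + int (length u) + 1))"
    have "i < 2 * l" "k = j + int (length u) + 1 + int i" using k by (auto simp: i_def l(2))
    then show "\<not> e k" using sp(2) by (auto simp: spells_def)
  qed (rule l(1))
  moreover have "2 * l < length b" by (simp add: l(2))
  ultimately show ?thesis by (rule that)
qed

text \<open>Some path is asked for, not the path of the normalization, so that only digits in
  \<open>{i<..j}\<close> and \<open>Z\<close> matter. The zeros in \<open>Z\<close> will force the
  true path into \<open>Even\<close> at the outer end as well.\<close>

definition path_event :: "int \<Rightarrow> int \<Rightarrow> ((int \<Rightarrow> bool) \<Rightarrow> bool) \<Rightarrow> int set \<Rightarrow> (int \<Rightarrow> bool) set" where
  "path_event i j Q Z = {x. (\<exists>e s. carry_path i j x e s \<and> s i = Even \<and> s j = Even \<and> Q e) \<and> (\<forall>k\<in>Z. \<not> x k)}"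

text \<open>The zeros at \<open>a\<close> and \<open>a + 1\<close> pin the state at
  \<open>a\<close>, and \<open>a < - 2 * int l\<close> keeps the whole gap inside the
  window.\<close>

definition past_event :: "(int \<Rightarrow> bool) set" where
  "past_event = (\<Union>l. \<Union>a\<in>{..<- 2 * int l}. path_event a 0 (\<lambda>e. even_gap e 0 l) {a, a + 1})"

text \<open>The window extends beyond the word to a pair of zeros that pins the state at
  \<open>n\<close>; the 1 after the word certifies that a last block in \<open>w\<close> has
  ended.\<close>

definition future_event :: "bool list \<Rightarrow> (int \<Rightarrow> bool) set" where
  "future_event w = (\<Union>n\<in>{int (length w)<..}.
     path_event 0 n (\<lambda>e. spells e 1 w \<and> e (int (length w) + 1)) {n, n + 1})"

definition word_event :: "bool list \<Rightarrow> (int \<Rightarrow> bool) set" where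
  "word_event w = path_event 0 (int (length w)) (\<lambda>e. spells e 1 w) {}"

lemma depends_on_mono: "depends_on K A \<Longrightarrow> K \<subseteq> L \<Longrightarrow> depends_on L A"
  unfolding depends_on_def by (intro allI impI) (metis subsetD)

lemma depends_on_UN: "(\<And>i. i \<in> I \<Longrightarrow> depends_on K (A i)) \<Longrightarrow> depends_on K (\<Union>i\<in>I. A i)"
  unfolding depends_on_def by (intro allI impI) (metis UN_iff)

lemma carry_path_cong_input:
  "carry_path i j x e s \<Longrightarrow> (\<And>k. i < k \<Longrightarrow> k \<le> j \<Longrightarrow> x k = y k) \<Longrightarrow> carry_path i j y e s"
  unfolding carry_path_def by simp

lemma path_event:
  assumes "finite Z"
  shows "depends_on ({i<..j} \<union> Z) (path_event i j Q Z)" "path_event i j Q Z \<in> sets coin_measure"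
proof -
  show dep: "depends_on ({i<..j} \<union> Z) (path_event i j Q Z)"
    unfolding depends_on_def
  proof (intro allI impI)
    fix x y assume xy: "\<forall>k\<in>{i<..j} \<union> Z. x k = y k" and "x \<in> path_event i j Q Z"
    then obtain e s where *: "carry_path i j x e s" "s i = Even" "s j = Even" "Q e" "\<forall>k\<in>Z. \<not> x k"
      unfolding path_event_def by blast
    have "carry_path i j y e s" by (rule carry_path_cong_input[OF *(1)]) (use xy in auto)
    moreover have "\<forall>k\<in>Z. \<not> y k" using xy *(5) by blast
    ultimately show "y \<in> path_event i j Q Z" unfolding path_event_def using *(2-4) by blast
  qed
  show "path_event i j Q Z \<in> sets coin_measure" by (rule depends_on_finite[OF dep]) (use assms in simp)
qed

lemma past_event: "past_event \<in> sets coin_measure" "depends_on {..0} past_event"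
  unfolding past_event_def
  by (intro sets.countable_UN'' path_event(2); simp)
     (intro depends_on_UN depends_on_mono[OF path_event(1)]; auto)

lemma future_event: "future_event w \<in> sets coin_measure" "depends_on {1..} (future_event w)"
  unfolding future_event_def
  by (intro sets.countable_UN'' path_event(2); simp)
     (intro depends_on_UN depends_on_mono[OF path_event(1)]; auto)

lemma word_event: "depends_on {1..int (length w)} (word_event w)" "word_event w \<in> sets coin_measure"
  unfolding word_event_def by (rule depends_on_mono[OF path_event(1)]) (auto intro: path_event(2))

lemma sync_at_zeros: "sync_at x i \<Longrightarrow> \<not> x (i + 1) \<and> \<not> x (i + 2)"
  by (auto simp: sync_at_def)

lemma sync_recurrent_path:
  assumes "sync_recurrent x"
  obtains s where "\<And>i j. carry_path i j x (two_sided_normalization x) s"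
proof -
  have "\<exists>k\<le>N. \<not> x k" for N
  proof -
    obtain i where "i \<le> N - 1" "sync_at x i" using assms unfolding sync_recurrent_def by blast
    then show ?thesis using sync_at_zeros[of x i] by (intro exI[of _ "i + 1"]) auto
  qed
  then have "infinite {k. k < 0 \<and> \<not> x k}" by (simp add: infinite_left_zeros_iff)
  moreover have "\<exists>k\<ge>N. \<not> x k" for N
  proof -
    obtain i where "i \<ge> N" "sync_at x i" using assms unfolding sync_recurrent_def by blast
    then show ?thesis using sync_at_zeros[of x i] by (intro exI[of _ "i + 1"]) auto
  qed
  ultimately show ?thesis using carry_path_two_sided_normalization[of x] that by blast
qed

text \<open>The two finite paths meet in \<open>Even\<close> at 0, and their concatenation has the
  end states of the normalization's path because zeros of \<open>x\<close> force both; by uniqueness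
  both write the same digits. Conversely, the gap before coordinate 1 forces \<open>Even\<close> at
  0, where the path of the normalization may be cut in two.\<close>

lemma past_future_iff:
  assumes x: "sync_recurrent x" and w: "w \<noteq> [] \<Longrightarrow> hd w"
  defines "e \<equiv> two_sided_normalization x"
  shows "x \<in> past_event \<and> x \<in> future_event w \<longleftrightarrow>
    (\<exists>l. even_gap e 0 l) \<and> spells e 1 w \<and> e (int (length w) + 1)" (is "?L \<longleftrightarrow> ?R")
proof -
  obtain s where s: "\<And>i j. carry_path i j x e s"
    using sync_recurrent_path[OF x] unfolding e_def by blast
  have sync: "s k = Even" if "\<not> x k" "\<not> x (k + 1)" for k
    by (rule carry_path_two_zeros[OF s that])
  show ?thesis
  proof
    assume ?L
    then obtain a e1 s1 l n e2 s2 where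
      p: "a < - 2 * int l" "carry_path a 0 x e1 s1" "s1 a = Even" "s1 0 = Even"
        "\<not> x a" "\<not> x (a + 1)" "even_gap e1 0 l"
      and f: "int (length w) < n" "carry_path 0 n x e2 s2" "s2 0 = Even" "s2 n = Even"
        "spells e2 1 w" "e2 (int (length w) + 1)" "\<not> x n" "\<not> x (n + 1)"
      unfolding past_event_def future_event_def path_event_def by auto
    define e' where "e' = (\<lambda>k. if k \<le> 0 then e1 k else e2 k)"
    define s' where "s' = (\<lambda>k. if k \<le> 0 then s1 k else s2 k)"
    have path: "carry_path a n x e' s'"
      unfolding e'_def s'_def by (rule carry_path_append[OF p(2) f(2)]) (use p f in auto)
    have "e k = e' k" if "a < k" "k \<le> n" for k
      by (rule carry_path_unique(2)[OF s path, of k])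
         (use p f that sync[of a] sync[of n] in \<open>auto simp: s'_def\<close>)
    note e' = this
    have e1: "e k = e1 k" if "a < k" "k \<le> 0" for k using e'[of k] that f(1) by (simp add: e'_def)
    have e2: "e k = e2 k" if "0 < k" "k \<le> n" for k using e'[of k] that p(1) by (simp add: e'_def)
    have "even_gap e 0 l" using p(1,7) e1 by (auto simp: even_gap_def)
    moreover have "spells e 1 w" using f(1,5) e2 spells_cong[of 1 w e e2] by auto
    moreover have "e (int (length w) + 1)" using f(1,6) e2 by auto
    ultimately show ?R by blast
  next
    assume ?R
    then obtain l where l: "even_gap e 0 l" and w': "spells e 1 w" "e (int (length w) + 1)" by blast
    have "e 1"
    proof (cases "w = []")
      case False
      then show ?thesis using w' w[OF False] by (auto simp: spells_def hd_conv_nth dest: spec[of _ 0])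
    qed (use w' in auto)
    then have s0: "s 0 = Even"
      using l by (intro carry_path_even_gap[OF s, of l]) (auto simp: even_gap_def)
    obtain i where i: "i \<le> - 2 * int l - 2" "sync_at x i" using x unfolding sync_recurrent_def by blast
    obtain j where j: "j \<ge> int (length w)" "sync_at x j" using x unfolding sync_recurrent_def by blast
    have zi: "\<not> x (i + 1)" "\<not> x (i + 1 + 1)" and zj: "\<not> x (j + 1)" "\<not> x (j + 1 + 1)"
      using sync_at_zeros[OF i(2)] sync_at_zeros[OF j(2)] by (simp_all add: add.commute)
    have "x \<in> past_event" unfolding past_event_def path_event_def
      using i(1) s[of "i + 1" 0] l s0 sync[OF zi] zi by (intro UN_I[of l] UN_I[of "i + 1"]) auto
    moreover have "x \<in> future_event w" unfolding future_event_def path_event_def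
      using j(1) s[of 0 "j + 1"] w' s0 sync[OF zj] zj by (intro UN_I[of "j + 1"]) auto
    ultimately show ?L by blast
  qed
qed

text \<open>The block ends in an even gap and a 1 follows, so every path concerned is in
  \<open>Even\<close> at the end of \<open>b\<close> and splits there; conversely, two paths can be
  joined in that state.\<close>

lemma future_event_block:
  assumes b: "golden_block b" and w: "w \<noteq> [] \<Longrightarrow> hd w"
  shows "future_event (b @ w) = word_event b \<inter> {x. (\<lambda>i. x (i + int (length b))) \<in> future_event w}"
    (is "_ = ?R")
proof (intro equalityI subsetI)
  let ?m = "int (length b)"
  fix x assume "x \<in> future_event (b @ w)"
  then obtain n e s where *: "?m + int (length w) < n" "carry_path 0 n x e s" "s 0 = Even" "s n = Even"
     "spells e 1 (b @ w)" "e (?m + int (length w) + 1)" "\<not> x n" "\<not> x (n + 1)"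
    unfolding future_event_def path_event_def by auto
  have bw: "spells e 1 b" "spells e (1 + ?m) w" using *(5) unfolding spells_append by auto
  obtain l where l: "even_gap e ?m l" "2 * l < length b"
    using golden_block_even_gap[OF b bw(1)] by auto
  have "e (?m + 1)"
  proof (cases "w = []")
    case False
    then show ?thesis
      using bw(2) w[OF False] by (auto simp: spells_def hd_conv_nth add.commute dest: spec[of _ 0])
  qed (use * in auto)
  then have sm: "s ?m = Even"
    using l * by (intro carry_path_even_gap[where l = l and x = x and e = e]) (auto simp: even_gap_def intro: carry_path_sub)
  have "x \<in> word_event b"
    unfolding word_event_def path_event_def using carry_path_sub[OF *(2), of 0 ?m] *(1,3) sm bw(1) by auto
  moreover have "(\<lambda>i. x (i + ?m)) \<in> future_event w"
  proof -
    have "carry_path 0 (n - ?m) (\<lambda>i. x (i + ?m)) (\<lambda>i. e (i + ?m)) (\<lambda>i. s (i + ?m))"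
      using carry_path_shift[of 0 ?m "n - ?m" x e s] *(1,2) by (auto intro: carry_path_sub)
    moreover have "spells (\<lambda>i. e (i + ?m)) 1 w" using bw(2) by (simp add: spells_shift)
    ultimately show ?thesis unfolding future_event_def path_event_def
      using * sm by (intro UN_I[of "n - ?m"] CollectI conjI exI[of _ "\<lambda>i. e (i + ?m)"] exI[of _ "\<lambda>i. s (i + ?m)"])
        (auto simp: algebra_simps)
  qed
  ultimately show "x \<in> ?R" by blast
next
  let ?m = "int (length b)"
  fix x assume "x \<in> ?R"
  then obtain e1 s1 n e2 s2 where
    1: "carry_path 0 ?m x e1 s1" "s1 0 = Even" "s1 ?m = Even" "spells e1 1 b"
    and 2: "int (length w) < n" "carry_path 0 n (\<lambda>i. x (i + ?m)) e2 s2" "s2 0 = Even" "s2 n = Even"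
      "spells e2 1 w" "e2 (int (length w) + 1)" "\<not> x (n + ?m)" "\<not> x (n + 1 + ?m)"
    unfolding word_event_def future_event_def path_event_def by auto
  have p: "carry_path ?m (n + ?m) x (\<lambda>i. e2 (i - ?m)) (\<lambda>i. s2 (i - ?m))"
    using carry_path_shift[of 0 ?m n x "\<lambda>i. e2 (i - ?m)" "\<lambda>i. s2 (i - ?m)"] 2(2) by simp
  define e where "e = (\<lambda>k. if k \<le> ?m then e1 k else e2 (k - ?m))"
  define s where "s = (\<lambda>k. if k \<le> ?m then s1 k else s2 (k - ?m))"
  have path: "carry_path 0 (n + ?m) x e s"
    unfolding e_def s_def by (rule carry_path_append[OF 1(1) p]) (use 1 2 in auto)
  have "spells e 1 b" using 1(4) spells_cong[of 1 b e e1] by (auto simp: e_def)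
  moreover have "spells e (1 + ?m) w"
    using 2(5) spells_shift[of e ?m 1 w] spells_cong[of 1 w "\<lambda>i. e (i + ?m)" e2] by (auto simp: e_def)
  ultimately have "spells e 1 (b @ w)" by (simp add: spells_append)
  then show "x \<in> future_event (b @ w)"
    unfolding future_event_def path_event_def
    by (intro UN_I[of "n + ?m"] CollectI conjI exI[of _ e] exI[of _ s])
       (use 1 2 path in \<open>auto simp: e_def s_def algebra_simps\<close>)
qed

section \<open>Paths writing a block and representations of its value\<close>

definition sequence_of_word :: "bool list \<Rightarrow> int \<Rightarrow> bool" where
  "sequence_of_word w i \<longleftrightarrow> 1 \<le> i \<and> i \<le> int (length w) \<and> w ! nat (i - 1)"

lemma word_value_tail_number: "word_value w = golden * tail_number (sequence_of_word w) 0"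
proof -
  have "tail_number (sequence_of_word w) 0 =
      (\<Sum>n<length w. of_bool (sequence_of_word w (0 + 1 + int n)) * (1 / golden) ^ Suc n)"
    unfolding tail_number_def by (rule suminf_finite) (auto simp: sequence_of_word_def)
  also have "\<dots> = (\<Sum>n<length w. of_bool (w ! n) * (1 / golden) ^ Suc n)"
    by (intro sum.cong refl) (auto simp: sequence_of_word_def)
  finally show ?thesis
    using golden_bounds
    by (simp add: word_value_def sum_distrib_left power_int_minus power_one_over inverse_eq_divide field_simps)
qed

lemma spells_sequence_of_word: "spells (sequence_of_word w) 1 w"
  by (auto simp: spells_def sequence_of_word_def)

lemma spells_iff_sequence: "spells e 1 w \<longleftrightarrow> (\<forall>i. 1 \<le> i \<and> i \<le> int (length w) \<longrightarrow> e i = sequence_of_word w i)"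
proof
  assume a: "spells e 1 w"
  show "\<forall>i. 1 \<le> i \<and> i \<le> int (length w) \<longrightarrow> e i = sequence_of_word w i"
  proof (intro allI impI)
    fix i assume i: "1 \<le> i \<and> i \<le> int (length w)"
    then have "nat (i - 1) < length w" by linarith
    then show "e i = sequence_of_word w i"
      using a i unfolding spells_def by (auto simp: sequence_of_word_def dest!: spec[of _ "nat (i - 1)"])
  qed
qed (auto simp: spells_def sequence_of_word_def)

fun carry_value :: "carry_state \<Rightarrow> real" where
  "carry_value Even = 0" | "carry_value Kept = 0" | "carry_value Owed = -1" | "carry_value Half = 1 - golden"

lemma carry_value_edge:
  "carry_edge s a b t \<Longrightarrow> carry_value t = golden * carry_value s + of_bool a - of_bool b"
  using golden_square by (auto simp: carry_edge_def right_diff_distrib)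

text \<open>Equal values mean carry 0 at the left end, and finite support means carry 0 at the right
  end; so equality of values amounts to a path from \<open>Even\<close> to \<open>Even\<close>. This
  turns the preimages of a block into the words counted by
  \<open>representation_count\<close>.\<close>

lemma word_event_iff:
  assumes b: "golden_block b"
  shows "x \<in> word_event b \<longleftrightarrow> word_value (map x [1..int (length b)]) = word_value b"
proof -
  let ?n = "int (length b)" and ?y = "sequence_of_word (map x [1..int (length b)])" and ?e = "sequence_of_word b"
  have y: "?y i \<longleftrightarrow> 1 \<le> i \<and> i \<le> ?n \<and> x i" for i
    by (auto simp: sequence_of_word_def nth_upto)
  have yn: "tail_number ?y ?n = 0" and en: "tail_number ?e ?n = 0"
    by (rule finite_support_tail_zero, simp add: sequence_of_word_def)+
  have "word_value (map x [1..int (length b)]) = word_value b \<longleftrightarrow> tail_number ?e 0 = tail_number ?y 0"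
    using golden_bounds by (auto simp: word_value_tail_number)
  also have "\<dots> \<longleftrightarrow> x \<in> word_event b"
  proof
    assume eq: "tail_number ?e 0 = tail_number ?y 0"
    have gold: "?e \<in> golden_space" unfolding golden_space_def
    proof (intro CollectI allI notI)
      fix k assume k: "?e k \<and> ?e (k + 1)"
      then have "Suc (nat (k - 1)) < length b" "b ! nat (k - 1)" "b ! Suc (nat (k - 1))"
        unfolding sequence_of_word_def by (auto simp: Suc_nat_eq_nat_zadd1 algebra_simps)
      then show False using b unfolding golden_block_def by blast
    qed
    \<comment> \<open>Finite support excludes the tail 1 0 1 0 ..., the only one of value 1.\<close>
    have lt: "tail_number ?e k < 1" for k
    proof (rule ccontr)
      assume "\<not> ?thesis"
      then have "tail_number ?e k = 1" using golden_space_tail_le[OF gold, of k] by simp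
      from golden_space_tail_eq_1_infinite(1)[OF gold this, of "nat (?n - k)"]
      moreover have "?n < k + 1 + 2 * int (nat (?n - k))" by linarith
      ultimately show False by (simp add: sequence_of_word_def)
    qed
    have lt': "tail_number ?y k < golden" for k
      by (rule tail_number_lt_golden[of _ "max (k + 1) (?n + 1)"]) (auto simp: y)
    define s where "s = (\<lambda>k. carry_state_of (tail_number ?e k - tail_number ?y k) (?e k))"
    have path: "carry_path 0 ?n ?y ?e s"
      unfolding s_def by (rule carry_path_expansion(2)[OF gold lt lt']) (simp add: eq carries_def)
    \<comment> \<open>Carry 0 means \<open>Even\<close> only after a written 0; a block ends with
      zeros, which excludes \<open>Kept\<close>.\<close>
    have "\<not> ?e ?n"
    proof -
      obtain l where "even_gap ?e ?n l"
        using golden_block_even_gap[OF b spells_sequence_of_word] by auto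
      then show ?thesis unfolding even_gap_def by auto
    qed
    then have ends: "s 0 = Even" "s ?n = Even"
      by (simp_all add: s_def eq yn en carry_state_of_def sequence_of_word_def[of _ 0])
    have "carry_path 0 ?n x ?e s"
      by (rule carry_path_cong_input[OF path]) (simp add: y)
    then show "x \<in> word_event b"
      unfolding word_event_def path_event_def using ends spells_sequence_of_word by blast
  next
    assume "x \<in> word_event b"
    then obtain e s where *: "carry_path 0 ?n x e s" "s 0 = Even" "s ?n = Even" "spells e 1 b"
      unfolding word_event_def path_event_def by blast
    have path: "carry_path 0 ?n ?y ?e s"
      using *(1) carry_path_cong[of 0 ?n ?y x ?e e s s] *(4) y by (simp add: spells_iff_sequence)
    \<comment> \<open>The left side is multiplied by \<open>golden\<close> at every step; it
      vanishes at the right end, hence at 0.\<close>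
    have "tail_number ?e (int k) - tail_number ?y (int k) - carry_value (s (int k)) =
        golden ^ k * (tail_number ?e 0 - tail_number ?y 0)" if "k \<le> length b" for k
      using that
    proof (induction k)
      case (Suc k)
      have "carry_value (s (int k + 1)) = golden * carry_value (s (int k)) + of_bool (?y (int k + 1)) - of_bool (?e (int k + 1))"
        by (rule carry_value_edge[OF carry_path_edge[OF path]]) (use Suc in auto)
      moreover have "tail_number ?e (int k + 1) - tail_number ?y (int k + 1) =
          golden * (tail_number ?e (int k) - tail_number ?y (int k)) + of_bool (?y (int k + 1)) - of_bool (?e (int k + 1))"
        using carry_step[of ?e "int k + 1" ?y] by simp
      ultimately have "tail_number ?e (int k + 1) - tail_number ?y (int k + 1) - carry_value (s (int k + 1)) =
          golden * (tail_number ?e (int k) - tail_number ?y (int k) - carry_value (s (int k)))"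
        by (simp add: right_diff_distrib)
      then show ?case using Suc by (simp add: add.commute)
    qed (simp add: *(2))
    from this[of "length b"] show "tail_number ?e 0 = tail_number ?y 0"
      using golden_bounds by (simp add: yn en *(3))
  qed
  finally show ?thesis by blast
qed

definition block_weight :: "bool list \<Rightarrow> real" where
  "block_weight w = real (representation_count w) / 2 ^ length w"

text \<open>Each representation is a cylinder of measure \<open>(1/2) ^ length b\<close>, and
  distinct words give disjoint cylinders.\<close>

lemma coin_prob_word_event:
  assumes b: "golden_block b"
  shows "coin.prob (word_event b) = block_weight b"
proof -
  let ?S = "{w. length w = length b \<and> word_value w = word_value b}"
  let ?C = "\<lambda>w. {x. \<forall>i\<in>{1..int (length b)}. x i = sequence_of_word w i}"
  have fin: "finite ?S"
    by (rule finite_subset[OF _ finite_lists_length_eq[of "UNIV :: bool set" "length b"]]) auto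
  have C: "x \<in> ?C w \<longleftrightarrow> map x [1..int (length b)] = w" if "length w = length b" for x w
    using spells_iff_sequence[of x w] spells_iff_map[of x 1 w] that by auto
  have "word_event b = (\<Union>w\<in>?S. ?C w)"
  proof (rule set_eqI)
    fix x
    have "x \<in> (\<Union>w\<in>?S. ?C w) \<longleftrightarrow> (\<exists>w\<in>?S. map x [1..int (length b)] = w)"
      unfolding UN_iff by (intro bex_cong refl C) simp
    also have "\<dots> \<longleftrightarrow> map x [1..int (length b)] \<in> ?S" by blast
    also have "\<dots> \<longleftrightarrow> x \<in> word_event b" unfolding word_event_iff[OF b] by simp
    finally show "x \<in> word_event b \<longleftrightarrow> x \<in> (\<Union>w\<in>?S. ?C w)" by (rule sym)
  qed
  also have "coin.prob \<dots> = (\<Sum>w\<in>?S. coin.prob (?C w))"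
  proof (rule coin.finite_measure_finite_Union[OF fin])
    have "depends_on {1..int (length b)} (?C w)" for w by (auto simp: depends_on_def)
    then show "?C ` ?S \<subseteq> sets coin_measure" by (auto intro: depends_on_finite)
    show "disjoint_family_on ?C ?S"
      unfolding disjoint_family_on_def
    proof (intro ballI impI)
      fix v w assume vw: "v \<in> ?S" "w \<in> ?S" "v \<noteq> w"
      show "?C v \<inter> ?C w = {}"
      proof (rule equals0I)
        fix x assume "x \<in> ?C v \<inter> ?C w"
        then have "x \<in> ?C v" "x \<in> ?C w" by (rule IntD1, rule IntD2)
        moreover have "length v = length b" "length w = length b" using vw by simp_all
        ultimately have "map x [1..int (length b)] = v" "map x [1..int (length b)] = w"
          using C by blast+
        then show False using vw(3) by simp
      qed
    qed
  qed
  also have "\<dots> = (\<Sum>w\<in>?S. (1/2) ^ length b)"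
    by (intro sum.cong refl) (subst coin_cylinder, auto)
  also have "\<dots> = block_weight b"
    by (simp add: block_weight_def representation_count_def power_one_over)
  finally show ?thesis .
qed

lemma coin_prob_future_event_block:
  assumes b: "golden_block b" and w: "w \<noteq> [] \<Longrightarrow> hd w"
  shows "coin.prob (future_event (b @ w)) = block_weight b * coin.prob (future_event w)"
proof -
  let ?m = "int (length b)"
  let ?A = "{x. (\<lambda>i. x (i + ?m)) \<in> future_event w}"
  have meas: "?A \<in> sets coin_measure"
    using measurable_sets[OF measurable_coin_shift[of ?m] future_event(1)] by (simp add: vimage_def)
  have dep: "depends_on {?m + 1..} ?A"
    unfolding depends_on_def
  proof (intro allI impI)
    fix x y assume xy: "\<forall>i\<in>{?m + 1..}. x i = y i" and x: "x \<in> ?A"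
    have "(\<lambda>i. x (i + ?m)) \<in> future_event w \<longleftrightarrow> (\<lambda>i. y (i + ?m)) \<in> future_event w"
      by (rule depends_onD[OF future_event(2)]) (use xy in auto)
    then show "y \<in> ?A" using x by simp
  qed
  have "future_event (b @ w) = word_event b \<inter> ?A"
    by (rule future_event_block[OF b]) (rule w)
  moreover have "coin.prob (word_event b \<inter> ?A) = coin.prob (word_event b) * coin.prob ?A"
    by (rule coin_indep[OF word_event(2,1) meas dep]) auto
  ultimately show ?thesis
    by (simp only: coin_prob_shift[OF future_event(1)] coin_prob_word_event[OF b])
qed

lemma concat_blocks_hd: "(\<And>b. b \<in> set bs \<Longrightarrow> golden_block b) \<Longrightarrow> concat bs \<noteq> [] \<Longrightarrow> hd (concat bs)"
  by (cases bs) (auto simp: golden_block_def)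

text \<open>Each block peels off by independence from what follows. The remaining factor is the same
  for all \<open>bs\<close>, so it cancels in the conditional measure.\<close>

lemma coin_prob_past_future:
  assumes "\<And>b. b \<in> set bs \<Longrightarrow> golden_block b"
  shows "coin.prob (past_event \<inter> future_event (concat bs)) =
    coin.prob (past_event \<inter> future_event []) * prod_list (map block_weight bs)"
proof -
  have "coin.prob (future_event (concat bs)) = prod_list (map block_weight bs) * coin.prob (future_event [])"
    using assms
  proof (induction bs)
    case (Cons b bs)
    then show ?case
      using coin_prob_future_event_block[of b "concat bs"] concat_blocks_hd[of bs] by simp
  qed simp
  moreover have "coin.prob (past_event \<inter> future_event w) = coin.prob past_event * coin.prob (future_event w)" for w
    by (rule coin_indep[OF past_event future_event]) auto
  ultimately show ?thesis by simp
qed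

section \<open>Splitting into blocks\<close>

text \<open>The places where a block begins: the final 1 of a separator, whereas
  \<open>separator_at\<close> records the initial one.\<close>

definition cut_at :: "(int \<Rightarrow> bool) \<Rightarrow> int \<Rightarrow> bool" where
  "cut_at e i \<longleftrightarrow> e i \<and> (\<exists>l. even_gap e (i - 1) l)"

definition consecutive_cuts :: "(int \<Rightarrow> bool) \<Rightarrow> int \<Rightarrow> int \<Rightarrow> bool" where
  "consecutive_cuts e i j \<longleftrightarrow> i < j \<and> cut_at e i \<and> cut_at e j \<and> (\<forall>k. i < k \<and> k < j \<longrightarrow> \<not> cut_at e k)"

lemma even_gap_shift: "even_gap (\<lambda>i. e (i + m)) j l \<longleftrightarrow> even_gap e (j + m) l"
proof -
  have "(\<forall>k. j - 2 * int l < k \<and> k \<le> j \<longrightarrow> \<not> e (k + m)) \<longleftrightarrow>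
      (\<forall>k. j + m - 2 * int l < k \<and> k \<le> j + m \<longrightarrow> \<not> e k)"
  proof (intro iffI allI impI)
    fix k assume "\<forall>k. j - 2 * int l < k \<and> k \<le> j \<longrightarrow> \<not> e (k + m)" "j + m - 2 * int l < k \<and> k \<le> j + m"
    then show "\<not> e k" by (auto dest: spec[of _ "k - m"])
  qed auto
  then show ?thesis by (simp add: even_gap_def algebra_simps)
qed

lemma cut_at_shift: "cut_at (\<lambda>i. e (i + m)) j \<longleftrightarrow> cut_at e (j + m)"
  using even_gap_shift[of e m "j - 1"] by (simp add: cut_at_def algebra_simps)

lemma even_gap_le: "even_gap e (j - 1) l \<Longrightarrow> e i \<Longrightarrow> i < j \<Longrightarrow> i \<le> j - 1 - 2 * int l"
  unfolding even_gap_def by (meson leI zle_diff1_eq)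

lemma separator_at_iff: "separator_at e i \<longleftrightarrow> (\<exists>j l. e j \<and> even_gap e (j - 1) l \<and> i = j - 1 - 2 * int l)"
proof
  assume "separator_at e i"
  then obtain l :: nat where "l \<ge> 1" "e i" "\<forall>j\<in>{i<..i + 2 * int l}. \<not> e j" "e (i + 2 * int l + 1)"
    unfolding separator_at_def by blast
  then show "\<exists>j l. e j \<and> even_gap e (j - 1) l \<and> i = j - 1 - 2 * int l"
    by (intro exI[of _ "i + 2 * int l + 1"] exI[of _ l]) (auto simp: even_gap_def)
next
  assume "\<exists>j l. e j \<and> even_gap e (j - 1) l \<and> i = j - 1 - 2 * int l"
  then obtain j l where "e j" "even_gap e (j - 1) l" "i = j - 1 - 2 * int l" by blast
  then show "separator_at e i" unfolding separator_at_def even_gap_def by (intro exI[of _ l]) auto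
qed

lemma separators_unbounded_below_iff: "(\<forall>N. \<exists>i\<le>N. separator_at e i) \<longleftrightarrow> (\<forall>N. \<exists>i\<le>N. cut_at e i)"
proof (intro iffI allI)
  fix N assume *: "\<forall>N. \<exists>i\<le>N. separator_at e i"
  obtain i where i: "i \<le> N" "separator_at e i" using * by blast
  then have "e i" by (auto simp: separator_at_def)
  \<comment> \<open>A separator that starts below \<open>N\<close> may end above it. One that starts
    before the 1 at \<open>i\<close> must end at \<open>i\<close> or earlier, since there are only
    zeros between its two ones.\<close>
  obtain i' where "i' \<le> i - 1" "separator_at e i'" using * by blast
  then obtain j l where j: "e j" "even_gap e (j - 1) l" "j - 1 - 2 * int l \<le> i - 1"
    unfolding separator_at_iff by auto
  then have "\<not> i < j" using even_gap_le[OF j(2) \<open>e i\<close>] by auto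
  then show "\<exists>i\<le>N. cut_at e i" using j i by (intro exI[of _ j]) (auto simp: cut_at_def)
next
  fix N assume "\<forall>N. \<exists>i\<le>N. cut_at e i"
  then obtain j l where "j \<le> N" "e j" "even_gap e (j - 1) l" unfolding cut_at_def by blast
  then show "\<exists>i\<le>N. separator_at e i" unfolding separator_at_iff
    by (intro exI[of _ "j - 1 - 2 * int l"]) auto
qed

lemma separators_unbounded_above_iff: "(\<forall>N. \<exists>i\<ge>N. separator_at e i) \<longleftrightarrow> (\<forall>N. \<exists>i\<ge>N. cut_at e i)"
proof (intro iffI allI)
  fix N assume "\<forall>N. \<exists>i\<ge>N. separator_at e i"
  then obtain j l where "e j" "even_gap e (j - 1) l" "j - 1 - 2 * int l \<ge> N"
    unfolding separator_at_iff by blast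
  then show "\<exists>i\<ge>N. cut_at e i" by (intro exI[of _ j]) (auto simp: cut_at_def)
next
  fix N assume *: "\<forall>N. \<exists>i\<ge>N. cut_at e i"
  obtain i where i: "i \<ge> N" "cut_at e i" using * by blast
  obtain j where j: "j \<ge> i + 1" "cut_at e j" using * by blast
  then obtain l where l: "e j" "even_gap e (j - 1) l" by (auto simp: cut_at_def)
  then have "i \<le> j - 1 - 2 * int l" using even_gap_le[OF l(2), of i] i j by (auto simp: cut_at_def)
  then show "\<exists>i\<ge>N. separator_at e i" unfolding separator_at_iff
    using i l by (intro exI[of _ "j - 1 - 2 * int l"]) auto
qed

lemma golden_base_iff:
  "e \<in> golden_base \<longleftrightarrow> e \<in> golden_space \<and> cut_at e 1 \<and> (\<forall>N. \<exists>i\<le>N. cut_at e i) \<and> (\<forall>N. \<exists>i\<ge>N. cut_at e i)"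
proof -
  have "(\<exists>k\<ge>1. e (- 2 * k) \<and> (\<forall>i\<in>{- 2 * k + 1..0}. \<not> e i) \<and> e 1) \<longleftrightarrow> cut_at e 1"
  proof
    assume "\<exists>k\<ge>1. e (- 2 * k) \<and> (\<forall>i\<in>{- 2 * k + 1..0}. \<not> e i) \<and> e 1"
    then obtain k where "k \<ge> 1" "e (- 2 * k)" "\<forall>i\<in>{- 2 * k + 1..0}. \<not> e i" "e 1" by blast
    then show "cut_at e 1" unfolding cut_at_def even_gap_def by (intro conjI exI[of _ "nat k"]) auto
  next
    assume "cut_at e 1"
    then obtain l where "e 1" "even_gap e 0 l" by (auto simp: cut_at_def)
    then show "\<exists>k\<ge>1. e (- 2 * k) \<and> (\<forall>i\<in>{- 2 * k + 1..0}. \<not> e i) \<and> e 1"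
      by (intro exI[of _ "int l"]) (auto simp: even_gap_def)
  qed
  then show ?thesis
    unfolding golden_base_def separators_unbounded_below_iff[symmetric] separators_unbounded_above_iff[symmetric]
    by blast
qed

lemma golden_space_shift: "e \<in> golden_space \<Longrightarrow> (\<lambda>i. e (i + m)) \<in> golden_space"
  unfolding golden_space_def by (auto simp: add.commute add.left_commute)

text \<open>A shift invariant set of full Erdos measure. For its members, asking whether a shift
  lies in the base reduces to asking for one cut.\<close>

definition cut_recurrent :: "(int \<Rightarrow> bool) set" where
  "cut_recurrent = {e \<in> golden_space. (\<forall>N. \<exists>i\<le>N. cut_at e i) \<and> (\<forall>N. \<exists>i\<ge>N. cut_at e i)}"

lemma golden_base_eq: "golden_base = {e \<in> cut_recurrent. cut_at e 1}"
  by (auto simp: golden_base_iff cut_recurrent_def)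

lemma cut_recurrent_shift_iff:
  assumes "e \<in> cut_recurrent" shows "(\<lambda>i. e (i + m)) \<in> golden_base \<longleftrightarrow> cut_at e (1 + m)"
proof -
  have "(\<forall>N. \<exists>i\<le>N. cut_at e (i + m))" "(\<forall>N. \<exists>i\<ge>N. cut_at e (i + m))"
    using assms unfolding cut_recurrent_def by (smt (verit) mem_Collect_eq diff_add_cancel)+
  then show ?thesis
    using assms golden_space_shift[of e m] unfolding golden_base_iff cut_at_shift cut_recurrent_def by blast
qed

lemma golden_base_shift_iff:
  "e \<in> golden_base \<Longrightarrow> (\<lambda>i. e (i + m)) \<in> golden_base \<longleftrightarrow> cut_at e (1 + m)"
  by (rule cut_recurrent_shift_iff) (simp add: golden_base_eq)

lemma spells_separator:
  assumes "even_gap e (j - 1) l" "e j"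
  shows "spells e (j - 1 - 2 * int l) ([True] @ replicate (2 * l) False @ [True])"
proof -
  have "spells e (j - 1 - 2 * int l) [True]" using assms by (simp add: spells_def even_gap_def)
  moreover have "spells e (j - 1 - 2 * int l + 1) (replicate (2 * l) False)"
    using assms by (auto simp: spells_def even_gap_def)
  moreover have "spells e j [True]" using assms by (simp add: spells_def)
  ultimately show ?thesis by (simp add: spells_append del: append_Cons)
qed

text \<open>A cut strictly inside would end a separator. Its initial 1 cannot lie left of the 1 at
  \<open>i\<close>, since the gap contains no ones, so the separator would be a forbidden subword of
  \<open>b\<close>.\<close>

lemma consecutive_cuts_block:
  assumes b: "golden_block b" and sp: "spells e i b" and "cut_at e i" "e (i + int (length b))"
  shows "consecutive_cuts e i (i + int (length b))"
  unfolding consecutive_cuts_def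
proof (intro conjI allI impI notI)
  show "i < i + int (length b)" using golden_block_nonempty[OF b] by simp
  show "cut_at e (i + int (length b))"
    using golden_block_even_gap[OF b sp] assms(4) unfolding cut_at_def by metis
  fix k assume k: "i < k \<and> k < i + int (length b)" and "cut_at e k"
  then obtain l where l: "e k" "even_gap e (k - 1) l" by (auto simp: cut_at_def)
  have "e i" using \<open>cut_at e i\<close> by (simp add: cut_at_def)
  then have i: "i \<le> k - 1 - 2 * int l" using even_gap_le[OF l(2)] k by simp
  define sep where "sep = [True] @ replicate (2 * l) False @ [True]"
  define p where "p = nat (k - 1 - 2 * int l - i)"
  have p: "int p = k - 1 - 2 * int l - i" using i by (simp add: p_def)
  have len: "length sep = 2 * l + 2" by (simp add: sep_def)
  have "take (length sep) (drop p b) = sep"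
  proof (rule nth_equalityI)
    have "p + length sep \<le> length b" using p k len by linarith
    then show "length (take (length sep) (drop p b)) = length sep" by simp
    fix n assume "n < length (take (length sep) (drop p b))"
    then have n: "n < length sep" "p + n < length b" by auto
    have "take (length sep) (drop p b) ! n = b ! (p + n)" using n by simp
    also have "\<dots> = e (i + int (p + n))" using sp n(2) unfolding spells_def by blast
    also have "i + int (p + n) = k - 1 - 2 * int l + int n" using p by simp
    also have "e (k - 1 - 2 * int l + int n) = sep ! n"
      using spells_separator[OF l(2,1)] n unfolding spells_def sep_def by blast
    finally show "take (length sep) (drop p b) ! n = sep ! n" .
  qed
  then have "b = take p b @ sep @ drop (length sep) (drop p b)" by (metis append_take_drop_id)
  then have "sublist sep b" unfolding sublist_def by blast
  then show False using b l(2) unfolding golden_block_def sep_def even_gap_def by blast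
qed (rule assms)

text \<open>A separator inside the word would end in a cut strictly between \<open>i\<close> and
  \<open>j\<close>. The trailing zeros are those of the gap that makes \<open>j\<close> a cut; its
  leading 1 lies at or after \<open>i\<close>.\<close>

lemma golden_block_between_cuts:
  assumes g: "e \<in> golden_space" and c: "consecutive_cuts e i j"
  shows "golden_block (map e [i..j - 1])"
proof -
  let ?w = "map e [i..j - 1]"
  have ij: "i < j" "e i" "cut_at e j" and no: "\<And>k. i < k \<Longrightarrow> k < j \<Longrightarrow> \<not> cut_at e k"
    using c by (auto simp: consecutive_cuts_def cut_at_def)
  have nth: "?w ! n = e (i + int n)" if "n < length ?w" for n
    using that by (simp add: nth_upto)
  have sp: "spells e i ?w" by (auto simp: spells_def nth)
  obtain l where l: "e j" "even_gap e (j - 1) l" using ij by (auto simp: cut_at_def)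
  then have p: "i \<le> j - 1 - 2 * int l" using even_gap_le[OF l(2)] ij by simp
  show ?thesis unfolding golden_block_def
  proof (intro conjI allI impI)
    fix n assume n: "Suc n < length ?w"
    have "?w ! n = e (i + int n)" "?w ! Suc n = e (i + int n + 1)"
      using n nth[of n] nth[of "Suc n"] by (simp_all add: add_ac)
    then show "\<not> (?w ! n \<and> ?w ! Suc n)" using golden_spaceD[OF g, of "i + int n"] by simp
  next
    show "?w \<noteq> []" using ij by simp
    show "hd ?w" using ij by (simp add: upto.simps)
  next
    have "?w = map e [i..j - 1 - 2 * int l - 1] @ map e [j - 1 - 2 * int l..j - 1]"
      using upto_split1[of i "j - 1 - 2 * int l" "j - 1"] p by simp
    also have "map e [j - 1 - 2 * int l..j - 1] = [True] @ replicate (2 * l) False"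
    proof -
      have "spells e (j - 1 - 2 * int l) ([True] @ replicate (2 * l) False)"
        using spells_separator[OF l(2,1)] unfolding append_assoc[symmetric] spells_append by blast
      then show ?thesis unfolding spells_iff_map by simp
    qed
    finally show "\<exists>u l. 1 \<le> l \<and> ?w = u @ [True] @ replicate (2 * l) False"
      using l(2) unfolding even_gap_def by blast
  next
    show "\<not> (\<exists>l\<ge>1. sublist ([True] @ replicate (2 * l) False @ [True]) ?w)"
    proof
      assume "\<exists>l\<ge>1. sublist ([True] @ replicate (2 * l) False @ [True]) ?w"
      then obtain l ps ss where *: "l \<ge> 1" "?w = ps @ ([True] @ replicate (2 * l) False @ [True]) @ ss"
        unfolding sublist_def by blast
      let ?p = "i + int (length ps)"
      have "spells e i (ps @ [True] @ replicate (2 * l) False @ [True] @ ss)"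
        using sp unfolding * by simp
      then have sp': "spells e ?p [True]" "spells e (?p + 1) (replicate (2 * l) False)"
        "spells e (?p + 1 + 2 * int l) [True]"
        unfolding spells_append by (auto simp: add_ac)
      let ?k = "?p + 1 + 2 * int l"
      have "even_gap e (?k - 1) l"
        unfolding even_gap_def
      proof (intro conjI allI impI)
        show "e (?k - 1 - 2 * int l)" using sp'(1) by (simp add: spells_def)
        fix k assume "?k - 1 - 2 * int l < k \<and> k \<le> ?k - 1"
        then show "\<not> e k" using sp'(2) unfolding spells_def by (auto dest!: spec[of _ "nat (k - (?p + 1))"])
      qed (rule *)
      moreover have "e ?k" using sp'(3) by (simp add: spells_def)
      ultimately have "cut_at e ?k" by (auto simp: cut_at_def)
      moreover have "?k < j"
      proof -
        have "length ?w = nat (j - i)" by simp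
        moreover have "length ?w = length ps + 2 * l + 2 + length ss" using arg_cong[OF *(2), of length] by simp
        ultimately show ?thesis using ij by linarith
      qed
      ultimately show False using no[of ?k] by simp
    qed
  qed
qed

lemma consecutive_cuts_unique:
  "consecutive_cuts e i j \<Longrightarrow> consecutive_cuts e i j' \<Longrightarrow> j = j'"
  "consecutive_cuts e i j \<Longrightarrow> consecutive_cuts e i' j \<Longrightarrow> i = i'"
  unfolding consecutive_cuts_def by (meson linorder_neqE)+

definition splits_at :: "(int \<Rightarrow> bool) \<Rightarrow> (int \<Rightarrow> bool list) \<Rightarrow> (int \<Rightarrow> int) \<Rightarrow> bool" where
  "splits_at e B s \<longleftrightarrow> s 1 = 1 \<and>
     (\<forall>j. golden_block (B j) \<and> s (j + 1) = s j + int (length (B j)) \<and> spells e (s j) (B j))"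

lemma block_splitting_iff: "block_splitting e B \<longleftrightarrow> (\<exists>s. splits_at e B s)"
proof -
  have "s (j + 1) = s j + int (length (B j)) \<and> B j = map e [s j..s (j + 1) - 1] \<longleftrightarrow>
      s (j + 1) = s j + int (length (B j)) \<and> spells e (s j) (B j)" for s j
    using spells_iff_map[of e "s j" "B j"] by (cases "s (j + 1) = s j + int (length (B j))") metis+
  then show ?thesis unfolding block_splitting_def splits_at_def all_conj_distrib by blast
qed

lemma splits_at_next: "splits_at e B s \<Longrightarrow> s (j + 1) = s j + int (length (B j))"
  by (simp add: splits_at_def)

lemma splits_at_consecutive:
  assumes "splits_at e B s" shows "consecutive_cuts e (s j) (s (j + 1))"
proof -
  have *: "golden_block (B j)" "spells e (s j) (B j)" "s (j + 1) = s j + int (length (B j))" for j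
    using assms by (auto simp: splits_at_def)
  have one: "e (s j)" for j using golden_block_starts * by blast
  have "cut_at e (s j)" for j
    using golden_block_even_gap[OF *(1,2)[of "j - 1"]] one[of j] *(3)[of "j - 1"] unfolding cut_at_def
    by (metis diff_add_cancel)
  then show ?thesis
    unfolding *(3) by (intro consecutive_cuts_block *) (use one[of "j + 1"] *(3) in simp_all)
qed

lemma int_up_down_induct:
  assumes "P (1::int)" "\<And>j. P j \<Longrightarrow> P (j + 1)" "\<And>j. P (j + 1) \<Longrightarrow> P j"
  shows "P j"
proof (induction j rule: int_induct[where k = 1])
  case (step2 i)
  then show ?case using assms(3)[of "i - 1"] by simp
qed (use assms in auto)

text \<open>Neighbouring cuts determine each other in both directions, so \<open>s 1 = 1\<close>
  fixes all starts. This gives meaning to the description in \<open>blocks\<close>.\<close>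

lemma splits_at_unique:
  assumes "splits_at e B s" "splits_at e B' s'" shows "s = s'" "B = B'"
proof -
  note c = splits_at_consecutive[OF assms(1)] splits_at_consecutive[OF assms(2)]
  have s: "s j = s' j" for j
  proof (induction j rule: int_up_down_induct)
    case (2 j) then show ?case using consecutive_cuts_unique(1)[OF c(1)[of j]] c(2)[of j] by simp
  next
    case (3 j) then show ?case using consecutive_cuts_unique(2)[OF c(1)[of j]] c(2)[of j] by simp
  qed (use assms in \<open>simp add: splits_at_def\<close>)
  then show "s = s'" by blast
  have "B j = B' j" for j
  proof -
    have "int (length (B j)) = int (length (B' j))"
      using splits_at_next[OF assms(1), of j] splits_at_next[OF assms(2), of j] s by simp
    moreover have "spells e (s j) (B j)" "spells e (s j) (B' j)"
      using assms s by (simp_all add: splits_at_def)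
    ultimately show ?thesis unfolding spells_iff_map by metis
  qed
  then show "B = B'" by blast
qed

lemma blocks_eq: assumes "splits_at e B s" shows "blocks e = B"
  unfolding blocks_def
  by (rule the_equality) (use assms splits_at_unique(2) block_splitting_iff in blast)+

lemma int_least_above:
  fixes i :: int assumes "\<exists>j>i. P j" shows "\<exists>j>i. P j \<and> (\<forall>k. i < k \<and> k < j \<longrightarrow> \<not> P k)"
proof -
  obtain j where "i < j" "P j" using assms by blast
  then have ex: "P (i + 1 + int (nat (j - i - 1)))" by simp
  define n where "n = (LEAST n. P (i + 1 + int n))"
  have "P (i + 1 + int n)" unfolding n_def by (rule LeastI[where P = "\<lambda>n. P (i + 1 + int n)", OF ex])
  moreover have "\<not> P k" if "i < k" "k < i + 1 + int n" for k
  proof -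
    have "nat (k - i - 1) < n" using that by linarith
    from not_less_Least[OF this[unfolded n_def]] that show ?thesis by simp
  qed
  ultimately show ?thesis by (intro exI[of _ "i + 1 + int n"]) auto
qed

lemma int_greatest_below:
  fixes i :: int assumes "\<exists>j<i. P j" shows "\<exists>j<i. P j \<and> (\<forall>k. j < k \<and> k < i \<longrightarrow> \<not> P k)"
proof -
  have "\<exists>j>- i. P (- j)" using assms by (metis minus_minus neg_less_iff_less)
  from int_least_above[OF this] obtain j where j: "- i < j" "P (- j)" "\<And>k. - i < k \<Longrightarrow> k < j \<Longrightarrow> \<not> P (- k)" by blast
  have "\<not> P k" if "- j < k" "k < i" for k using j(3)[of "- k"] that by simp
  then show ?thesis using j by (intro exI[of _ "- j"]) auto
qed

text \<open>The starts are obtained by iterating the next and the previous cut from the cut at 1;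
  cuts recur on both sides, so neither ever runs out.\<close>

lemma golden_base_splits:
  assumes e: "e \<in> golden_base"
  obtains s where "splits_at e (blocks e) s"
proof -
  have "\<exists>j. consecutive_cuts e i j" if "cut_at e i" for i
  proof -
    have "\<exists>j\<ge>i + 1. cut_at e j" using e unfolding golden_base_iff by blast
    then have "\<exists>j>i. cut_at e j" by (meson add1_zle_eq)
    from int_least_above[OF this] show ?thesis using that unfolding consecutive_cuts_def by blast
  qed
  then obtain nx where nx: "\<And>i. cut_at e i \<Longrightarrow> consecutive_cuts e i (nx i)" by metis
  have "\<exists>j. consecutive_cuts e j i" if "cut_at e i" for i
  proof -
    have "\<exists>j\<le>i - 1. cut_at e j" using e unfolding golden_base_iff by blast
    then have "\<exists>j<i. cut_at e j" by (meson zle_diff1_eq)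
    from int_greatest_below[OF this] show ?thesis using that unfolding consecutive_cuts_def by blast
  qed
  then obtain pv where pv: "\<And>i. cut_at e i \<Longrightarrow> consecutive_cuts e (pv i) i" by metis
  have nc: "cut_at e (nx i)" "cut_at e (pv i)" if "cut_at e i" for i
    using nx[OF that] pv[OF that] by (auto simp: consecutive_cuts_def)
  have c1: "cut_at e 1" using e by (simp add: golden_base_iff)
  have cn: "cut_at e ((nx ^^ n) 1)" and cp: "cut_at e ((pv ^^ n) 1)" for n
    by (induction n) (use c1 nc in auto)
  define s where "s j = (if 1 \<le> j then (nx ^^ nat (j - 1)) 1 else (pv ^^ nat (1 - j)) 1)" for j
  have c: "consecutive_cuts e (s j) (s (j + 1))" for j
  proof (cases "1 \<le> j")
    case True
    then have "nat (j + 1 - 1) = Suc (nat (j - 1))" by simp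
    then have "s (j + 1) = nx (s j)" using True by (simp add: s_def)
    moreover have "cut_at e (s j)" using cn True by (simp add: s_def)
    ultimately show ?thesis using nx by simp
  next
    case False
    then have "nat (1 - j) = Suc (nat (1 - (j + 1)))" by simp
    moreover have "s (j + 1) = (pv ^^ nat (1 - (j + 1))) 1" using False by (auto simp: s_def)
    ultimately have "s j = pv (s (j + 1))" "cut_at e (s (j + 1))" using False cp by (simp_all add: s_def)
    then show ?thesis using pv by simp
  qed
  have "splits_at e (\<lambda>j. map e [s j..s (j + 1) - 1]) s"
    unfolding splits_at_def
  proof (intro conjI allI)
    show "s 1 = 1" by (simp add: s_def)
    fix j
    have "s j < s (j + 1)" using c[of j] by (simp add: consecutive_cuts_def)
    then show l: "s (j + 1) = s j + int (length (map e [s j..s (j + 1) - 1]))" by simp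
    show "golden_block (map e [s j..s (j + 1) - 1])"
      using e c by (intro golden_block_between_cuts) (auto simp: golden_base_iff)
    show "spells e (s j) (map e [s j..s (j + 1) - 1])" unfolding spells_iff_map l[symmetric] by simp
  qed
  moreover from blocks_eq[OF this] have "blocks e = (\<lambda>j. map e [s j..s (j + 1) - 1])" .
  ultimately show ?thesis using that by simp
qed

lemma splits_at_shift:
  assumes s: "splits_at e B s" and e: "e \<in> golden_base"
  shows "(\<lambda>i. e (i + (s m - 1))) \<in> golden_base"
    and "splits_at (\<lambda>i. e (i + (s m - 1))) (\<lambda>j. B (j + (m - 1))) (\<lambda>j. s (j + (m - 1)) - (s m - 1))"
proof -
  have "cut_at e (s m)" using splits_at_consecutive[OF s, of m] by (simp add: consecutive_cuts_def)
  then show "(\<lambda>i. e (i + (s m - 1))) \<in> golden_base" using golden_base_shift_iff[OF e, of "s m - 1"] by simp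
  have "s (j + 1 + (m - 1)) = s (j + (m - 1)) + int (length (B (j + (m - 1))))" for j
    using splits_at_next[OF s, of "j + (m - 1)"] by (simp add: algebra_simps)
  then show "splits_at (\<lambda>i. e (i + (s m - 1))) (\<lambda>j. B (j + (m - 1))) (\<lambda>j. s (j + (m - 1)) - (s m - 1))"
    using s by (simp add: splits_at_def spells_shift)
qed

lemma two_sided_shift_power: "(two_sided_shift ^^ n) e = (\<lambda>k. e (k + int n))"
  by (induction n arbitrary: e) (simp_all add: two_sided_shift_def funpow_swap1 add_ac)

text \<open>The 1 after the concatenation matters: it makes the end of the last word a cut, so that
  the block found there is not a longer one.\<close>

lemma splits_at_spells_iff:
  assumes s: "splits_at e B s" and bs: "\<And>b. b \<in> set bs \<Longrightarrow> golden_block b"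
  shows "(\<forall>i<length bs. B (m + int i) = bs ! i) \<longleftrightarrow>
    spells e (s m) (concat bs) \<and> e (s m + int (length (concat bs)))"
  using bs
proof (induction bs arbitrary: m)
  case Nil
  have "e (s m)" using splits_at_consecutive[OF s, of m] by (simp add: consecutive_cuts_def cut_at_def)
  then show ?case by (simp add: spells_def)
next
  case (Cons b bs)
  have b: "golden_block b" using Cons by simp
  have IH: "(\<forall>i<length bs. B (m + 1 + int i) = bs ! i) \<longleftrightarrow>
    spells e (s (m + 1)) (concat bs) \<and> e (s (m + 1) + int (length (concat bs)))"
    using Cons by simp
  have cm: "cut_at e (s m)" using splits_at_consecutive[OF s, of m] by (simp add: consecutive_cuts_def)
  have split: "(\<forall>i<length (b # bs). B (m + int i) = (b # bs) ! i) \<longleftrightarrow>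
      B m = b \<and> (\<forall>i<length bs. B (m + 1 + int i) = bs ! i)"
    by (simp add: All_less_Suc2 add_ac)
  show ?case
  proof
    assume "\<forall>i<length (b # bs). B (m + int i) = (b # bs) ! i"
    then have *: "B m = b" "\<forall>i<length bs. B (m + 1 + int i) = bs ! i" unfolding split by auto
    then have "s (m + 1) = s m + int (length b)" "spells e (s m) b" using s by (auto simp: splits_at_def)
    then show "spells e (s m) (concat (b # bs)) \<and> e (s m + int (length (concat (b # bs))))"
      using *(2) unfolding IH by (simp add: spells_append add_ac)
  next
    assume *: "spells e (s m) (concat (b # bs)) \<and> e (s m + int (length (concat (b # bs))))"
    then have sp: "spells e (s m) b" "spells e (s m + int (length b)) (concat bs)"
      by (simp_all add: spells_append)
    have "e (s m + int (length b))"
    proof (cases "concat bs = []")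
      case False
      then have "hd (concat bs)" using concat_blocks_hd[of bs] Cons by simp
      then show ?thesis using sp(2) False by (auto simp: spells_def hd_conv_nth dest: spec[of _ 0])
    next
      case True
      then have "concat (b # bs) = b" by simp
      then show ?thesis using * by (simp only:)
    qed
    from consecutive_cuts_block[OF b sp(1) cm this]
    have s1: "s (m + 1) = s m + int (length b)"
      using consecutive_cuts_unique(1)[OF splits_at_consecutive[OF s]] by blast
    then have "length (B m) = length b" "spells e (s m) (B m)" using s by (auto simp: splits_at_def)
    then have "B m = b" using sp(1) unfolding spells_iff_map by metis
    moreover have "spells e (s (m + 1)) (concat bs) \<and> e (s (m + 1) + int (length (concat bs)))"
      using sp(2) * unfolding s1 by (simp add: add_ac)
    ultimately show "\<forall>i<length (b # bs). B (m + int i) = (b # bs) ! i" unfolding split IH by blast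
  qed
qed

lemma first_block_length_cut:
  assumes "e \<in> golden_base"
  shows "consecutive_cuts e 1 (1 + int (first_block_length e))"
proof -
  obtain s where s: "splits_at e (blocks e) s" using golden_base_splits[OF assms] .
  have "s 1 = 1" "s (1 + 1) = 1 + int (first_block_length e)"
    using s splits_at_next[OF s, of 1] unfolding splits_at_def first_block_length_def by simp_all
  then show ?thesis using splits_at_consecutive[OF s, of 1] by simp
qed

lemma first_return_time_golden_base:
  assumes "e \<in> golden_base"
  shows "first_block_length e > 0" "(two_sided_shift ^^ first_block_length e) e \<in> golden_base"
    and "first_return_time two_sided_shift golden_base e = first_block_length e"
proof -
  note c = first_block_length_cut[OF assms]
  have iff: "(two_sided_shift ^^ n) e \<in> golden_base \<longleftrightarrow> cut_at e (1 + int n)" for n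
    unfolding two_sided_shift_power by (rule golden_base_shift_iff[OF assms])
  show 1: "first_block_length e > 0" using c by (simp add: consecutive_cuts_def)
  show 2: "(two_sided_shift ^^ first_block_length e) e \<in> golden_base"
    using c by (simp add: consecutive_cuts_def iff)
  show "first_return_time two_sided_shift golden_base e = first_block_length e"
    unfolding first_return_time_def
  proof (rule Least_equality)
    fix n assume n: "0 < n \<and> (two_sided_shift ^^ n) e \<in> golden_base"
    then have "\<not> 1 + int n < 1 + int (first_block_length e)"
      using c iff[of n] unfolding consecutive_cuts_def by auto
    then show "first_block_length e \<le> n" by simp
  qed (use 1 2 in simp)
qed

lemma goldenshift_blocks:
  assumes "e \<in> golden_base"
  shows "goldenshift e \<in> golden_base" "blocks (goldenshift e) j = blocks e (j + 1)"
proof -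
  obtain s where s: "splits_at e (blocks e) s" using golden_base_splits[OF assms] .
  have "s 1 = 1" "s (1 + 1) = 1 + int (first_block_length e)"
    using s splits_at_next[OF s, of 1] unfolding splits_at_def first_block_length_def by simp_all
  then have "goldenshift e = (\<lambda>i. e (i + (s 2 - 1)))"
    by (simp add: goldenshift_def two_sided_shift_power)
  then show "goldenshift e \<in> golden_base" "blocks (goldenshift e) j = blocks e (j + 1)"
    using splits_at_shift[OF s assms, of 2] by (simp_all add: blocks_eq)
qed

text \<open>Moving back by the length of block 0 makes that block the first one.\<close>

definition goldenshift_inverse :: "(int \<Rightarrow> bool) \<Rightarrow> int \<Rightarrow> bool" where
  "goldenshift_inverse e = (\<lambda>i. e (i - int (length (blocks e 0))))"

lemma goldenshift_inverse:
  assumes "e \<in> golden_base"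
  shows "goldenshift_inverse e \<in> golden_base" "goldenshift (goldenshift_inverse e) = e"
    "goldenshift_inverse (goldenshift e) = e"
proof -
  obtain s where s: "splits_at e (blocks e) s" using golden_base_splits[OF assms] .
  then have "s 1 = 1" using splits_at_def by blast
  then have "s 0 = 1 - int (length (blocks e 0))" using splits_at_next[OF s, of 0] by simp
  then have inv: "goldenshift_inverse e = (\<lambda>i. e (i + (s 0 - 1)))" by (simp add: goldenshift_inverse_def)
  show "goldenshift_inverse e \<in> golden_base" unfolding inv by (rule splits_at_shift[OF s assms])
  have "blocks (goldenshift_inverse e) = (\<lambda>j. blocks e (j + (0 - 1)))"
    unfolding inv by (rule blocks_eq[OF splits_at_shift(2)[OF s assms, of 0]])
  then show "goldenshift (goldenshift_inverse e) = e"
    by (simp add: goldenshift_def two_sided_shift_power first_block_length_def) (simp add: goldenshift_inverse_def)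
  show "goldenshift_inverse (goldenshift e) = e"
    using goldenshift_blocks(2)[OF assms, of 0]
    by (simp add: goldenshift_inverse_def) (simp add: goldenshift_def two_sided_shift_power first_block_length_def)
qed

section \<open>The Erdos measure\<close>

lemma sets_borel_Collect: "Measurable.pred coin_measure P \<Longrightarrow> {x. P x} \<in> sets borel"
  by (drule predE) (simp only: space_coin_measure UNIV_I simp_thms sets_coin_measure)

lemma sets_golden_space: "golden_space \<in> sets borel"
  unfolding golden_space_def by (rule sets_borel_Collect) measurable

lemma space_erdos_measure [simp]: "space erdos_measure = golden_space"
  by (simp add: erdos_measure_def space_restrict_space)

lemma sets_erdos_measure: "sets erdos_measure = sets (restrict_space borel golden_space)"
  by (simp add: erdos_measure_def)

lemma sets_erdos_measure_iff: "A \<in> sets erdos_measure \<longleftrightarrow> A \<in> sets borel \<and> A \<subseteq> golden_space"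
  using sets_restrict_space_iff[of golden_space borel A] sets_golden_space
  by (auto simp: sets_erdos_measure)

lemma sets_erdos_Int:
  assumes "A \<in> sets erdos_measure" "B \<in> sets borel"
  shows "A \<inter> B \<in> sets erdos_measure"
proof -
  have A: "A \<in> sets borel" "A \<subseteq> golden_space"
    using assms(1)[unfolded sets_erdos_measure_iff] by (rule conjunct1, rule conjunct2)
  have "A \<inter> B \<in> sets borel" by (rule sets.Int[OF A(1) assms(2)])
  moreover have "A \<inter> B \<subseteq> golden_space" using A(2) by (rule le_infI1)
  ultimately show ?thesis unfolding sets_erdos_measure_iff by (rule conjI)
qed

interpretation erdos: prob_space erdos_measure
  unfolding erdos_measure_def by (rule coin.prob_space_distr[OF measurable_two_sided_normalization])

lemma erdos_prob: "A \<in> sets erdos_measure \<Longrightarrow> erdos.prob A = coin.prob {x. two_sided_normalization x \<in> A}"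
  using measure_distr[OF measurable_two_sided_normalization, of A]
  unfolding sets_erdos_measure erdos_measure_def[symmetric] space_coin_measure Int_UNIV_right vimage_def .

lemma AE_erdos:
  assumes "AE x in coin_measure. P (two_sided_normalization x)" "{e \<in> golden_space. P e} \<in> sets erdos_measure"
  shows "AE e in erdos_measure. P e"
proof -
  have "{e \<in> space (restrict_space borel golden_space). P e} \<in> sets (restrict_space borel golden_space)"
    using assms(2) unfolding sets_erdos_measure space_restrict_space space_borel Int_UNIV_right .
  from AE_distr_iff[OF measurable_two_sided_normalization this] assms(1)
  show ?thesis unfolding erdos_measure_def by blast
qed

lemma measurable_shift_borel:
  "(\<lambda>e i. e (i + m)) \<in> (borel :: (int \<Rightarrow> bool) measure) \<rightarrow>\<^sub>M borel"
  by (intro measurable_to_sequences measurable_borel_component)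

lemma measurable_shift_erdos: "(\<lambda>e i. e (i + m)) \<in> erdos_measure \<rightarrow>\<^sub>M erdos_measure"
proof -
  have "(\<lambda>e i. e (i + m)) \<in> restrict_space borel golden_space \<rightarrow>\<^sub>M restrict_space borel golden_space"
    by (rule measurable_restrict_space3[OF measurable_shift_borel]) (use golden_space_shift in auto)
  then show ?thesis
    by (simp cong: measurable_cong_sets add: sets_erdos_measure)
qed

text \<open>The normalization commutes with the shift, so invariance is inherited from the coin
  measure.\<close>

lemma distr_erdos_shift: "distr erdos_measure erdos_measure (\<lambda>e i. e (i + m)) = erdos_measure"
proof -
  let ?R = "restrict_space borel golden_space" and ?T = "\<lambda>e i. (e :: int \<Rightarrow> bool) (i + m)"
  have T: "?T \<in> ?R \<rightarrow>\<^sub>M ?R"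
    using measurable_shift_erdos measurable_cong_sets[OF sets_erdos_measure sets_erdos_measure] by blast
  have "distr erdos_measure erdos_measure ?T = distr erdos_measure ?R ?T"
    by (rule distr_cong) (simp_all add: sets_erdos_measure)
  also have "\<dots> = distr coin_measure ?R (?T \<circ> two_sided_normalization)"
    unfolding erdos_measure_def by (rule distr_distr[OF T measurable_two_sided_normalization])
  also have "?T \<circ> two_sided_normalization = two_sided_normalization \<circ> ?T"
    by (simp add: fun_eq_iff two_sided_normalization_shift)
  also have "distr coin_measure ?R \<dots> = distr (distr coin_measure coin_measure ?T) ?R two_sided_normalization"
    by (rule distr_distr[OF measurable_two_sided_normalization measurable_coin_shift, symmetric])
  also have "\<dots> = erdos_measure" by (simp add: distr_coin_shift erdos_measure_def)
  finally show ?thesis .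
qed

lemma erdos_emeasure_shift:
  assumes "A \<in> sets erdos_measure"
  shows "{e \<in> golden_space. (\<lambda>i. e (i + m)) \<in> A} \<in> sets erdos_measure"
    and "emeasure erdos_measure {e \<in> golden_space. (\<lambda>i. e (i + m)) \<in> A} = emeasure erdos_measure A"
proof -
  have eq: "(\<lambda>e i. e (i + m)) -` A \<inter> space erdos_measure = {e \<in> golden_space. (\<lambda>i. e (i + m)) \<in> A}"
    by auto
  show "{e \<in> golden_space. (\<lambda>i. e (i + m)) \<in> A} \<in> sets erdos_measure"
    using measurable_sets[OF measurable_shift_erdos[of m] assms] unfolding eq .
  show "emeasure erdos_measure {e \<in> golden_space. (\<lambda>i. e (i + m)) \<in> A} = emeasure erdos_measure A"
    using emeasure_distr[OF measurable_shift_erdos[of m] assms] unfolding eq distr_erdos_shift by simp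
qed

lemma measure_automorphism_erdos: "measure_automorphism erdos_measure two_sided_shift"
proof -
  have T: "two_sided_shift = (\<lambda>e i. e (i + 1))" by (simp add: two_sided_shift_def fun_eq_iff)
  show ?thesis
    unfolding measure_automorphism_def T
    by (intro conjI erdos.prob_space_axioms measurable_shift_erdos distr_erdos_shift
        bexI[OF _ measurable_shift_erdos[of "- 1"]]) simp_all
qed

lemma measurable_cut_at: "Measurable.pred coin_measure (\<lambda>e. cut_at e i)"
  unfolding cut_at_def even_gap_def by measurable

lemma sets_borel_cut: "{e. cut_at e i} \<in> sets borel"
  by (rule sets_borel_Collect[OF measurable_cut_at])

lemma sets_cut_recurrent: "cut_recurrent \<in> sets erdos_measure"
proof -
  let ?A = "\<Inter>N. \<Union>i\<in>{..N}. {e. cut_at e i}" and ?B = "\<Inter>N. \<Union>i\<in>{N..}. {e. cut_at e i}"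
  have "(\<Union>i\<in>I. {e. cut_at e i}) \<in> sets borel" for I
    by (rule sets.countable_UN'') (simp_all add: sets_borel_cut)
  then have "?A \<in> sets borel" "?B \<in> sets borel"
    by (intro sets.countable_INT subsetI; blast)+
  moreover have "cut_recurrent =
      golden_space \<inter> (?A \<inter> ?B)"
    unfolding cut_recurrent_def by blast
  ultimately have "cut_recurrent \<in> sets borel" by (metis sets.Int sets_golden_space)
  moreover have "cut_recurrent \<subseteq> golden_space" by (auto simp: cut_recurrent_def)
  ultimately show ?thesis unfolding sets_erdos_measure_iff by (rule conjI)
qed

lemma sets_golden_base: "golden_base \<in> sets erdos_measure"
proof -
  have eq: "golden_base = cut_recurrent \<inter> {e. cut_at e 1}" unfolding golden_base_eq by blast
  show ?thesis unfolding eq by (rule sets_erdos_Int[OF sets_cut_recurrent sets_borel_cut])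
qed

text \<open>Copying the word is itself a path from \<open>Even\<close> to \<open>Even\<close>, and
  the two pairs of zeros force the true path into the same end states; by uniqueness the digits are
  copied. The cut is at the second 1 of the word.\<close>

lemma sync_cut:
  assumes x: "sync_recurrent x" and i: "sync_at x i"
  shows "cut_at (two_sided_normalization x) (i + 6)"
proof -
  let ?e = "two_sided_normalization x"
  obtain s where s: "\<And>i j. carry_path i j x ?e s" using sync_recurrent_path[OF x] by blast
  have xi: "x k = (k = i + 3 \<or> k = i + 6)" if "i + 1 \<le> k" "k \<le> i + 8" for k
    by (rule bspec[OF i[unfolded sync_at_def]]) (use that in simp)
  have zero: "\<not> x (i + 1)" "\<not> x (i + 1 + 1)" "\<not> x (i + 7)" "\<not> x (i + 7 + 1)" by (simp_all add: xi)
  define s' where "s' k = (if x k then Kept else Even)" for k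
  have path: "carry_path (i + 1) (i + 7) x x s'"
    unfolding carry_path_def
  proof (intro allI impI)
    fix k assume k: "i + 1 < k \<and> k \<le> i + 7"
    then show "carry_edge (s' (k - 1)) (x k) (x k) (s' k)"
      using xi[of k] xi[of "k - 1"] by (auto simp: s'_def carry_edge_def)
  qed
  have ends: "s (i + 1) = s' (i + 1)" "s (i + 7) = s' (i + 7)"
    using carry_path_two_zeros[OF s zero(1,2)] carry_path_two_zeros[OF s zero(3,4)] zero
    by (simp_all add: s'_def)
  have e: "?e k = x k" if "i + 1 < k" "k \<le> i + 7" for k
    by (rule carry_path_unique(2)[OF s path ends]) (use that in auto)
  show ?thesis
    unfolding cut_at_def even_gap_def
  proof (intro conjI exI[of _ 1] allI impI)
    show "?e (i + 6)" "?e (i + 6 - 1 - 2 * int 1)" by (simp_all add: e xi)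
    show "\<not> ?e k" if "i + 6 - 1 - 2 * int 1 < k \<and> k \<le> i + 6 - 1" for k
      using that by (simp add: e xi)
  qed simp
qed

lemma sync_recurrent_cut_recurrent:
  assumes x: "sync_recurrent x" shows "two_sided_normalization x \<in> cut_recurrent"
proof -
  have "\<exists>j\<le>N. cut_at (two_sided_normalization x) j" for N
  proof -
    obtain i where "i \<le> N - 6" "sync_at x i" using x unfolding sync_recurrent_def by blast
    then show ?thesis using sync_cut[OF x, of i] by (intro exI[of _ "i + 6"]) auto
  qed
  moreover have "\<exists>j\<ge>N. cut_at (two_sided_normalization x) j" for N
  proof -
    obtain i where "i \<ge> N" "sync_at x i" using x unfolding sync_recurrent_def by blast
    then show ?thesis using sync_cut[OF x, of i] by (intro exI[of _ "i + 6"]) auto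
  qed
  ultimately show ?thesis using two_sided_normalization_golden by (simp add: cut_recurrent_def)
qed

lemma AE_cut_recurrent: "AE e in erdos_measure. e \<in> cut_recurrent"
proof (rule AE_erdos)
  show "AE x in coin_measure. two_sided_normalization x \<in> cut_recurrent"
    using AE_sync_recurrent by (rule AE_mp) (simp add: sync_recurrent_cut_recurrent)
  have "{e \<in> golden_space. e \<in> cut_recurrent} = cut_recurrent" by (auto simp: cut_recurrent_def)
  then show "{e \<in> golden_space. e \<in> cut_recurrent} \<in> sets erdos_measure" using sets_cut_recurrent by simp
qed

section \<open>Cylinders of consecutive blocks under the Erdos measure\<close>

definition block_cylinder :: "int \<Rightarrow> bool list list \<Rightarrow> (int \<Rightarrow> bool) set" where
  "block_cylinder m bs = {e \<in> golden_base. \<forall>i<length bs. blocks e (m + int i) = bs ! i}"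

lemma golden_block_blocks: "e \<in> golden_base \<Longrightarrow> golden_block (blocks e j)"
  by (rule golden_base_splits[of e]) (auto simp: splits_at_def)

lemma block_cylinder_empty: "\<not> (\<forall>b\<in>set bs. golden_block b) \<Longrightarrow> block_cylinder m bs = {}"
proof -
  assume "\<not> (\<forall>b\<in>set bs. golden_block b)"
  then obtain i where i: "i < length bs" "\<not> golden_block (bs ! i)" by (metis in_set_conv_nth)
  show "block_cylinder m bs = {}"
  proof (rule equals0I)
    fix e assume "e \<in> block_cylinder m bs"
    then have "e \<in> golden_base" "blocks e (m + int i) = bs ! i" using i(1) by (auto simp: block_cylinder_def)
    then show False using golden_block_blocks[of e "m + int i"] i(2) by simp
  qed
qed

lemma block_cylinder_1:
  assumes "\<And>b. b \<in> set bs \<Longrightarrow> golden_block b"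
  shows "block_cylinder 1 bs = {e \<in> golden_base. spells e 1 (concat bs) \<and> e (1 + int (length (concat bs)))}"
proof -
  have "(\<forall>i<length bs. blocks e (1 + int i) = bs ! i) \<longleftrightarrow>
      spells e 1 (concat bs) \<and> e (1 + int (length (concat bs)))" if e: "e \<in> golden_base" for e
  proof -
    obtain s where s: "splits_at e (blocks e) s" using golden_base_splits[OF e] .
    then have "s 1 = 1" using splits_at_def by blast
    then show ?thesis using splits_at_spells_iff[OF s assms, where m = 1] by simp
  qed
  then show ?thesis unfolding block_cylinder_def by blast
qed

lemma splits_at_prefix_length:
  assumes s: "splits_at e B s" and "\<And>i. i < n \<Longrightarrow> B (m + int i) = bs ! i" "n \<le> length bs"
  shows "s (m + int n) = s m + int (length (concat (take n bs)))"
  using assms(2,3)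
proof (induction n)
  case (Suc n)
  then show ?case
    using splits_at_next[OF s, of "m + int n"] by (simp add: take_Suc_conv_app_nth add_ac)
qed simp

text \<open>All blocks from index \<open>1 - n\<close> to 0 are prescribed, so their total length
  \<open>d\<close> is known. The cylinder is then a shift by a constant, and invariance of the Erdos
  measure moves it to start at block 1.\<close>

lemma block_cylinder_shift:
  assumes "n \<le> length bs"
  defines "d \<equiv> int (length (concat (take n bs)))"
  shows "block_cylinder (1 - int n) bs = {e \<in> golden_space. (\<lambda>i. e (i + - d)) \<in> block_cylinder 1 bs}"
proof (intro equalityI subsetI)
  fix e assume e: "e \<in> block_cylinder (1 - int n) bs"
  then have base: "e \<in> golden_base" and bl: "\<And>i. i < length bs \<Longrightarrow> blocks e (1 - int n + int i) = bs ! i"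
    by (auto simp: block_cylinder_def)
  obtain s where s: "splits_at e (blocks e) s" using golden_base_splits[OF base] .
  then have "s 1 = 1" using splits_at_def by blast
  moreover have "s (1 - int n + int n) = s (1 - int n) + d" unfolding d_def
    by (rule splits_at_prefix_length[OF s]) (use bl assms in auto)
  ultimately have sd: "s (1 - int n) - 1 = - d" by simp
  note sh = splits_at_shift[OF s base, of "1 - int n", unfolded sd]
  have eq: "blocks (\<lambda>i. e (i + - d)) = (\<lambda>j. blocks e (j + (1 - int n - 1)))" by (rule blocks_eq[OF sh(2)])
  have idx: "1 + int i + (1 - int n - 1) = 1 - int n + int i" for i by simp
  have "(\<lambda>i. e (i + - d)) \<in> block_cylinder 1 bs"
    unfolding block_cylinder_def mem_Collect_eq eq idx using sh(1) bl by blast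
  then show "e \<in> {e \<in> golden_space. (\<lambda>i. e (i + - d)) \<in> block_cylinder 1 bs}"
    using base by (simp add: golden_base_iff)
next
  fix e assume "e \<in> {e \<in> golden_space. (\<lambda>i. e (i + - d)) \<in> block_cylinder 1 bs}"
  then have base: "(\<lambda>i. e (i + - d)) \<in> golden_base"
    and bl: "\<And>i. i < length bs \<Longrightarrow> blocks (\<lambda>i. e (i + - d)) (1 + int i) = bs ! i"
    by (auto simp: block_cylinder_def)
  obtain s where s: "splits_at (\<lambda>i. e (i + - d)) (blocks (\<lambda>i. e (i + - d))) s"
    using golden_base_splits[OF base] .
  then have "s 1 = 1" using splits_at_def by blast
  moreover have "s (1 + int n) = s 1 + d" unfolding d_def
    by (rule splits_at_prefix_length[OF s[unfolded d_def]]) (use bl assms in \<open>auto simp: d_def\<close>)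
  ultimately have sd: "s (1 + int n) - 1 = d" by simp
  note sh = splits_at_shift[OF s base, of "1 + int n", unfolded sd]
  have e: "(\<lambda>i. e (i + d + - d)) = e" by simp
  have "blocks e = (\<lambda>j. blocks (\<lambda>i. e (i + - d)) (j + (1 + int n - 1)))"
    using blocks_eq[OF sh(2)] unfolding e .
  then show "e \<in> block_cylinder (1 - int n) bs"
    using sh(1) bl unfolding e block_cylinder_def by simp
qed

lemma sets_spells: "{e. spells e 1 w \<and> e (1 + int (length w))} \<in> sets borel"
proof -
  have "depends_on {1..1 + int (length w)} {e. spells e 1 w \<and> e (1 + int (length w))}"
    unfolding depends_on_def
  proof (intro allI impI)
    fix x y assume xy: "\<forall>i\<in>{1..1 + int (length w)}. x i = y i"
      and x: "x \<in> {e. spells e 1 w \<and> e (1 + int (length w))}"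
    have "spells x 1 w \<longleftrightarrow> spells y 1 w" by (rule spells_cong) (use xy in simp)
    moreover have "x (1 + int (length w)) = y (1 + int (length w))" using xy by simp
    ultimately show "y \<in> {e. spells e 1 w \<and> e (1 + int (length w))}" using x by blast
  qed
  from depends_on_finite[OF this] show ?thesis by (simp only: sets_coin_measure finite_atLeastAtMost_int)
qed

lemma sets_block_cylinder_1: "block_cylinder 1 bs \<in> sets erdos_measure"
proof (cases "\<forall>b\<in>set bs. golden_block b")
  case True
  have "block_cylinder 1 bs = golden_base \<inter> {e. spells e 1 (concat bs) \<and> e (1 + int (length (concat bs)))}"
    using block_cylinder_1[of bs] True by blast
  then show ?thesis by (simp only: sets_erdos_Int[OF sets_golden_base sets_spells])
qed (simp add: block_cylinder_empty)

lemma block_cylinder_erdos: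
  assumes "n \<le> length bs"
  shows "block_cylinder (1 - int n) bs \<in> sets erdos_measure"
    and "emeasure erdos_measure (block_cylinder (1 - int n) bs) = emeasure erdos_measure (block_cylinder 1 bs)"
  unfolding block_cylinder_shift[OF assms]
  by (rule erdos_emeasure_shift[OF sets_block_cylinder_1])+

text \<open>On the sync recurrent sequences, which have full measure, past and future events
  describe the preimage of the cylinder.\<close>

lemma erdos_block_cylinder_1:
  assumes bs: "\<And>b. b \<in> set bs \<Longrightarrow> golden_block b"
  shows "erdos.prob (block_cylinder 1 bs) =
    coin.prob (past_event \<inter> future_event []) * prod_list (map block_weight bs)"
proof -
  have iff: "two_sided_normalization x \<in> block_cylinder 1 bs \<longleftrightarrow> x \<in> past_event \<inter> future_event (concat bs)"
    if x: "sync_recurrent x" for x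
  proof -
    let ?e = "two_sided_normalization x" and ?w = "concat bs"
    have w: "?w \<noteq> [] \<Longrightarrow> hd ?w" using concat_blocks_hd[OF bs] .
    have e1: "?e 1" if "spells ?e 1 ?w" "?e (1 + int (length ?w))"
    proof (cases "?w = []")
      case True
      then show ?thesis using that(2) by (simp only: list.size) simp
    next
      case False
      then have "?e (1 + int 0) = ?w ! 0" using that(1) unfolding spells_def by blast
      then show ?thesis using w[OF False] False by (simp add: hd_conv_nth)
    qed
    have "?e \<in> block_cylinder 1 bs \<longleftrightarrow> cut_at ?e 1 \<and> spells ?e 1 ?w \<and> ?e (1 + int (length ?w))"
      using sync_recurrent_cut_recurrent[OF x] block_cylinder_1[of bs, OF bs] unfolding golden_base_eq by blast
    also have "\<dots> \<longleftrightarrow> (\<exists>l. even_gap ?e 0 l) \<and> spells ?e 1 ?w \<and> ?e (int (length ?w) + 1)"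
      using e1 by (auto simp: cut_at_def add.commute)
    also have "\<dots> \<longleftrightarrow> x \<in> past_event \<and> x \<in> future_event ?w"
      by (rule past_future_iff[OF x w, symmetric])
    finally show ?thesis by simp
  qed
  have "erdos.prob (block_cylinder 1 bs) = coin.prob {x. two_sided_normalization x \<in> block_cylinder 1 bs}"
    by (rule erdos_prob[OF sets_block_cylinder_1])
  also have "\<dots> = coin.prob (past_event \<inter> future_event (concat bs))"
  proof (rule coin.finite_measure_eq_AE)
    show "AE x in coin_measure. x \<in> {x. two_sided_normalization x \<in> block_cylinder 1 bs} \<longleftrightarrow>
        x \<in> past_event \<inter> future_event (concat bs)"
      using AE_sync_recurrent by (rule AE_mp) (simp add: iff)
    show "{x. two_sided_normalization x \<in> block_cylinder 1 bs} \<in> sets coin_measure"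
      using measurable_sets[OF measurable_two_sided_normalization, of "block_cylinder 1 bs"]
        sets_block_cylinder_1[of bs] by (simp add: sets_erdos_measure vimage_def)
    show "past_event \<inter> future_event (concat bs) \<in> sets coin_measure"
      using past_event(1) future_event(1) by blast
  qed
  also have "\<dots> = coin.prob (past_event \<inter> future_event []) * prod_list (map block_weight bs)"
    by (rule coin_prob_past_future[OF bs])
  finally show ?thesis .
qed

lemma block_cylinder_Nil: "block_cylinder m [] = golden_base"
  by (simp add: block_cylinder_def)

lemma erdos_golden_base: "erdos.prob golden_base = coin.prob (past_event \<inter> future_event [])"
  using erdos_block_cylinder_1[of "[]"] by (simp add: block_cylinder_Nil)

text \<open>Countably many shifts of the base cover \<open>cut_recurrent\<close>, which has full
  measure, and each has the measure of the base.\<close>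

lemma erdos_golden_base_pos: "erdos.prob golden_base > 0"
proof (rule ccontr)
  assume "\<not> ?thesis"
  then have 0: "emeasure erdos_measure golden_base = 0"
    using measure_nonneg[of erdos_measure golden_base] by (simp add: erdos.emeasure_eq_measure)
  let ?N = "\<lambda>m. {e \<in> golden_space. (\<lambda>i. e (i + m)) \<in> golden_base}"
  have "AE e in erdos_measure. e \<notin> ?N m" for m
    by (rule AE_not_in[OF null_setsI[OF trans[OF erdos_emeasure_shift(2)[OF sets_golden_base] 0]
          erdos_emeasure_shift(1)[OF sets_golden_base]]])
  then have "AE e in erdos_measure. \<forall>m. e \<notin> ?N m" by (rule AE_all_countable[THEN iffD2, rule_format])
  with AE_cut_recurrent have "AE e in erdos_measure. False"
  proof eventually_elim
    case (elim e)
    then obtain i where "cut_at e i" by (auto simp: cut_recurrent_def)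
    then show ?case
      using elim cut_recurrent_shift_iff[OF elim(1), of "i - 1"] by (auto simp: cut_recurrent_def)
  qed
  then show False by (simp add: erdos.AE_False)
qed

section \<open>The block measure\<close>

text \<open>The candidate for \<open>block_measure\<close>. The restriction is there because
  \<open>uniform_measure\<close> keeps the whole space.\<close>

definition base_measure :: "(int \<Rightarrow> bool) measure" where
  "base_measure = restrict_space (uniform_measure erdos_measure golden_base) golden_base"

lemma space_base_measure [simp]: "space base_measure = golden_base"
proof -
  have "golden_base \<subseteq> golden_space" by (auto simp: golden_base_iff)
  then show ?thesis by (simp add: base_measure_def space_restrict_space Int_absorb2)
qed

lemma sets_golden_base_uniform:
  "golden_base \<inter> space (uniform_measure erdos_measure golden_base) \<in>
    sets (uniform_measure erdos_measure golden_base)"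
proof -
  have "golden_base \<inter> golden_space = golden_base" by (auto simp: golden_base_iff)
  then show ?thesis using sets_golden_base by (simp only: space_uniform_measure sets_uniform_measure space_erdos_measure)
qed

lemma sets_base_measure_iff: "A \<in> sets base_measure \<longleftrightarrow> A \<in> sets erdos_measure \<and> A \<subseteq> golden_base"
proof -
  from sets_restrict_space_iff[OF sets_golden_base_uniform, of A] show ?thesis
    unfolding base_measure_def sets_uniform_measure by (rule trans) (rule conj_commute)
qed

lemma sets_base_measure: "sets base_measure = sets (restrict_space borel golden_base)"
proof (rule set_eqI)
  fix A
  have sub: "golden_base \<subseteq> golden_space" by (auto simp: golden_base_iff)
  have gb: "golden_base \<in> sets borel" using sets_golden_base unfolding sets_erdos_measure_iff by (rule conjunct1)
  then have "golden_base \<inter> space borel \<in> sets borel" unfolding space_borel Int_UNIV_right .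
  from sets_restrict_space_iff[OF this, of A]
  show "A \<in> sets base_measure \<longleftrightarrow> A \<in> sets (restrict_space borel golden_base)"
    unfolding sets_base_measure_iff sets_erdos_measure_iff using sub by (metis subset_trans)
qed

lemma emeasure_base_measure:
  assumes "A \<in> sets erdos_measure" "A \<subseteq> golden_base"
  shows "emeasure base_measure A = ennreal (erdos.prob A / erdos.prob golden_base)"
proof -
  have "emeasure base_measure A = emeasure (uniform_measure erdos_measure golden_base) A"
    unfolding base_measure_def by (rule emeasure_restrict_space[OF sets_golden_base_uniform assms(2)])
  also have "\<dots> = emeasure erdos_measure (golden_base \<inter> A) / emeasure erdos_measure golden_base"
    by (rule emeasure_uniform_measure[OF sets_golden_base assms(1)])
  also have "golden_base \<inter> A = A" using assms(2) by (rule Int_absorb1)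
  also have "emeasure erdos_measure A / emeasure erdos_measure golden_base =
      ennreal (erdos.prob A / erdos.prob golden_base)"
    unfolding erdos.emeasure_eq_measure by (rule divide_ennreal[OF measure_nonneg erdos_golden_base_pos])
  finally show ?thesis .
qed

interpretation base: prob_space base_measure
proof
  show "emeasure base_measure (space base_measure) = 1"
    unfolding space_base_measure emeasure_base_measure[OF sets_golden_base order_refl]
    using erdos_golden_base_pos by simp
qed

text \<open>Zero off the blocks, so that product formulas hold for arbitrary words.\<close>

definition letter_weight :: "bool list \<Rightarrow> real" where
  "letter_weight b = (if golden_block b then block_weight b else 0)"

lemma letter_weight_nonneg: "0 \<le> letter_weight b"
  by (simp add: letter_weight_def block_weight_def)

lemma block_cylinder_subset: "block_cylinder m bs \<subseteq> golden_base"
  by (auto simp: block_cylinder_def)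

lemma emeasure_base_block_cylinder:
  assumes "n \<le> length bs"
  shows "emeasure base_measure (block_cylinder (1 - int n) bs) = ennreal (prod_list (map letter_weight bs))"
proof (cases "\<forall>b\<in>set bs. golden_block b")
  case True
  have "erdos.prob (block_cylinder (1 - int n) bs) = erdos.prob (block_cylinder 1 bs)"
    using block_cylinder_erdos(2)[OF assms] by (simp add: measure_def)
  also have "\<dots> = erdos.prob golden_base * prod_list (map block_weight bs)"
    using erdos_block_cylinder_1[of bs] True erdos_golden_base by simp
  also have "map block_weight bs = map letter_weight bs" using True by (simp add: letter_weight_def)
  finally show ?thesis
    unfolding emeasure_base_measure[OF block_cylinder_erdos(1)[OF assms] block_cylinder_subset]
    using erdos_golden_base_pos by simp
next
  case False
  then obtain b where "b \<in> set bs" "letter_weight b = 0" by (auto simp: letter_weight_def)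
  then have "prod_list (map letter_weight bs) = 0" by (force simp: prod_list_zero_iff)
  then show ?thesis using block_cylinder_empty[OF False] by simp
qed

section \<open>Prescribing the blocks at finitely many indices\<close>

definition block_event :: "int set \<Rightarrow> (int \<Rightarrow> bool list) \<Rightarrow> (int \<Rightarrow> bool) set" where
  "block_event J w = {e \<in> golden_base. \<forall>j\<in>J. blocks e j = w j}"

lemma block_event_interval:
  "block_event {- int n..int n} w = block_cylinder (- int n) (map (\<lambda>i. w (- int n + int i)) [0..<2 * n + 1])"
proof -
  have "(\<forall>j\<in>{- int n..int n}. blocks e j = w j) \<longleftrightarrow>
      (\<forall>i<2 * n + 1. blocks e (- int n + int i) = w (- int n + int i))" for e
  proof (intro iffI ballI allI impI)
    fix j assume *: "\<forall>i<2 * n + 1. blocks e (- int n + int i) = w (- int n + int i)" "j \<in> {- int n..int n}"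
    then show "blocks e j = w j" by (auto dest!: spec[of _ "nat (j + int n)"])
  qed auto
  then show ?thesis by (simp add: block_event_def block_cylinder_def nth_map_upt cong: conj_cong del: upt_Suc)
qed

lemma emeasure_block_event_interval:
  "emeasure base_measure (block_event {- int n..int n} w) = ennreal (\<Prod>j\<in>{- int n..int n}. letter_weight (w j))"
  "block_event {- int n..int n} w \<in> sets base_measure"
proof -
  let ?bs = "map (\<lambda>i. w (- int n + int i)) [0..<2 * n + 1]"
  have n: "- int n = 1 - int (n + 1)" "n + 1 \<le> length ?bs" by simp_all
  have "prod_list (map letter_weight ?bs) = (\<Prod>i\<in>set [0..<2 * n + 1]. letter_weight (w (- int n + int i)))"
    by (subst prod.distinct_set_conv_list) (simp_all add: comp_def)
  also have "\<dots> = (\<Prod>j\<in>{- int n..int n}. letter_weight (w j))"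
    by (rule prod.reindex_bij_witness[where i = "\<lambda>j. nat (j + int n)" and j = "\<lambda>i. - int n + int i"]) auto
  finally show "emeasure base_measure (block_event {- int n..int n} w) =
      ennreal (\<Prod>j\<in>{- int n..int n}. letter_weight (w j))"
    unfolding block_event_interval emeasure_base_block_cylinder[OF n(2), folded n(1)]
    by (rule arg_cong[where f = ennreal])
  show "block_event {- int n..int n} w \<in> sets base_measure"
    unfolding block_event_interval sets_base_measure_iff
    using block_cylinder_erdos(1)[OF n(2), folded n(1)] block_cylinder_subset by (rule conjI)
qed

lemma block_event_UN:
  "block_event J w = (\<Union>b. block_event (insert i J) (w(i := b)))" if "i \<notin> J"
  using that by (auto simp: block_event_def)

lemma sets_block_event:
  assumes "finite J" shows "block_event J w \<in> sets base_measure"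
proof -
  have single: "block_event {j} w \<in> sets base_measure" for j w
  proof -
    define n where "n = nat \<bar>j\<bar>"
    let ?I = "{- int n..int n}"
    \<comment> \<open>Lists index the union because they are countable, while functions from
      \<open>int\<close> to words are not.\<close>
    let ?U = "\<Union>bs\<in>{bs. bs ! nat (j + int n) = w j}. block_event ?I (\<lambda>k. bs ! nat (k + int n))"
    have "j \<in> ?I" by (simp add: n_def abs_le_iff[symmetric]) linarith
    have "block_event {j} w = ?U"
    proof (intro equalityI subsetI)
      fix e assume e: "e \<in> block_event {j} w"
      let ?bs = "map (\<lambda>i. blocks e (- int n + int i)) [0..<2 * n + 1]"
      have nth: "?bs ! nat (k + int n) = blocks e k" if "k \<in> ?I" for k
      proof -
        have "nat (k + int n) < 2 * n + 1" using that by auto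
        then have "?bs ! nat (k + int n) = blocks e (- int n + int (nat (k + int n)))"
          by (simp only: nth_map length_upt nth_upt diff_zero add_0)
        then show ?thesis using that by simp
      qed
      show "e \<in> ?U"
        using e nth nth[OF \<open>j \<in> ?I\<close>] by (intro UN_I[of ?bs]) (simp_all only: block_event_def mem_Collect_eq, simp_all)
    next
      fix e assume "e \<in> ?U"
      then obtain bs where "bs ! nat (j + int n) = w j" "e \<in> block_event ?I (\<lambda>k. bs ! nat (k + int n))" by blast
      then show "e \<in> block_event {j} w" using \<open>j \<in> ?I\<close> unfolding block_event_def by auto
    qed
    also have "\<dots> \<in> sets base_measure"
      by (rule sets.countable_UN'') (simp_all only: countableI_type emeasure_block_event_interval(2))
    finally show ?thesis .
  qed
  show ?thesis
    using assms
  proof (induction J)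
    case empty
    have "block_event {} w = space base_measure" by (simp add: block_event_def)
    then show ?case by (simp only: sets.top)
  next
    case (insert j J)
    have "block_event (insert j J) w = block_event {j} w \<inter> block_event J w" by (auto simp: block_event_def)
    then show ?case using sets.Int[OF single insert.IH] by simp
  qed
qed

lemma emeasure_eq_sum_blocks:
  assumes "finite J" "i \<notin> J"
  shows "emeasure base_measure (block_event J w) =
    (\<integral>\<^sup>+b. emeasure base_measure (block_event (insert i J) (w(i := b))) \<partial>count_space UNIV)"
  unfolding block_event_UN[OF \<open>i \<notin> J\<close>, of w]
proof (rule emeasure_UN_countable)
  show "block_event (insert i J) (w(i := b)) \<in> sets base_measure" for b
    using assms by (intro sets_block_event) simp
  show "disjoint_family (\<lambda>b. block_event (insert i J) (w(i := b)))"
    by (auto simp: disjoint_family_on_def block_event_def)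
qed simp

text \<open>No combinatorial summation: the weights are the probabilities of the values of block 0,
  and these events partition the base.\<close>

lemma letter_weight_sum: "(\<integral>\<^sup>+b. ennreal (letter_weight b) \<partial>count_space UNIV) = 1"
proof -
  have "emeasure base_measure (block_event {0} (w(0 := b))) = ennreal (letter_weight b)" for w b
    using emeasure_block_event_interval(1)[of 0 "w(0 := b)"] by simp
  moreover have "block_event {} w = space base_measure" for w by (simp add: block_event_def)
  ultimately show ?thesis
    using emeasure_eq_sum_blocks[of "{}" 0] base.emeasure_space_1 by simp
qed

text \<open>The formula is known for symmetric intervals of indices. The surplus indices are summed
  out one at a time, each contributing the factor 1.\<close>

lemma emeasure_block_event:
  assumes "finite J"
  shows "emeasure base_measure (block_event J w) = ennreal (\<Prod>j\<in>J. letter_weight (w j))"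
proof -
  have remove: "emeasure base_measure (block_event J w) = ennreal (\<Prod>j\<in>J. letter_weight (w j))"
    if *: "\<And>w. emeasure base_measure (block_event (insert i J) w) = ennreal (\<Prod>j\<in>insert i J. letter_weight (w j))"
      and J: "finite J" "i \<notin> J" for i J w
  proof -
    let ?p = "\<Prod>j\<in>J. letter_weight (w j)"
    have "(\<Prod>j\<in>insert i J. letter_weight ((w(i := b)) j)) = ?p * letter_weight b" for b
    proof -
      have "(\<Prod>j\<in>J. letter_weight ((w(i := b)) j)) = ?p"
        by (rule prod.cong) (use J(2) in auto)
      then show ?thesis using J by simp
    qed
    then have "emeasure base_measure (block_event J w) =
        (\<integral>\<^sup>+b. ennreal ?p * ennreal (letter_weight b) \<partial>count_space UNIV)"
      unfolding emeasure_eq_sum_blocks[OF J] *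
      by (simp add: ennreal_mult prod_nonneg letter_weight_nonneg del: fun_upd_apply)
    also have "\<dots> = ennreal ?p" by (simp add: nn_integral_cmult letter_weight_sum)
    finally show ?thesis .
  qed
  obtain n where n: "J \<subseteq> {- int n..int n}"
  proof -
    obtain b where "\<And>j. j \<in> J \<Longrightarrow> \<bar>j\<bar> \<le> b"
      using assms by (metis Max_ge finite_imageI image_eqI)
    then have "J \<subseteq> {- int (nat b)..int (nat b)}" by force
    then show thesis by (rule that)
  qed
  define I where "I = {- int n..int n}"
  have "emeasure base_measure (block_event (I - D) w) = ennreal (\<Prod>j\<in>I - D. letter_weight (w j))"
    if "finite D" "D \<subseteq> I" for D w
    using that
  proof (induction D arbitrary: w)
    case empty
    then show ?case using emeasure_block_event_interval(1) by (simp add: I_def)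
  next
    case (insert i D)
    have eq: "insert i (I - insert i D) = I - D" using insert by auto
    show ?case
    proof (rule remove[of i])
      show "emeasure base_measure (block_event (insert i (I - insert i D)) w) =
          ennreal (\<Prod>j\<in>insert i (I - insert i D). letter_weight (w j))" for w
        unfolding eq using insert.IH insert.prems by blast
    qed (simp_all add: I_def)
  qed
  from this[of "I - J" w] n show ?thesis by (simp add: I_def double_diff)
qed

text \<open>Blocks are nonempty and block 1 starts at coordinate 1, so the \<open>n + 1\<close>
  blocks up to index 0 reach back at least to \<open>- n\<close> and the \<open>n\<close> blocks
  after them reach at least to \<open>n\<close>.\<close>

lemma same_blocks_same_digit:
  assumes e: "e \<in> block_cylinder (- int n) bs" "e' \<in> block_cylinder (- int n) bs"
    and len: "length bs = 2 * n + 1" and i: "\<bar>i\<bar> < int n"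
  shows "e i = e' i"
proof -
  \<comment> \<open>The total length of the blocks with indices \<open>- n\<close> to 0, so that
    block \<open>- n\<close> starts at \<open>1 - d\<close>.\<close>
  define d where "d = int (length (concat (take (n + 1) bs)))"
  have long: "length xs \<le> length (concat xs)" if "\<And>b. b \<in> set xs \<Longrightarrow> b \<noteq> []" for xs :: "bool list list"
    using that
  proof (induction xs)
    case (Cons x xs)
    then have "length xs \<le> length (concat xs)" by simp
    have "1 \<le> length x" using Cons by (simp add: Suc_le_eq)
    then show ?case using \<open>length xs \<le> length (concat xs)\<close> by simp
  qed simp
  have gb: "golden_block b" if "b \<in> set bs" for b
    using block_cylinder_empty[of bs "- int n"] e(1) that by blast
  then have ne: "b \<noteq> []" if "b \<in> set bs" for b using golden_block_nonempty that by blast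
  have *: "spells f (1 - d) (concat bs)" if f: "f \<in> block_cylinder (- int n) bs" for f
  proof -
    have base: "f \<in> golden_base" and bl: "\<And>i. i < length bs \<Longrightarrow> blocks f (- int n + int i) = bs ! i"
      using f by (auto simp: block_cylinder_def)
    obtain s where s: "splits_at f (blocks f) s" using golden_base_splits[OF base] .
    then have "s 1 = 1" using splits_at_def by blast
    moreover have "s (- int n + int (n + 1)) = s (- int n) + d"
      unfolding d_def by (rule splits_at_prefix_length[OF s]) (use bl len in auto)
    ultimately have "s (- int n) = 1 - d" by simp
    moreover have "spells f (s (- int n)) (concat bs)"
      using splits_at_spells_iff[of f "blocks f" s bs "- int n", OF s gb] bl by blast
    ultimately show ?thesis by simp
  qed
  have "int (n + 1) \<le> d"
  proof -
    have "length (take (n + 1) bs) \<le> length (concat (take (n + 1) bs))"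
      by (rule long) (meson in_set_takeD ne)
    then show ?thesis by (simp add: d_def len)
  qed
  moreover have "int n \<le> int (length (concat bs)) - d"
  proof -
    have "length (drop (n + 1) bs) \<le> length (concat (drop (n + 1) bs))"
      by (rule long) (meson in_set_dropD ne)
    moreover have "length (concat bs) = length (concat (take (n + 1) bs)) + length (concat (drop (n + 1) bs))"
      by (metis append_take_drop_id concat_append length_append)
    ultimately show ?thesis by (simp add: d_def len)
  qed
  ultimately have k: "nat (i - (1 - d)) < length (concat bs)" "i = 1 - d + int (nat (i - (1 - d)))"
    using i by linarith+
  have "f i = concat bs ! nat (i - (1 - d))" if "f \<in> block_cylinder (- int n) bs" for f
    using *[OF that] k unfolding spells_def by metis
  from this[OF e(1)] this[OF e(2)] show ?thesis by (rule trans[OF _ sym])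
qed

text \<open>Incompatible prescriptions meet in the empty set, which is added for closure under
  intersection.\<close>

definition cylinders :: "(int \<Rightarrow> bool) set set" where
  "cylinders = insert {} {block_event J w | J w. finite J}"

lemma Int_stable_cylinders: "Int_stable cylinders"
proof (rule Int_stableI)
  fix A B assume "A \<in> cylinders" "B \<in> cylinders"
  then consider "A = {} \<or> B = {}"
    | J v K w where "A = block_event J v" "B = block_event K w" "finite J" "finite K"
    unfolding cylinders_def by blast
  then show "A \<inter> B \<in> cylinders"
  proof cases
    case 2
    show ?thesis
    proof (cases "\<forall>j\<in>J \<inter> K. v j = w j")
      case True
      then have "A \<inter> B = block_event (J \<union> K) (\<lambda>j. if j \<in> J then v j else w j)"
        unfolding 2 block_event_def by auto
      then show ?thesis using 2(3,4) unfolding cylinders_def by blast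
    next
      case False
      then have "A \<inter> B = {}" unfolding 2 block_event_def by fastforce
      then show ?thesis by (simp add: cylinders_def)
    qed
  qed (auto simp: cylinders_def)
qed

lemma cylinders_Pow: "cylinders \<subseteq> Pow golden_base"
  by (auto simp: cylinders_def block_event_def)

text \<open>Finitely many blocks around 0 determine a given coordinate, so each coordinate event is
  a countable union of cylinders, and the coordinates generate the Borel sets.\<close>

lemma sigma_sets_cylinders: "sigma_sets golden_base cylinders = sets (restrict_space borel golden_base)"
proof
  have "cylinders \<subseteq> sets base_measure"
    unfolding cylinders_def using sets_block_event sets.empty_sets[of base_measure] by blast
  then have "sigma_sets (space base_measure) cylinders \<subseteq> sets base_measure" by (rule sets.sigma_sets_subset)
  then show "sigma_sets golden_base cylinders \<subseteq> sets (restrict_space borel golden_base)"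
    by (simp only: space_base_measure sets_base_measure)
next
  define S where "S = sigma golden_base cylinders"
  have space: "space S = golden_base" and sets: "sets S = sigma_sets golden_base cylinders"
    unfolding S_def using cylinders_Pow by (simp_all add: space_measure_of sets_measure_of)
  have coord: "(\<lambda>e. e i) \<in> S \<rightarrow>\<^sub>M count_space UNIV" for i
  proof -
    let ?K = "{A. (\<exists>n w. A = block_event {- int n..int n} w) \<and> A \<subseteq> {e. e i}}"
    have K: "?K \<subseteq> cylinders" unfolding cylinders_def by blast
    have "{e \<in> golden_base. e i} = \<Union>?K"
    proof (intro equalityI subsetI)
      fix e assume e: "e \<in> {e \<in> golden_base. e i}"
      define n where "n = nat \<bar>i\<bar> + 1"
      let ?A = "block_event {- int n..int n} (blocks e)"
      have eA: "e \<in> ?A" using e by (simp add: block_event_def)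
      have "e' i = e i" if "e' \<in> ?A" for e'
        using that eA unfolding block_event_interval
        by (rule same_blocks_same_digit) (simp_all add: n_def)
      then have "?A \<in> ?K" using e by blast
      then show "e \<in> \<Union>?K" using eA by blast
    next
      fix e assume "e \<in> \<Union>?K"
      then show "e \<in> {e \<in> golden_base. e i}" unfolding block_event_def by blast
    qed
    moreover have "\<Union>?K \<in> sets S"
    proof (rule sets.countable_Union)
      have "?K \<subseteq> (\<lambda>(n, bs). block_cylinder (- int n) bs) ` UNIV"
        unfolding block_event_interval by blast
      then show "countable ?K" by (rule countable_subset) simp
      show "?K \<subseteq> sets S" unfolding sets using sigma_sets.Basic K by blast
    qed
    ultimately have "{e \<in> space S. e i} \<in> sets S" by (simp only: space)
    then show ?thesis by (simp only: pred_def)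
  qed
  have id: "(\<lambda>e. e) \<in> S \<rightarrow>\<^sub>M borel" by (rule measurable_to_sequences[OF coord])
  show "sets (restrict_space borel golden_base) \<subseteq> sigma_sets golden_base cylinders"
  proof
    fix A assume "A \<in> sets (restrict_space borel golden_base)"
    then obtain B where B: "B \<in> sets borel" "A = golden_base \<inter> B"
      unfolding sets_restrict_space by blast
    have "(\<lambda>e. e) -` B \<inter> space S \<in> sets S" by (rule measurable_sets[OF id B(1)])
    moreover have "(\<lambda>e. e) -` B \<inter> space S = A" unfolding space B(2) by blast
    ultimately show "A \<in> sigma_sets golden_base cylinders" by (simp only: sets)
  qed
qed

text \<open>Cylinders generate the Borel sets and are closed under intersection. The criterion
  yields both uniqueness of the block measure and invariance under
  \<open>goldenshift\<close>.\<close>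

lemma base_measure_eqI:
  assumes M: "prob_space M" "space M = golden_base" "sets M = sets (restrict_space borel golden_base)"
    and eq: "\<And>J w. finite J \<Longrightarrow> emeasure M (block_event J w) = (\<Prod>j\<in>J. letter_weight (w j))"
  shows "M = base_measure"
proof (rule measure_eqI_generator_eq[where A = "\<lambda>_. golden_base" and \<Omega> = golden_base, OF Int_stable_cylinders cylinders_Pow])
  fix A assume "A \<in> cylinders"
  then consider "A = {}" | J w where "A = block_event J w" "finite J" by (auto simp: cylinders_def)
  then show "emeasure M A = emeasure base_measure A"
    by cases (simp_all only: eq emeasure_block_event emeasure_empty)
next
  show "sets M = sigma_sets golden_base cylinders" unfolding sigma_sets_cylinders by (rule M(3))
  show "sets base_measure = sigma_sets golden_base cylinders" unfolding sigma_sets_cylinders by (rule sets_base_measure)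
  have "golden_base = block_event {} w" for w by (simp add: block_event_def)
  then show "range (\<lambda>_::nat. golden_base) \<subseteq> cylinders" unfolding cylinders_def by blast
  interpret M: prob_space M by (rule M(1))
  show "emeasure M golden_base \<noteq> \<infinity>" by simp
qed simp

lemma prob_block_event: "finite J \<Longrightarrow> base.prob (block_event J w) = (\<Prod>j\<in>J. letter_weight (w j))"
  by (simp add: measure_def emeasure_block_event prod_nonneg letter_weight_nonneg)

lemma block_event_single: "{e \<in> golden_base. blocks e j = b} = block_event {j} (\<lambda>_. b)"
  by (simp add: block_event_def)

lemma measurable_blocks: "(\<lambda>e. blocks e j) \<in> base_measure \<rightarrow>\<^sub>M count_space UNIV"
proof -
  have pre: "(\<lambda>e. blocks e j) -` {b} \<inter> space base_measure \<in> sets base_measure" for b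
  proof -
    have "(\<lambda>e. blocks e j) -` {b} \<inter> space base_measure = block_event {j} (\<lambda>_. b)"
      unfolding block_event_def space_base_measure by blast
    then show ?thesis using sets_block_event[of "{j}" "\<lambda>_. b"] by (simp only: finite.emptyI finite.insertI)
  qed
  show ?thesis
    by (subst measurable_count_space_eq2_countable)
       (rule conjI[OF _ ballI[OF pre]], simp)
qed

text \<open>The events prescribing one block, with the empty set, are closed under intersection, and
  as there are only countably many words they generate all events of that block; independence
  extends from them.\<close>

lemma indep_vars_blocks: "base.indep_vars (\<lambda>_. count_space UNIV) (\<lambda>j e. blocks e j) UNIV"
proof -
  let ?V = "\<lambda>j. {(\<lambda>e. blocks e j) -` A \<inter> space base_measure |A. A \<in> sets (count_space UNIV)}"
  let ?E = "\<lambda>j. {block_event {j} (\<lambda>_. b) | b. True} \<union> {{}}"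
  have "base.indep_sets ?E UNIV"
  proof (rule base.indep_setsI)
    show "?E j \<subseteq> base.events" for j
      using sets_block_event[of "{j}"] sets.empty_sets[of base_measure] by blast
    fix A and J :: "int set" assume J: "J \<noteq> {}" "finite J" and A: "\<forall>j\<in>J. A j \<in> ?E j"
    show "base.prob (\<Inter>j\<in>J. A j) = (\<Prod>j\<in>J. base.prob (A j))"
    proof (cases "\<exists>j\<in>J. A j = {}")
      case True
      then obtain j where j: "j \<in> J" "A j = {}" by blast
      then have "(\<Inter>j\<in>J. A j) = {}" by blast
      moreover have "(\<Prod>j\<in>J. base.prob (A j)) = 0"
        by (rule prod_zero[OF J(2)]) (use j in \<open>auto intro!: bexI[of _ j]\<close>)
      ultimately show ?thesis by simp
    next
      case False
      with A have "\<forall>j\<in>J. \<exists>b. A j = block_event {j} (\<lambda>_. b)" by blast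
      then obtain w where w: "\<And>j. j \<in> J \<Longrightarrow> A j = block_event {j} (\<lambda>_. w j)" by metis
      have "(\<Inter>j\<in>J. A j) = block_event J w"
        using w J(1) by (auto simp: block_event_def)
      then have "base.prob (\<Inter>j\<in>J. A j) = (\<Prod>j\<in>J. letter_weight (w j))"
        by (simp only: prob_block_event[OF J(2)])
      also have "\<dots> = (\<Prod>j\<in>J. base.prob (A j))"
        by (rule prod.cong[OF refl]) (simp add: w prob_block_event)
      finally show ?thesis .
    qed
  qed
  then have "base.indep_sets (\<lambda>j. sigma_sets (space base_measure) (?E j)) UNIV"
  proof (rule base.indep_sets_sigma)
    show "Int_stable (?E j)" for j
    proof (rule Int_stableI)
      fix A B assume "A \<in> ?E j" "B \<in> ?E j"
      then consider "A = {} \<or> B = {}"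
        | a b where "A = block_event {j} (\<lambda>_. a)" "B = block_event {j} (\<lambda>_. b)" by blast
      then show "A \<inter> B \<in> ?E j"
      proof cases
        case 2
        then have "A \<inter> B = A \<or> A \<inter> B = {}" by (auto simp: block_event_def)
        then show ?thesis using \<open>A \<in> ?E j\<close> by auto
      qed auto
    qed
  qed
  then have "base.indep_sets ?V UNIV"
  proof (rule base.indep_sets_mono_sets)
    show "?V j \<subseteq>
        sigma_sets (space base_measure) (?E j)" for j
    proof
      fix C assume "C \<in> ?V j"
      then obtain A where "C = (\<lambda>e. blocks e j) -` A \<inter> space base_measure" by blast
      then have C: "C = \<Union>((\<lambda>b. block_event {j} (\<lambda>_. b)) ` A)"
        unfolding block_event_def space_base_measure by blast
      show "C \<in> sigma_sets (space base_measure) (?E j)"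
        unfolding C
      proof (rule sigma_sets_UNION)
        show "countable ((\<lambda>b. block_event {j} (\<lambda>_. b)) ` A)" by simp
        fix D assume "D \<in> (\<lambda>b. block_event {j} (\<lambda>_. b)) ` A"
        then have "D \<in> ?E j" by blast
        then show "D \<in> sigma_sets (space base_measure) (?E j)" by (rule sigma_sets.Basic)
      qed
    qed
  qed
  then show ?thesis unfolding base.indep_vars_def2 using measurable_blocks by blast
qed

lemma is_block_measure_base: "is_block_measure base_measure"
  unfolding is_block_measure_def
proof (intro conjI allI impI)
  show "base.prob {e \<in> golden_base. blocks e j = w} = real (representation_count w) / 2 ^ length w"
    if "golden_block w" for j w
    using that unfolding block_event_single by (simp add: prob_block_event letter_weight_def block_weight_def)
qed (rule base.prob_space_axioms space_base_measure sets_base_measure indep_vars_blocks)+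

lemma is_block_measure_unique:
  assumes "is_block_measure M" shows "M = base_measure"
proof -
  have M: "prob_space M" "space M = golden_base" "sets M = sets (restrict_space borel golden_base)"
    and ind: "prob_space.indep_vars M (\<lambda>_. count_space UNIV) (\<lambda>j e. blocks e j) UNIV"
    and marg: "\<And>j w. golden_block w \<Longrightarrow> measure M {e \<in> golden_base. blocks e j = w} = block_weight w"
    using assms unfolding is_block_measure_def block_weight_def by blast+
  interpret M: prob_space M by (rule M(1))
  have marg': "measure M {e \<in> golden_base. blocks e j = w} = letter_weight w" for j w
  proof (cases "golden_block w")
    case False
    then have "{e \<in> golden_base. blocks e j = w} = {}" using golden_block_blocks by blast
    then show ?thesis using False by (simp only: letter_weight_def measure_empty if_False)
  qed (simp add: marg letter_weight_def)
  show ?thesis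
  proof (rule base_measure_eqI[OF M])
    fix J w assume J: "finite (J :: int set)"
    have pre: "(\<lambda>e. blocks e j) -` {w j} \<inter> space M = {e \<in> golden_base. blocks e j = w j}" for j
      unfolding M(2) by blast
    have "measure M (block_event J w) = (\<Prod>j\<in>J. letter_weight (w j))"
    proof (cases "J = {}")
      case True
      then show ?thesis using M.prob_space by (simp add: block_event_def M(2))
    next
      case False
      have "measure M (\<Inter>j\<in>J. (\<lambda>e. blocks e j) -` {w j} \<inter> space M) =
          (\<Prod>j\<in>J. measure M ((\<lambda>e. blocks e j) -` {w j} \<inter> space M))"
        by (rule M.indep_varsD[OF ind False J]) simp_all
      also have "(\<Inter>j\<in>J. (\<lambda>e. blocks e j) -` {w j} \<inter> space M) = block_event J w"
        unfolding pre block_event_def using False by auto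
      finally show ?thesis unfolding pre marg' .
    qed
    then show "emeasure M (block_event J w) = (\<Prod>j\<in>J. letter_weight (w j))"
      by (simp only: M.emeasure_eq_measure)
  qed
qed

lemma block_measure_eq: "block_measure = base_measure"
  unfolding block_measure_def
  by (rule the_equality, rule is_block_measure_base, rule is_block_measure_unique)

section \<open>The golden shift as an automorphism of the base\<close>

lemma measurable_base_shift:
  assumes f: "f \<in> base_measure \<rightarrow>\<^sub>M count_space (UNIV :: int set)"
    and base: "\<And>e. e \<in> golden_base \<Longrightarrow> (\<lambda>i. e (i + f e)) \<in> golden_base"
  shows "(\<lambda>e i. e (i + f e)) \<in> base_measure \<rightarrow>\<^sub>M base_measure"
proof -
  have comp: "(\<lambda>e. e i) \<in> base_measure \<rightarrow>\<^sub>M count_space UNIV" for i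
    using measurable_restrict_space1[OF measurable_borel_component]
      measurable_cong_sets[OF sets_base_measure refl] by blast
  have "(\<lambda>e. e (i + f e)) \<in> base_measure \<rightarrow>\<^sub>M count_space UNIV" for i
    by (rule measurable_compose_countable[OF comp f])
  then have "(\<lambda>e i. e (i + f e)) \<in> base_measure \<rightarrow>\<^sub>M borel"
    by (rule measurable_to_sequences)
  then have "(\<lambda>e i. e (i + f e)) \<in> base_measure \<rightarrow>\<^sub>M restrict_space borel golden_base"
    by (rule measurable_restrict_space2[rotated]) (use base in auto)
  then show ?thesis using measurable_cong_sets[OF refl sets_base_measure] by blast
qed

lemma measurable_block_length: "(\<lambda>e. length (blocks e j)) \<in> base_measure \<rightarrow>\<^sub>M count_space UNIV"
  by (rule measurable_compose[OF measurable_blocks]) simp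

lemma measurable_goldenshift: "goldenshift \<in> base_measure \<rightarrow>\<^sub>M base_measure"
proof -
  have eq: "goldenshift e = (\<lambda>i. e (i + int (length (blocks e 1))))" for e
    by (simp add: goldenshift_def two_sided_shift_power first_block_length_def)
  have "(\<lambda>e. int (length (blocks e 1))) \<in> base_measure \<rightarrow>\<^sub>M count_space UNIV"
    by (rule measurable_compose[OF measurable_block_length]) simp
  then have "(\<lambda>e i. e (i + int (length (blocks e 1)))) \<in> base_measure \<rightarrow>\<^sub>M base_measure"
    by (rule measurable_base_shift) (use goldenshift_blocks(1) in \<open>simp add: eq\<close>)
  then show ?thesis by (simp only: eq[abs_def])
qed

lemma measurable_goldenshift_inverse: "goldenshift_inverse \<in> base_measure \<rightarrow>\<^sub>M base_measure"
proof -
  have eq: "goldenshift_inverse e = (\<lambda>i. e (i + - int (length (blocks e 0))))" for e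
    by (simp add: goldenshift_inverse_def)
  have "(\<lambda>e. - int (length (blocks e 0))) \<in> base_measure \<rightarrow>\<^sub>M count_space UNIV"
    by (rule measurable_compose[OF measurable_block_length]) simp
  then have "(\<lambda>e i. e (i + - int (length (blocks e 0)))) \<in> base_measure \<rightarrow>\<^sub>M base_measure"
    by (rule measurable_base_shift) (use goldenshift_inverse(1) in \<open>simp add: eq\<close>)
  then show ?thesis by (simp only: eq[abs_def])
qed

text \<open>Shifting by one block renames the block indices, and the weights do not depend on the
  index.\<close>

lemma distr_goldenshift: "distr base_measure base_measure goldenshift = base_measure"
proof (rule base_measure_eqI)
  show "prob_space (distr base_measure base_measure goldenshift)"
    by (rule base.prob_space_distr[OF measurable_goldenshift])
  show "space (distr base_measure base_measure goldenshift) = golden_base" by simp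
  show "sets (distr base_measure base_measure goldenshift) = sets (restrict_space borel golden_base)"
    by (simp only: sets_distr sets_base_measure)
  fix J and w :: "int \<Rightarrow> bool list" assume J: "finite (J :: int set)"
  let ?J = "(\<lambda>j. j + 1) ` J" and ?w = "\<lambda>j. w (j - 1)"
  have "goldenshift e \<in> block_event J w \<longleftrightarrow> e \<in> block_event ?J ?w" if "e \<in> golden_base" for e
    using goldenshift_blocks[OF that] that by (simp add: block_event_def)
  then have "goldenshift -` block_event J w \<inter> space base_measure = block_event ?J ?w"
    unfolding space_base_measure by (auto simp: block_event_def)
  then have "emeasure (distr base_measure base_measure goldenshift) (block_event J w) =
      emeasure base_measure (block_event ?J ?w)"
    using emeasure_distr[OF measurable_goldenshift sets_block_event[OF J, of w]] by (simp only:)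
  also have "\<dots> = ennreal (\<Prod>j\<in>?J. letter_weight (?w j))" using J by (intro emeasure_block_event) simp
  also have "(\<Prod>j\<in>?J. letter_weight (?w j)) = (\<Prod>j\<in>J. letter_weight (w j))"
    by (subst prod.reindex) (simp_all add: inj_on_def comp_def)
  finally show "emeasure (distr base_measure base_measure goldenshift) (block_event J w) =
      (\<Prod>j\<in>J. letter_weight (w j))" .
qed

lemma measure_automorphism_goldenshift: "measure_automorphism base_measure goldenshift"
  unfolding measure_automorphism_def
proof (intro conjI bexI[OF _ measurable_goldenshift_inverse])
  show "AE e in base_measure. goldenshift_inverse (goldenshift e) = e"
    by (rule AE_I2) (simp add: goldenshift_inverse)
  show "AE e in base_measure. goldenshift (goldenshift_inverse e) = e"
    by (rule AE_I2) (simp add: goldenshift_inverse)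
qed (rule base.prob_space_axioms measurable_goldenshift distr_goldenshift)+

section \<open>Kac's formula\<close>

text \<open>The base points whose column has a floor \<open>j\<close> and meets \<open>E\<close>
  there.\<close>

definition tower_level :: "nat \<Rightarrow> (int \<Rightarrow> bool) set \<Rightarrow> (int \<Rightarrow> bool) set" where
  "tower_level j E = {e \<in> golden_base. j < first_block_length e \<and> (\<lambda>i. e (i + int j)) \<in> E}"

lemma tower_level_subset: "tower_level j E \<subseteq> golden_base"
  unfolding tower_level_def by blast

lemma less_first_block_length_iff:
  assumes e: "e \<in> golden_base"
  shows "j < first_block_length e \<longleftrightarrow> (\<forall>k. 0 < k \<and> k \<le> j \<longrightarrow> (\<lambda>i. e (i + int k)) \<notin> golden_base)"
proof -
  note c = first_block_length_cut[OF e]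
  have iff: "(\<lambda>i. e (i + int k)) \<in> golden_base \<longleftrightarrow> cut_at e (1 + int k)" for k
    by (rule golden_base_shift_iff[OF e])
  show ?thesis unfolding iff
  proof
    assume "j < first_block_length e"
    then show "\<forall>k. 0 < k \<and> k \<le> j \<longrightarrow> \<not> cut_at e (1 + int k)"
      using c unfolding consecutive_cuts_def by auto
  next
    assume *: "\<forall>k. 0 < k \<and> k \<le> j \<longrightarrow> \<not> cut_at e (1 + int k)"
    have "0 < first_block_length e" "cut_at e (1 + int (first_block_length e))"
      using c by (simp_all add: consecutive_cuts_def)
    then show "j < first_block_length e" using * by (meson not_le)
  qed
qed

text \<open>Floor \<open>j\<close> of the tower, recognized by looking backwards: \<open>j\<close>
  steps ago the orbit was in the base, and not since.\<close>

definition last_visit :: "nat \<Rightarrow> (int \<Rightarrow> bool) set" where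
  "last_visit j = {e \<in> golden_space. (\<lambda>i. e (i + - int j)) \<in> golden_base \<and>
     (\<forall>k<j. (\<lambda>i. e (i + - int k)) \<notin> golden_base)}"

lemma sets_last_visit: "last_visit j \<in> sets erdos_measure"
proof -
  let ?B = "\<lambda>k. {e \<in> golden_space. (\<lambda>i. e (i + - int k)) \<in> golden_base}"
  have B: "?B k \<in> sets erdos_measure" for k by (rule erdos_emeasure_shift(1)[OF sets_golden_base])
  have "(\<Union>k\<in>{..<j}. ?B k) \<in> sets erdos_measure"
    by (rule sets.finite_UN) (simp_all only: finite_lessThan B)
  then have "?B j - (\<Union>k\<in>{..<j}. ?B k) \<in> sets erdos_measure" by (rule sets.Diff[OF B])
  moreover have "last_visit j = ?B j - (\<Union>k\<in>{..<j}. ?B k)" unfolding last_visit_def by blast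
  ultimately show ?thesis by (simp only:)
qed

text \<open>The same column seen from its bottom and from floor \<open>j\<close>: no return within
  \<open>j\<close> steps is the same as no visit since. Shift invariance turns this into equality of
  measures.\<close>

lemma tower_level_eq:
  assumes "E \<subseteq> golden_space"
  shows "tower_level j E = {e \<in> golden_space. (\<lambda>i. e (i + int j)) \<in> E \<inter> last_visit j}"
proof (rule set_eqI)
  fix e
  show "e \<in> tower_level j E \<longleftrightarrow> e \<in> {e \<in> golden_space. (\<lambda>i. e (i + int j)) \<in> E \<inter> last_visit j}"
  proof (cases "e \<in> golden_base")
    case False
    then show ?thesis by (simp add: tower_level_def last_visit_def)
  next
    case True
    have "(\<forall>k<j. (\<lambda>i. e (i + - int k + int j)) \<notin> golden_base) \<longleftrightarrow>
        (\<forall>k. 0 < k \<and> k \<le> j \<longrightarrow> (\<lambda>i. e (i + int k)) \<notin> golden_base)"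
    proof (intro iffI allI impI)
      fix k assume *: "\<forall>k<j. (\<lambda>i. e (i + - int k + int j)) \<notin> golden_base" "0 < k \<and> k \<le> j"
      then have "(\<lambda>i. e (i + - int (j - k) + int j)) \<notin> golden_base"
        by (intro *(1)[rule_format]) linarith
      moreover have "i + - int (j - k) + int j = i + int k" for i using * by simp
      ultimately show "(\<lambda>i. e (i + int k)) \<notin> golden_base" by (simp only: simp_thms)
    next
      fix k assume *: "\<forall>k. 0 < k \<and> k \<le> j \<longrightarrow> (\<lambda>i. e (i + int k)) \<notin> golden_base" "k < j"
      then have "(\<lambda>i. e (i + int (j - k))) \<notin> golden_base"
        by (intro *(1)[rule_format]) linarith
      moreover have "i + - int k + int j = i + int (j - k)" for i using * by simp
      ultimately show "(\<lambda>i. e (i + - int k + int j)) \<notin> golden_base" by (simp only: simp_thms)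
    qed
    moreover have "e \<in> golden_space" using True by (simp add: golden_base_iff)
    ultimately show ?thesis
      using True less_first_block_length_iff[OF True, of j] golden_space_shift[of e "int j"]
      unfolding tower_level_def last_visit_def by simp blast
  qed
qed

lemma emeasure_tower_level:
  assumes "E \<in> sets erdos_measure"
  shows "tower_level j E \<in> sets erdos_measure"
    and "emeasure erdos_measure (tower_level j E) = emeasure erdos_measure (E \<inter> last_visit j)"
proof -
  have "E \<subseteq> golden_space" using assms unfolding sets_erdos_measure_iff by (rule conjunct2)
  note eq = tower_level_eq[OF this]
  have m: "E \<inter> last_visit j \<in> sets erdos_measure" by (rule sets.Int[OF assms sets_last_visit])
  show "tower_level j E \<in> sets erdos_measure" unfolding eq by (rule erdos_emeasure_shift(1)[OF m])
  show "emeasure erdos_measure (tower_level j E) = emeasure erdos_measure (E \<inter> last_visit j)"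
    unfolding eq by (rule erdos_emeasure_shift(2)[OF m])
qed

lemma last_visit_exists:
  assumes e: "e \<in> cut_recurrent" shows "\<exists>j. e \<in> last_visit j"
proof -
  obtain i where i: "i \<le> 1" "cut_at e i" using e unfolding cut_recurrent_def by blast
  then have ex: "(\<lambda>k. e (k + - int (nat (1 - i)))) \<in> golden_base"
    using cut_recurrent_shift_iff[OF e, of "- int (nat (1 - i))"] by simp
  define j where "j = (LEAST j. (\<lambda>k. e (k + - int j)) \<in> golden_base)"
  have "(\<lambda>k. e (k + - int j)) \<in> golden_base" unfolding j_def
    by (rule LeastI[where P = "\<lambda>j. (\<lambda>k. e (k + - int j)) \<in> golden_base", OF ex])
  moreover have "(\<lambda>i. e (i + - int k)) \<notin> golden_base" if "k < j" for k
    using not_less_Least[OF that[unfolded j_def]] .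
  ultimately show ?thesis using e unfolding last_visit_def cut_recurrent_def by blast
qed

text \<open>Almost every orbit was in the base at some time up to the present, so the sets
  \<open>last_visit j\<close> partition the space up to a null set.\<close>

lemma emeasure_erdos_tower:
  assumes E: "E \<in> sets erdos_measure"
  shows "emeasure erdos_measure E = (\<Sum>j. emeasure erdos_measure (tower_level j E))"
proof -
  have m: "E \<inter> last_visit j \<in> sets erdos_measure" for j by (rule sets.Int[OF E sets_last_visit])
  have "(\<Sum>j. emeasure erdos_measure (E \<inter> last_visit j)) = emeasure erdos_measure (\<Union>j. E \<inter> last_visit j)"
  proof (rule suminf_emeasure)
    show "range (\<lambda>j. E \<inter> last_visit j) \<subseteq> sets erdos_measure" using m by blast
    have "last_visit i \<inter> last_visit j = {}" if "i < j" for i j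
      using that unfolding last_visit_def by blast
    then show "disjoint_family (\<lambda>j. E \<inter> last_visit j)"
      unfolding disjoint_family_on_def by (metis (no_types, lifting) Int_assoc Int_commute Int_empty_right linorder_neqE_nat)
  qed
  also have "\<dots> = emeasure erdos_measure E"
  proof (rule emeasure_eq_AE)
    show "AE e in erdos_measure. e \<in> (\<Union>j. E \<inter> last_visit j) \<longleftrightarrow> e \<in> E"
      using AE_cut_recurrent
    proof eventually_elim
      case (elim e)
      then obtain j where "e \<in> last_visit j" using last_visit_exists by blast
      then show ?case by blast
    qed
    show "(\<Union>j. E \<inter> last_visit j) \<in> sets erdos_measure"
      by (rule sets.countable_UN'') (simp_all only: countableI_type m)
  qed (rule E)
  finally show ?thesis by (simp only: emeasure_tower_level(2)[OF E])
qed

text \<open>The sum at a base point counts the floors of its column that lie in \<open>E\<close>.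
  Exchanging it with the integral gives the measures of all tower levels, which add up to that of
  \<open>E\<close>.\<close>

lemma kac_formula:
  assumes E: "E \<in> sets erdos_measure"
  shows "(\<integral>\<^sup>+e. ennreal (\<Sum>j<first_block_length e. indicator E ((two_sided_shift ^^ j) e)) \<partial>base_measure) =
    ennreal (erdos.prob E / erdos.prob golden_base)"
proof -
  let ?f = "\<lambda>e. ennreal (\<Sum>j<first_block_length e. indicator E ((two_sided_shift ^^ j) e))"
  have T: "tower_level j E \<in> sets base_measure" for j
    unfolding sets_base_measure_iff using emeasure_tower_level(1)[OF E] tower_level_subset by (rule conjI)
  have pt: "?f e =
      (\<Sum>j. indicator (tower_level j E) e)" if e: "e \<in> golden_base" for e
  proof -
    have ind: "indicator (tower_level j E) e =
        (if j < first_block_length e then ennreal (indicator E ((two_sided_shift ^^ j) e)) else 0)" for j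
      using e unfolding tower_level_def two_sided_shift_power by (simp add: indicator_def)
    have "(\<Sum>j. indicator (tower_level j E) e :: ennreal) =
        (\<Sum>j<first_block_length e. indicator (tower_level j E) e)"
      by (rule suminf_finite) (simp_all add: ind)
    also have "\<dots> = (\<Sum>j<first_block_length e. ennreal (indicator E ((two_sided_shift ^^ j) e)))"
      by (rule sum.cong) (simp_all add: ind)
    also have "\<dots> = ?f e"
      by (rule sum_ennreal) simp
    finally show ?thesis by (rule sym)
  qed
  have "(\<integral>\<^sup>+e. ?f e \<partial>base_measure) =
      (\<integral>\<^sup>+e. (\<Sum>j. indicator (tower_level j E) e) \<partial>base_measure)"
    by (rule nn_integral_cong) (simp only: space_base_measure pt)
  also have "\<dots> = (\<Sum>j. \<integral>\<^sup>+e. indicator (tower_level j E) e \<partial>base_measure)"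
    by (rule nn_integral_suminf) (rule borel_measurable_indicator[OF T])
  also have "\<dots> = (\<Sum>j. emeasure base_measure (tower_level j E))"
    by (simp only: nn_integral_indicator[OF T])
  also have "\<dots> = (\<Sum>j. emeasure erdos_measure (tower_level j E) / emeasure erdos_measure golden_base)"
  proof (rule suminf_cong)
    fix j
    have "emeasure base_measure (tower_level j E) = ennreal (erdos.prob (tower_level j E) / erdos.prob golden_base)"
      by (rule emeasure_base_measure[OF emeasure_tower_level(1)[OF E] tower_level_subset])
    also have "\<dots> = emeasure erdos_measure (tower_level j E) / emeasure erdos_measure golden_base"
      unfolding erdos.emeasure_eq_measure by (rule divide_ennreal[OF measure_nonneg erdos_golden_base_pos, symmetric])
    finally show "emeasure base_measure (tower_level j E) =
      emeasure erdos_measure (tower_level j E) / emeasure erdos_measure golden_base" .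
  qed
  also have "\<dots> = (\<Sum>j. emeasure erdos_measure (tower_level j E)) / emeasure erdos_measure golden_base"
    by (rule ennreal_suminf_divide)
  also have "\<dots> = emeasure erdos_measure E / emeasure erdos_measure golden_base"
    by (simp only: emeasure_erdos_tower[OF E, symmetric])
  also have "\<dots> = ennreal (erdos.prob E / erdos.prob golden_base)"
    unfolding erdos.emeasure_eq_measure by (rule divide_ennreal[OF measure_nonneg erdos_golden_base_pos])
  finally show ?thesis .
qed

lemma integral_base_tower:
  assumes E: "E \<in> sets erdos_measure"
  shows "integrable base_measure (\<lambda>e. \<Sum>j<first_block_length e. indicator E ((two_sided_shift ^^ j) e) :: real)"
    and "(\<integral>e. (\<Sum>j<first_block_length e. indicator E ((two_sided_shift ^^ j) e)) \<partial>base_measure) =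
      erdos.prob E / erdos.prob golden_base"
proof -
  let ?f = "\<lambda>e. \<Sum>j<first_block_length e. indicator E ((two_sided_shift ^^ j) e) :: real"
  have T: "tower_level j E \<in> sets base_measure" for j
    unfolding sets_base_measure_iff using emeasure_tower_level(1)[OF E] tower_level_subset by (rule conjI)
  have len: "first_block_length \<in> base_measure \<rightarrow>\<^sub>M count_space UNIV"
    using measurable_block_length[of 1] by (simp only: first_block_length_def[abs_def])
  \<comment> \<open>The upper limit of the sum varies with \<open>e\<close>: measurability is shown
    for a fixed limit \<open>n\<close>, and a countable composition then inserts
    \<open>first_block_length\<close>.\<close>
  have "(\<lambda>e. \<Sum>j<n. indicator (tower_level j E) e :: real) \<in> borel_measurable base_measure" for n
    by (rule borel_measurable_sum) (rule borel_measurable_indicator[OF T])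
  from measurable_compose_countable[OF this len]
  have "(\<lambda>e. \<Sum>j<first_block_length e. indicator (tower_level j E) e :: real) \<in> borel_measurable base_measure" .
  moreover have "?f e = (\<Sum>j<first_block_length e. indicator (tower_level j E) e)" if "e \<in> golden_base" for e
    by (rule sum.cong[OF refl]) (use that in \<open>simp add: tower_level_def two_sided_shift_power indicator_def\<close>)
  ultimately have meas: "?f \<in> borel_measurable base_measure"
    by (subst measurable_cong[where g = "\<lambda>e. \<Sum>j<first_block_length e. indicator (tower_level j E) e"])
       (simp_all only: space_base_measure)
  have nonneg: "AE e in base_measure. 0 \<le> ?f e"
    by (rule AE_I2) (simp add: sum_nonneg)
  have int: "has_bochner_integral base_measure ?f (erdos.prob E / erdos.prob golden_base)"
    by (rule has_bochner_integral_nn_integral[OF meas nonneg _ kac_formula[OF E]]) simp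
  show "integrable base_measure ?f" using int by (rule integrable.intros)
  show "integral\<^sup>L base_measure ?f = erdos.prob E / erdos.prob golden_base"
    using int by (rule has_bochner_integral_integral_eq)
qed

theorem theorem2p12:
  shows "special_automorphism erdos_measure two_sided_shift block_measure goldenshift first_block_length"
  unfolding special_automorphism_def block_measure_eq space_base_measure
proof (intro conjI ballI)
  have full: "(\<Sum>j<first_block_length e. indicator golden_space ((two_sided_shift ^^ j) e) :: real) =
      real (first_block_length e)" if "e \<in> golden_base" for e
  proof -
    have "(two_sided_shift ^^ j) e \<in> golden_space" for j
      unfolding two_sided_shift_power using that by (intro golden_space_shift) (simp add: golden_base_iff)
    then show ?thesis by simp
  qed
  have top: "golden_space \<in> sets erdos_measure" using sets.top[of erdos_measure] by simp
  have prob_top: "erdos.prob golden_space = 1" using erdos.prob_space by simp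
  show int: "integrable base_measure (\<lambda>e. real (first_block_length e))"
    using integral_base_tower(1)[OF top]
    by (rule Bochner_Integration.integrable_cong[OF refl, THEN iffD1, rotated]) (simp add: full)
  \<comment> \<open>For the whole space every floor counts, so the mean roof is the reciprocal of
    the measure of the base; this is the normalizing factor of the formula.\<close>
  have mean: "(\<integral>e. real (first_block_length e) \<partial>base_measure) = 1 / erdos.prob golden_base"
    using integral_base_tower(2)[OF top] unfolding prob_top
    by (rule trans[OF Bochner_Integration.integral_cong[OF refl], rotated]) (simp add: full)
  show "erdos.prob E = 1 / (\<integral>e. real (first_block_length e) \<partial>base_measure) *
      (\<integral>e. (\<Sum>j<first_block_length e. indicator E ((two_sided_shift ^^ j) e)) \<partial>base_measure)"
    if "E \<in> sets erdos_measure" for E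
    unfolding mean integral_base_tower(2)[OF that] using erdos_golden_base_pos by simp
  show "AE e in base_measure. (\<exists>n>0. (two_sided_shift ^^ n) e \<in> golden_base) \<and>
      first_block_length e = first_return_time two_sided_shift golden_base e \<and>
      goldenshift e = first_return_map two_sided_shift golden_base e"
    (is "AE e in _. ?P e")
  proof (rule AE_I2)
    fix e assume "e \<in> space base_measure"
    then have "e \<in> golden_base" by simp
    note r = first_return_time_golden_base[OF this]
    show "?P e"
      unfolding first_return_map_def r(3) goldenshift_def using r(1,2) by blast
  qed
  show "sets base_measure = sets (restrict_space erdos_measure golden_base)"
  proof (rule set_eqI)
    fix A
    have "golden_base \<inter> space erdos_measure \<in> sets erdos_measure"
      using sets_golden_base sets.top sets.Int by blast
    from sets_restrict_space_iff[OF this, of A]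
    show "A \<in> sets base_measure \<longleftrightarrow> A \<in> sets (restrict_space erdos_measure golden_base)"
      unfolding sets_base_measure_iff by blast
  qed
qed (rule measure_automorphism_erdos measure_automorphism_goldenshift sets_golden_base)+

end
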